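(* Let $F\in L^\infty(\mathbb{C}^d)$. The Toeplitz operator $T^{\mathcal{F}^2}_F$ is a compact operator on $\mathcal{F}^2(\mathbb{C}^d)$ if and only if $$f\ast|V_{\varphi_0}\varphi_0|^2\in C_0(\mathbb{R}^{2d}),$$ where $f(x,\omega)=F(x-i\omega)$ for $x,\omega\in\mathbb{R}^d$ and $|V_{\varphi_0}\varphi_0(z)|^2=e^{-\pi|z|^2}$ for $z\in\mathbb{R}^{2d}$.
   Context: $\mathcal{F}^2(\mathbb{C}^d)$ is the Bargmann-Fock space: the Hilbert space of entire functions $F$ on $\mathbb{C}^d$ with $\int_{\mathbb{C}^d}|F(z)|^2e^{-\pi|z|^2}\,dz<\infty$, a closed subspace of $L^2(\mathbb{C}^d,e^{-\pi|z|^2}dz)$, with orthogonal projection $\mathcal{P}_{\mathcal{F}^2}$. For $F\in L^\infty(\mathbb{C}^d)$, $T_F^{\mathcal{F}^2}(H)=\mathcal{P}_{\mathcal{F}^2}(F\cdot H)$ for $H\in\mathcal{F}^2(\mathbb{C}^d)$. $\varphi_0(t)=2^{d/4}e^{-\pi|t|^2}$ on $\mathbb{R}^d$, and $V_{\varphi_0}\varphi_0(x,\omega)=\int_{\mathbb{R}^d}\varphi_0(t)\overline{\varphi_0(t-x)}e^{-2\pi i\omega\cdot t}\,dt$. $\ast$ is the convolution of functions on $\mathbb{R}^{2d}$. *)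

theory Defs
  imports "HOL-Analysis.Analysis"
begin

section \<open>Function spaces\<close>

text \<open>Elements of \<open>L\<^sup>\<infinity>\<close> and \<open>L\<^sup>2\<close> are represented by functions, not by classes modulo
  null sets; integrals, and hence \<open>convolution\<close>, \<open>fock_proj\<close> and \<open>toeplitz\<close> below, do not depend
  on the representative.\<close>

definition Linfty :: "('a::euclidean_space \<Rightarrow> complex) set" where
  "Linfty = {f \<in> borel_measurable lebesgue. \<exists>C. AE z in lebesgue. cmod (f z) \<le> C}"

definition C0 :: "('a::euclidean_space \<Rightarrow> complex) set" where
  "C0 = {h. continuous_on UNIV h \<and> (h \<longlongrightarrow> 0) at_infinity}"

definition convolution ::
    "('a::euclidean_space \<Rightarrow> complex) \<Rightarrow> ('a \<Rightarrow> complex) \<Rightarrow> 'a \<Rightarrow> complex" where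
  "convolution f g z = (LINT w|lebesgue. f w * g (z - w))"


section \<open>Short-time Fourier transform\<close>

definition gauss0 :: "real^'n \<Rightarrow> complex" where
  "gauss0 t = complex_of_real (2 powr (real CARD('n) / 4) * exp (- pi * (norm t)\<^sup>2))"

definition stft :: "(real^'n \<Rightarrow> complex) \<Rightarrow> (real^'n \<Rightarrow> complex) \<Rightarrow> (real^'n) \<times> (real^'n) \<Rightarrow> complex" where
  "stft g f = (\<lambda>(x, \<omega>).
     LINT t|lebesgue. f t * cnj (g (t - x)) * exp (- 2 * complex_of_real pi * \<i> * complex_of_real (\<omega> \<bullet> t)))"


section \<open>Bargmann-Fock space and Toeplitz operators\<close>

text \<open>Entire means complex Frechet differentiable everywhere: \<open>has_derivative\<close> only provides
  a real-linear derivative, hence the extra homogeneity condition.\<close>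

definition entire :: "(complex^'n \<Rightarrow> complex) \<Rightarrow> bool" where
  "entire H \<longleftrightarrow>
     (\<forall>z. \<exists>D. (H has_derivative D) (at z) \<and> (\<forall>c v. D (c *s v) = c * D v))"

definition fock_measure :: "(complex^'n) measure" where
  "fock_measure = density lebesgue (\<lambda>z. ennreal (exp (- pi * (norm z)\<^sup>2)))"

definition fock :: "(complex^'n \<Rightarrow> complex) set" where
  "fock = {H. entire H \<and> integrable fock_measure (\<lambda>z. (cmod (H z))\<^sup>2)}"

definition fock_inner :: "(complex^'n \<Rightarrow> complex) \<Rightarrow> (complex^'n \<Rightarrow> complex) \<Rightarrow> complex" where
  "fock_inner G H = (LINT z|fock_measure. G z * cnj (H z))"

definition fock_norm :: "(complex^'n \<Rightarrow> complex) \<Rightarrow> real" where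
  "fock_norm H = sqrt (LINT z|fock_measure. (cmod (H z))\<^sup>2)"

definition fock_dist :: "(complex^'n \<Rightarrow> complex) \<Rightarrow> (complex^'n \<Rightarrow> complex) \<Rightarrow> real" where
  "fock_dist G H = fock_norm (\<lambda>z. G z - H z)"

text \<open>Orthogonal projection of \<open>L\<^sup>2(fock_measure)\<close> onto \<^const>\<open>fock\<close>. The element is unique as
  a function, since entire functions that agree almost everywhere are equal.\<close>

definition fock_proj :: "(complex^'n \<Rightarrow> complex) \<Rightarrow> complex^'n \<Rightarrow> complex" where
  "fock_proj G = (THE K. K \<in> fock \<and> (\<forall>H\<in>fock. fock_inner (\<lambda>z. G z - K z) H = 0))"

definition toeplitz ::
    "(complex^'n \<Rightarrow> complex) \<Rightarrow> (complex^'n \<Rightarrow> complex) \<Rightarrow> complex^'n \<Rightarrow> complex" where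
  "toeplitz F H = fock_proj (\<lambda>z. F z * H z)"

definition fock_compact_operator ::
    "((complex^'n \<Rightarrow> complex) \<Rightarrow> complex^'n \<Rightarrow> complex) \<Rightarrow> bool" where
  "fock_compact_operator T \<longleftrightarrow>
     T ` fock \<subseteq> fock \<and>
     (\<forall>a b. \<forall>G\<in>fock. \<forall>H\<in>fock.
        T (\<lambda>z. a * G z + b * H z) = (\<lambda>z. a * T G z + b * T H z)) \<and>
     (\<forall>B. Metric_space.mbounded fock fock_dist B \<longrightarrow>
        compactin (Metric_space.mtopology fock fock_dist)
          (Metric_space.mtopology fock fock_dist closure_of (T ` B)))"

end

theory Submission
  imports "HOL-Probability.Distributions" "HOL-Complex_Analysis.Great_Picard" Defs
begin

text \<open>
  Throughout, a function \<open>H\<close> on \<open>\<complex>\<^sup>n\<close> is paired with \<open>wtd H z = H z e^(-\<pi>|z|\<^sup>2/2)\<close>; in these terms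
  the Fock norm is the norm of \<open>L\<^sup>2\<close> for Lebesgue measure, and orthogonal projection onto the Fock
  space is integration against \<open>kern z w\<close>, the inner product of the normalised coherent states at
  \<open>w\<close> and \<open>z\<close>, whose modulus is the Gaussian \<open>e^(-\<pi>|z-w|\<^sup>2/2)\<close>. The reproducing formula behind this
  comes from the mean value property, which holds because Gaussian measure is invariant under
  \<open>w \<mapsto> e\<^sup>i\<^sup>\<theta> w\<close>.

  Under \<open>(x, \<omega>) \<mapsto> x - i\<omega>\<close>, an isometry, the convolution in the theorem becomes the Berezin transform
  \<open>berezin F w = \<integral> F (w + y) e^(-\<pi>|y|\<^sup>2) dy\<close>, which is the diagonal matrix element of the Toeplitz
  operator at the coherent state of \<open>w\<close>. It is always continuous, so the claim is that the
  operator is compact exactly if its Berezin transform vanishes at infinity.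

  If the operator is compact, then along a sequence \<open>w\<^sub>n \<rightarrow> \<infinity>\<close> the images of the coherent states have
  a norm limit \<open>L\<close> after passing to a subsequence; as every Fock function satisfies \<open>wtd L \<rightarrow> 0\<close> at
  infinity, so do the diagonal matrix elements (\<open>berezin_vanishes_if_compact\<close>).

  For the converse, the decay of the diagonal forces the decay of the matrix elements
  \<open>toeplitz_kern F (w + v) w\<close> for every fixed offset \<open>v\<close>. Up to a factor independent of \<open>w\<close> and a
  phase they equal \<open>\<integral> F (w + y) e^(\<pi> v\<cdot>y\<^sup>*) e^(-\<pi>|y|\<^sup>2) dy\<close>, where \<open>v\<cdot>y\<^sup>*\<close> is the Hermitian product.
  Replacing the exponent by \<open>\<alpha> p(y) + \<beta> q(y)\<close>, with \<open>p\<close> and \<open>q\<close> multiples of its real and imaginary part,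
  gives for real \<open>\<alpha>, \<beta>\<close> a multiple of a translate of the Berezin transform, and the integral is
  entire in \<open>\<alpha>\<close> and in \<open>\<beta>\<close>, locally uniformly bounded in \<open>w\<close>. By Montel's theorem, convergence to 0
  at real parameters implies convergence to 0 at complex parameters (\<open>vanishing_from_real_axis\<close>).
  This takes the place of a Tauberian theorem. The matrix elements also have the Gaussian bound
  \<open>C e^(-\<pi>|z-w|\<^sup>2/8)\<close>, so by dominated convergence the column integrals \<open>\<kappa> w = \<integral> |toeplitz_kern F z w| dz\<close>
  tend to 0 at infinity. The Schur test bounds the squared norm of the image of \<open>h\<close> by a constant
  times \<open>\<integral> \<kappa> w |wtd h w|\<^sup>2 dw\<close>, which tends to 0 along every bounded sequence that converges
  to 0 pointwise (\<open>toeplitz_norm_null_sequence\<close>). Since bounded sequences in the Fock space have pointwise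
  convergent subsequences with limit in the space, this is compactness.
\<close>

section \<open>Gaussian integrals\<close>

lemma nn_integral_gauss_real:
  assumes "a > 0"
  shows "(\<integral>\<^sup>+x. ennreal (exp (- a * x\<^sup>2)) \<partial>lborel) = ennreal (sqrt (pi / a))"
proof -
  define s where "s = sqrt (1 / (2 * a))"
  have s2: "s\<^sup>2 = 1 / (2 * a)" and s: "s > 0" using assms by (auto simp: s_def)
  have c: "sqrt (2 * pi * s\<^sup>2) = sqrt (pi / a)" "sqrt (pi / a) > 0" using assms by (simp_all add: s2)
  have e: "exp (- a * x\<^sup>2) = sqrt (pi / a) * normal_density 0 s x" for x
    using c assms unfolding normal_density_def by (simp add: s2 field_simps)
  have "(\<integral>\<^sup>+x. ennreal (exp (- a * x\<^sup>2)) \<partial>lborel) = ennreal (sqrt (pi / a)) * (\<integral>\<^sup>+x. ennreal (normal_density 0 s x) \<partial>lborel)"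
    unfolding e using c by (simp add: ennreal_mult' nn_integral_cmult)
  also have "(\<integral>\<^sup>+x. ennreal (normal_density 0 s x) \<partial>lborel) = 1"
    using s by (subst nn_integral_eq_integral) auto
  finally show ?thesis by simp
qed

lemma nn_integral_gauss:
  assumes "a > 0"
  shows "(\<integral>\<^sup>+x. ennreal (exp (- a * (norm x)\<^sup>2)) \<partial>(lborel :: 'a::euclidean_space measure))
    = ennreal (sqrt (pi / a) ^ DIM('a))"
proof -
  have "exp (- a * (norm x)\<^sup>2) = (\<Prod>b\<in>Basis. exp (- a * (x \<bullet> b)\<^sup>2))" for x :: 'a
    unfolding power2_norm_eq_inner euclidean_inner [of x x]
    by (simp add: exp_sum [symmetric] sum_distrib_left [symmetric] power2_eq_square sum_negf)
  then have "(\<integral>\<^sup>+x. ennreal (exp (- a * (norm x)\<^sup>2)) \<partial>(lborel :: 'a measure))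
     = (\<integral>\<^sup>+x. (\<Prod>b\<in>Basis. ennreal (exp (- a * (x \<bullet> b)\<^sup>2))) \<partial>(lborel :: 'a measure))"
    by (simp add: prod_ennreal)
  also have "\<dots> = (\<Prod>b\<in>(Basis::'a set). \<integral>\<^sup>+x. ennreal (exp (- a * x\<^sup>2)) \<partial>lborel)"
    by (rule nn_integral_lborel_prod) auto
  also have "\<dots> = ennreal (sqrt (pi / a) ^ DIM('a))"
    using assms by (simp only: nn_integral_gauss_real [OF assms])
       (simp add: ennreal_power)
  finally show ?thesis .
qed

lemma has_bochner_integral_gauss:
  assumes "a > 0"
  shows "has_bochner_integral lborel (\<lambda>x::'a::euclidean_space. exp (- a * (norm x)\<^sup>2)) (sqrt (pi / a) ^ DIM('a))"
  using nn_integral_gauss [OF assms, where 'a='a] assms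
  by (intro has_bochner_integral_nn_integral) auto

text \<open>A single term of the exponential series is at most its sum.\<close>

lemma power_le_fact_exp: "0 \<le> x \<Longrightarrow> x ^ k \<le> fact k * exp (x::real)"
proof -
  assume x: "0 \<le> x"
  have "x ^ k / fact k \<le> (\<Sum>n\<in>{..k}. x ^ n / fact n)"
    using x by (intro member_le_sum [of k "{..k}" "\<lambda>n. x ^ n / fact n"]) auto
  also have "\<dots> \<le> exp x" 
    using x sum_le_suminf [of "\<lambda>n. x ^ n / fact n" "{..k}"] summable_exp [of x]
    by (simp add: exp_def field_simps)
  finally show ?thesis by (simp add: field_simps)
qed

text \<open>A factor \<open>|x|\<^sup>k e^(c|x|)\<close> costs at most half of the Gaussian decay, by completing a square; this
  serves as the dominating function for all parameter integrals below.\<close>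

lemma integrable_gauss_weight:
  assumes "a > 0"
  shows "integrable lborel (\<lambda>x::'a::euclidean_space. norm x ^ k * exp (c * norm x - a * (norm x)\<^sup>2))"
proof (rule Bochner_Integration.integrable_bound)
  \<comment> \<open>the bound \<open>(1 + c)|x| - a|x|\<^sup>2/2 \<le> (1 + c)\<^sup>2/(2a)\<close> with the 1 absorbing \<open>|x|\<^sup>k\<close>\<close>
  define C where "C = fact k * exp ((1 + c)\<^sup>2 / (2 * a))"
  show "integrable lborel (\<lambda>x::'a. C * exp (- (a/2) * (norm x)\<^sup>2))"
    using has_bochner_integral_gauss [of "a/2", where 'a='a] assms
    by (intro integrable_mult_right) (auto simp: has_bochner_integral_iff)
  show "AE x in lborel. norm (norm x ^ k * exp (c * norm x - a * (norm x)\<^sup>2)) \<le> norm (C * exp (- (a/2) * (norm (x::'a))\<^sup>2))"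
  proof (intro AE_I2)
    fix x :: 'a
    have "0 \<le> (a * norm x - (1 + c))\<^sup>2" by simp
    then have "(1 + c) * norm x \<le> (1 + c)\<^sup>2 / (2 * a) + (a / 2) * (norm x)\<^sup>2"
      using assms by (simp add: field_simps power2_eq_square)
    then have *: "norm x + (c * norm x - a * (norm x)\<^sup>2) \<le> (1 + c)\<^sup>2 / (2 * a) + - (a / 2) * (norm x)\<^sup>2"
      by (simp add: algebra_simps)
    have "norm x ^ k * exp (c * norm x - a * (norm x)\<^sup>2) \<le> fact k * exp (norm x) * exp (c * norm x - a * (norm x)\<^sup>2)"
      by (intro mult_right_mono power_le_fact_exp) auto
    also have "\<dots> = fact k * exp (norm x + (c * norm x - a * (norm x)\<^sup>2))" by (simp add: exp_add)
    also have "\<dots> \<le> fact k * exp ((1 + c)\<^sup>2 / (2 * a) + - (a / 2) * (norm x)\<^sup>2)"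
      using * by (intro mult_left_mono) auto
    also have "\<dots> = C * exp (- (a/2) * (norm x)\<^sup>2)" unfolding C_def exp_add by (simp only: mult.assoc)
    finally show "norm (norm x ^ k * exp (c * norm x - a * (norm x)\<^sup>2)) \<le> norm (C * exp (- (a/2) * (norm x)\<^sup>2))"
      by (simp add: C_def)
  qed
qed auto

section \<open>Invariance of Lebesgue measure under isometries\<close>

lemma nn_integral_lborel_plus:
  fixes t :: "'a::euclidean_space"
  assumes "f \<in> borel_measurable borel"
  shows "(\<integral>\<^sup>+x. f (x + t) \<partial>lborel) = (\<integral>\<^sup>+x. f x \<partial>lborel)"
  by (subst (2) lborel_distr_plus [of t, symmetric]) (simp add: nn_integral_distr assms add.commute)

lemma nn_integral_lborel_uminus:
  fixes f :: "'a::euclidean_space \<Rightarrow> ennreal"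
  assumes "f \<in> borel_measurable borel"
  shows "(\<integral>\<^sup>+x. f (- x) \<partial>lborel) = (\<integral>\<^sup>+x. f x \<partial>lborel)"
proof -
  have "lborel = density (distr lborel borel (\<lambda>x. 0 + (-1::real) *\<^sub>R (x::'a))) (\<lambda>_. \<bar>-1::real\<bar> ^ DIM('a))"
    by (rule lborel_affine) simp
  then have *: "lborel = distr lborel borel (\<lambda>x::'a. - x)" by (simp add: density_1)
  show ?thesis
    by (subst (2) *, subst nn_integral_distr) (use assms in auto)
qed

text \<open>By Tonelli, two translation-invariant \<open>\<sigma>\<close>-finite measures \<open>\<lambda>\<close> and \<open>\<nu>\<close>, the second one symmetric under \<open>y \<mapsto> -y\<close>,
  satisfy \<open>\<integral> g d\<lambda> \<integral> f d\<nu> = \<integral> f d\<lambda> \<integral> g d\<nu>\<close>. For Lebesgue measure and its image under \<open>T\<close>, taking for \<open>g\<close>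
  the Gaussian, whose integral is 1 against both because \<open>T\<close> is isometric, shows that they coincide.\<close>

lemma distr_lborel_isometry:
  fixes T :: "'a::euclidean_space \<Rightarrow> 'b::euclidean_space"
  assumes "linear T" and iso: "\<And>x. norm (T x) = norm x" and surj: "surj T"
  shows "distr lborel borel T = lborel"
proof -
  interpret T: linear T by fact
  have contT: "continuous_on UNIV T" by (rule linear_continuous_on) (simp add: linear_conv_bounded_linear [symmetric] assms)
  then have mT [measurable]: "T \<in> borel_measurable borel" by (rule borel_measurable_continuous_onI)
  define g :: "'b \<Rightarrow> ennreal" where "g = (\<lambda>x. ennreal (exp (- pi * (norm x)\<^sup>2)))"
  have mg [measurable]: "g \<in> borel_measurable borel" unfolding g_def by measurable
  have g1: "(\<integral>\<^sup>+x. g x \<partial>lborel) = 1"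
    unfolding g_def using nn_integral_gauss [of pi, where 'a='b] by simp
  have gT: "(\<integral>\<^sup>+y. g (x - T y) \<partial>lborel) = 1" for x
  proof -
    obtain a where a: "T a = x" using surj by (metis surjD)
    have "(\<integral>\<^sup>+y. g (x - T y) \<partial>lborel) = (\<integral>\<^sup>+y. (\<lambda>y. g (T (a - y))) y \<partial>lborel)"
      by (simp add: T.diff a)
    also have "\<dots> = (\<integral>\<^sup>+y. g (T (a - - y)) \<partial>lborel)"
      by (rule nn_integral_lborel_uminus [symmetric]) measurable
    also have "\<dots> = (\<integral>\<^sup>+y. (\<lambda>y. g (T y)) (y + a) \<partial>lborel)" by (simp add: add.commute)
    also have "\<dots> = (\<integral>\<^sup>+y. g (T y) \<partial>lborel)"
      by (rule nn_integral_lborel_plus [where f = "\<lambda>y. g (T y)"]) measurable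
    also have "\<dots> = 1"
      unfolding g_def iso using nn_integral_gauss [of pi, where 'a='a] by simp
    finally show ?thesis .
  qed
  have "(\<integral>\<^sup>+y. f (T y) \<partial>lborel) = (\<integral>\<^sup>+x. f x \<partial>lborel)" if [measurable]: "f \<in> borel_measurable borel" for f :: "'b \<Rightarrow> ennreal"
  proof -
    have "(\<integral>\<^sup>+y. f (T y) \<partial>lborel) = (\<integral>\<^sup>+y. (\<integral>\<^sup>+x. g x * f (T y) \<partial>lborel) \<partial>lborel)"
      by (simp add: nn_integral_multc g1)
    also have "\<dots> = (\<integral>\<^sup>+x. (\<integral>\<^sup>+y. g x * f (T y) \<partial>lborel) \<partial>lborel)"
      by (rule lborel_pair.Fubini') measurable
    also have "\<dots> = (\<integral>\<^sup>+x. (\<integral>\<^sup>+y. g x * f (T y + x) \<partial>lborel) \<partial>lborel)"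
    proof (rule nn_integral_cong)
      fix x
      obtain a where a: "T a = x" using surj by (metis surjD)
      have "(\<integral>\<^sup>+y. g x * f (T y + x) \<partial>lborel) = (\<integral>\<^sup>+y. (\<lambda>y. g x * f (T y)) (y + a) \<partial>lborel)"
        by (simp add: T.add a)
      also have "\<dots> = (\<integral>\<^sup>+y. g x * f (T y) \<partial>lborel)"
        by (rule nn_integral_lborel_plus [where f = "\<lambda>y. g x * f (T y)"]) measurable
      finally show "(\<integral>\<^sup>+y. g x * f (T y) \<partial>lborel) = (\<integral>\<^sup>+y. g x * f (T y + x) \<partial>lborel)" by simp
    qed
    also have "\<dots> = (\<integral>\<^sup>+y. (\<integral>\<^sup>+x. g x * f (T y + x) \<partial>lborel) \<partial>lborel)"
      by (rule lborel_pair.Fubini') measurable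
    also have "\<dots> = (\<integral>\<^sup>+y. (\<integral>\<^sup>+x. g (x - T y) * f x \<partial>lborel) \<partial>lborel)"
    proof (rule nn_integral_cong)
      fix y
      show "(\<integral>\<^sup>+x. g x * f (T y + x) \<partial>lborel) = (\<integral>\<^sup>+x. g (x - T y) * f x \<partial>lborel)"
        using nn_integral_lborel_plus [of "\<lambda>x. g (x - T y) * f x" "T y"] by (simp add: add.commute)
    qed
    also have "\<dots> = (\<integral>\<^sup>+x. (\<integral>\<^sup>+y. g (x - T y) * f x \<partial>lborel) \<partial>lborel)"
      by (rule lborel_pair.Fubini') measurable
    also have "\<dots> = (\<integral>\<^sup>+x. f x \<partial>lborel)"
      by (simp add: nn_integral_multc gT)
    finally show ?thesis .
  qed
  note main = this
  show ?thesis
  proof (rule measure_eqI)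
    fix A :: "'b set" assume A: "A \<in> sets (distr lborel borel T)"
    then have [measurable]: "A \<in> sets borel" by simp
    have "emeasure (distr lborel borel T) A = (\<integral>\<^sup>+x. indicator A x \<partial>distr lborel borel T)"
      using A by (simp add: nn_integral_indicator)
    also have "\<dots> = (\<integral>\<^sup>+y. indicator A (T y) \<partial>lborel)"
      by (rule nn_integral_distr) measurable
    also have "\<dots> = (\<integral>\<^sup>+y. indicator A y \<partial>lborel)" by (rule main) measurable
    finally show "emeasure (distr lborel borel T) A = emeasure lborel A" by simp
  qed simp
qed

lemma
  fixes t :: "'a::euclidean_space" and f :: "'a \<Rightarrow> 'b::{banach, second_countable_topology}"
  assumes [measurable]: "f \<in> borel_measurable borel"
  shows integral_lborel_plus: "(LINT x|lborel. f (x + t)) = (LINT x|lborel. f x)"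
    and integrable_lborel_plus: "integrable lborel (\<lambda>x. f (x + t)) \<longleftrightarrow> integrable lborel f"
proof -
  have *: "(lborel :: 'a measure) = distr lborel borel (\<lambda>x. x + t)"
  proof -
    have "(\<lambda>x. x + t) = (+) t" by (simp add: fun_eq_iff add.commute)
    then show ?thesis by (simp add: lborel_distr_plus)
  qed
  show "(LINT x|lborel. f (x + t)) = (LINT x|lborel. f x)"
    by (subst (2) *, subst integral_distr) auto
  show "integrable lborel (\<lambda>x. f (x + t)) \<longleftrightarrow> integrable lborel f"
    by (subst (2) *, subst integrable_distr_eq) auto
qed

lemma
  fixes T :: "'a::euclidean_space \<Rightarrow> 'b::euclidean_space" and f :: "'b \<Rightarrow> 'c::{banach, second_countable_topology}"
  assumes T: "linear T" "\<And>x. norm (T x) = norm x" "surj T"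
    and [measurable]: "f \<in> borel_measurable borel"
  shows integral_lborel_isometry: "(LINT x|lborel. f (T x)) = (LINT x|lborel. f x)"
    and integrable_lborel_isometry: "integrable lborel (\<lambda>x. f (T x)) \<longleftrightarrow> integrable lborel f"
proof -
  have [measurable]: "T \<in> borel_measurable borel"
    using T(1) by (intro borel_measurable_continuous_onI linear_continuous_on)
      (simp add: linear_conv_bounded_linear [symmetric])
  note * = distr_lborel_isometry [OF T, symmetric]
  show "(LINT x|lborel. f (T x)) = (LINT x|lborel. f x)"
    by (subst *, subst integral_distr) auto
  show "integrable lborel (\<lambda>x. f (T x)) \<longleftrightarrow> integrable lborel f"
    by (subst *, subst integrable_distr_eq) auto
qed

lemma
  fixes z :: "'a::euclidean_space"
  assumes "a > 0"
  shows integrable_gauss_shift: "integrable lborel (\<lambda>w. exp (- a * (norm (z - w))\<^sup>2))"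
    and integral_gauss_shift: "(LINT w|lborel. exp (- a * (norm (z - w))\<^sup>2)) = sqrt (pi / a) ^ DIM('a)"
  using integrable_lborel_plus [of "\<lambda>w. exp (- a * (norm w)\<^sup>2)" "- z"]
    integral_lborel_plus [of "\<lambda>w. exp (- a * (norm w)\<^sup>2)" "- z"] has_bochner_integral_gauss [OF assms, where 'a='a]
  by (simp_all add: has_bochner_integral_iff norm_minus_commute)

section \<open>Differentiation of exponential integrals\<close>

lemma cmod_exp_remainder: "cmod (exp h - 1 - h) \<le> (cmod h)\<^sup>2 * exp (cmod h)"
proof -
  have "cmod (exp h - (\<Sum>i\<le>1. h ^ i / fact i)) \<le> exp \<bar>Re h\<bar> * cmod h ^ Suc 1 / fact 1"
    by (rule Taylor_exp)
  also have "(\<Sum>i\<le>1. h ^ i / fact i) = 1 + h" by simp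
  also have "exp \<bar>Re h\<bar> * cmod h ^ Suc 1 / fact 1 \<le> (cmod h)\<^sup>2 * exp (cmod h)"
    using mult_right_mono [of "exp \<bar>Re h\<bar>" "exp (cmod h)" "(cmod h)\<^sup>2"] abs_Re_le_cmod [of h]
    by (simp add: power2_eq_square mult.commute)
  finally show ?thesis by (simp add: algebra_simps)
qed

text \<open>Differentiation of \<open>z \<mapsto> \<integral> g(y) e^(L z y) dy\<close> under the integral sign, for a Gaussian-bounded \<open>g\<close>
  and \<open>L\<close> real linear in \<open>z\<close>. The parameter space is an arbitrary normed space because this is used
  for parameters in \<open>\<complex>\<^sup>n\<close> (the projection is entire, the Berezin transform continuous) as well
  as in \<open>\<complex>\<close> (the Laplace-type integrals whose real parameters are complexified).\<close>

locale exp_integral =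
  fixes g :: "'y::euclidean_space \<Rightarrow> complex"
    and L :: "'a::real_normed_vector \<Rightarrow> 'y \<Rightarrow> complex"
    and C c a M :: real
  assumes g_measurable [measurable]: "g \<in> borel_measurable borel"
    and g_bound: "\<And>y. cmod (g y) \<le> C * exp (c * norm y - a * (norm y)\<^sup>2)"
    and a_pos: "a > 0"
    and L_measurable [measurable]: "\<And>z. L z \<in> borel_measurable borel"
    and L_linear: "\<And>y. linear (\<lambda>z. L z y)"
    and L_bound: "\<And>z y. cmod (L z y) \<le> M * norm z * norm y"
begin

lemma C_nonneg: "C \<ge> 0"
  using order_trans [OF norm_ge_zero g_bound [of 0]] by simp

lemma L_bound_nonneg: "0 \<le> M * norm z * norm y" for z :: 'a and y :: 'y
  by (rule order_trans [OF norm_ge_zero L_bound])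

lemma term_bound:
  "cmod (g y * exp (L z y)) \<le> C * exp ((c + M * norm z) * norm y - a * (norm y)\<^sup>2)"
proof -
  have "cmod (g y * exp (L z y)) \<le> (C * exp (c * norm y - a * (norm y)\<^sup>2)) * exp (M * norm z * norm y)"
    unfolding norm_mult
  proof (intro mult_mono g_bound)
    have "Re (L z y) \<le> M * norm z * norm y"
      using L_bound [of z y] complex_Re_le_cmod [of "L z y"] by linarith
    then show "cmod (exp (L z y)) \<le> exp (M * norm z * norm y)" by simp
  qed (use C_nonneg in auto)
  also have "\<dots> = C * exp ((c + M * norm z) * norm y - a * (norm y)\<^sup>2)"
    by (simp add: mult.assoc exp_add [symmetric] algebra_simps)
  finally show ?thesis .
qed

lemma integrable_weight: "integrable lborel (\<lambda>y::'y. norm y ^ k * (C * exp (e * norm y - a * (norm y)\<^sup>2)))"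
  using integrable_mult_right [OF integrable_gauss_weight [OF a_pos, where 'a='y], of C k e]
  by (simp add: mult.left_commute)

lemma integrable_term: "integrable lborel (\<lambda>y. g y * exp (L z y))"
proof (rule Bochner_Integration.integrable_bound [OF integrable_weight [of 0 "c + M * norm z"]])
  show "AE y in lborel. cmod (g y * exp (L z y)) \<le> norm (norm y ^ 0 * (C * exp ((c + M * norm z) * norm y - a * (norm y)\<^sup>2)))"
    using C_nonneg by (intro AE_I2 order_trans [OF term_bound]) simp
qed measurable

lemma integral_bound:
  "cmod (LINT y|lborel. g y * exp (L z y)) \<le> (LINT y|lborel. C * exp ((c + M * norm z) * norm (y::'y) - a * (norm y)\<^sup>2))"
  using integrable_weight [of 0 "c + M * norm z"]
  by (intro Bochner_Integration.integral_norm_bound_integral integrable_term term_bound) simp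

lemma integrable_deriv_term: "integrable lborel (\<lambda>y. g y * L v y * exp (L z y))"
proof (rule Bochner_Integration.integrable_bound [OF Bochner_Integration.integrable_mult_right [where c = "M * norm v", OF integrable_weight [of 1 "c + M * norm z"]]])
  have "cmod (g y * L v y * exp (L z y)) \<le> norm (M * norm v * (norm y ^ 1 * (C * exp ((c + M * norm z) * norm y - a * (norm y)\<^sup>2))))" for y
  proof -
    have "cmod (g y * L v y * exp (L z y)) = cmod (L v y) * cmod (g y * exp (L z y))"
      by (simp add: norm_mult)
    also have "\<dots> \<le> (M * norm v * norm y) * (C * exp ((c + M * norm z) * norm y - a * (norm y)\<^sup>2))"
      by (intro mult_mono L_bound term_bound) (simp_all add: L_bound_nonneg)
    also have "\<dots> = M * norm v * (norm y ^ 1 * (C * exp ((c + M * norm z) * norm y - a * (norm y)\<^sup>2)))"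
      by simp
    also have "\<dots> \<le> norm (M * norm v * (norm y ^ 1 * (C * exp ((c + M * norm z) * norm y - a * (norm y)\<^sup>2))))"
      unfolding real_norm_def by (rule abs_ge_self)
    finally show ?thesis .
  qed
  then show "AE y in lborel. cmod (g y * L v y * exp (L z y)) \<le> norm (M * norm v * (norm y ^ 1 * (C * exp ((c + M * norm z) * norm y - a * (norm y)\<^sup>2))))"
    by simp
qed measurable

text \<open>The remainder of the integrand is \<open>g(y) e^(L z y) (e\<^sup>u - 1 - u)\<close> with \<open>u = L (x - z) y\<close>, hence of second
  order in \<open>x - z\<close> with an integrable constant; the derivative is therefore obtained with an
  explicit quadratic error instead of a limit theorem.\<close>

theorem has_derivative_integral:
  "((\<lambda>z. LINT y|lborel. g y * exp (L z y)) has_derivative (\<lambda>v. LINT y|lborel. g y * L v y * exp (L z y))) (at z)"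
proof -
  define K where "K = (LINT y|lborel. M\<^sup>2 * (norm (y::'y) ^ 2 * (C * exp ((c + \<bar>M\<bar> * (norm z + 1)) * norm y - a * (norm y)\<^sup>2))))"
  let ?\<Phi> = "\<lambda>z. LINT y|lborel. g y * exp (L z y)"
  let ?D = "\<lambda>v. LINT y|lborel. g y * L v y * exp (L z y)"
  have bound: "cmod (?\<Phi> x - ?\<Phi> z - ?D (x - z)) \<le> K * (norm (x - z))\<^sup>2" if x: "norm (x - z) \<le> 1" for x
  proof -
    define h where "h = x - z"
    have h1: "norm h \<le> 1" using x by (simp add: h_def)
    have Lx: "L x y = L z y + L h y" for y
      using linear_add [OF L_linear, of z h y] by (simp add: h_def)
    have eq: "?\<Phi> x - ?\<Phi> z - ?D h = (LINT y|lborel. g y * exp (L x y) - g y * exp (L z y) - g y * L h y * exp (L z y))"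
      by (simp add: Bochner_Integration.integral_diff integrable_term integrable_deriv_term)
    have pw: "cmod (g y * exp (L x y) - g y * exp (L z y) - g y * L h y * exp (L z y))
        \<le> (norm h)\<^sup>2 * (M\<^sup>2 * (norm y ^ 2 * (C * exp ((c + \<bar>M\<bar> * (norm z + 1)) * norm y - a * (norm y)\<^sup>2))))" for y
    proof -
      have m: "M * norm z * norm y \<le> \<bar>M\<bar> * norm z * norm y" "M * norm h * norm y \<le> \<bar>M\<bar> * 1 * norm y"
         apply (intro mult_right_mono; simp)
        apply (rule mult_right_mono [OF order_trans [OF _ mult_left_mono [OF h1]]])
          apply (simp_all add: mult_right_mono)
        done
      have "cmod (g y * exp (L x y) - g y * exp (L z y) - g y * L h y * exp (L z y))
         = cmod (g y) * exp (Re (L z y)) * cmod (exp (L h y) - 1 - L h y)"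
        unfolding Lx exp_add norm_exp_eq_Re [symmetric] norm_mult [symmetric] by (simp add: algebra_simps)
      also have "\<dots> \<le> (C * exp (c * norm y - a * (norm y)\<^sup>2)) * exp (\<bar>M\<bar> * norm z * norm y)
           * ((M * norm h * norm y)\<^sup>2 * exp (\<bar>M\<bar> * norm y))"
      proof (intro mult_mono g_bound)
        show "exp (Re (L z y)) \<le> exp (\<bar>M\<bar> * norm z * norm y)"
          using L_bound [of z y] complex_Re_le_cmod [of "L z y"] m by simp
        have "cmod (exp (L h y) - 1 - L h y) \<le> (cmod (L h y))\<^sup>2 * exp (cmod (L h y))"
          by (rule cmod_exp_remainder)
        also have "\<dots> \<le> (M * norm h * norm y)\<^sup>2 * exp (\<bar>M\<bar> * norm y)"
          using L_bound [of h y] m by (intro mult_mono power_mono) auto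
        finally show "cmod (exp (L h y) - 1 - L h y) \<le> (M * norm h * norm y)\<^sup>2 * exp (\<bar>M\<bar> * norm y)" .
      qed (use C_nonneg in auto)
      also have "\<dots> = (norm h)\<^sup>2 * (M\<^sup>2 * (norm y ^ 2 * (C * (exp (c * norm y - a * (norm y)\<^sup>2) * exp (\<bar>M\<bar> * norm z * norm y) * exp (\<bar>M\<bar> * norm y)))))"
        by (simp add: power_mult_distrib)
      also have "exp (c * norm y - a * (norm y)\<^sup>2) * exp (\<bar>M\<bar> * norm z * norm y) * exp (\<bar>M\<bar> * norm y)
          = exp ((c + \<bar>M\<bar> * (norm z + 1)) * norm y - a * (norm y)\<^sup>2)"
        unfolding exp_add [symmetric] by (rule arg_cong [of _ _ exp]) (simp add: algebra_simps)
      finally show ?thesis .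
    qed
    have "cmod (?\<Phi> x - ?\<Phi> z - ?D h) \<le> (LINT y|lborel. (norm h)\<^sup>2 * (M\<^sup>2 * (norm (y::'y) ^ 2 * (C * exp ((c + \<bar>M\<bar> * (norm z + 1)) * norm y - a * (norm y)\<^sup>2)))))"
      unfolding eq
      by (intro Bochner_Integration.integral_norm_bound_integral Bochner_Integration.integrable_diff integrable_term
            integrable_deriv_term integrable_mult_right integrable_weight pw)
    also have "\<dots> = K * (norm h)\<^sup>2"
      unfolding K_def by simp
    finally show ?thesis by (simp add: h_def)
  qed
  have lim: "((\<lambda>x. norm (?\<Phi> x - ?\<Phi> z - ?D (x - z)) / norm (x - z)) \<longlongrightarrow> 0) (at z)"
  proof (rule Lim_null_comparison)
    have "eventually (\<lambda>x. dist x z < 1) (at z)" by (simp add: eventually_at) (use zero_less_one in blast)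
    then show "\<forall>\<^sub>F x in at z. norm (norm (?\<Phi> x - ?\<Phi> z - ?D (x - z)) / norm (x - z)) \<le> K * norm (x - z)"
    proof eventually_elim
      case (elim x)
      then have b: "norm (?\<Phi> x - ?\<Phi> z - ?D (x - z)) \<le> K * (norm (x - z))\<^sup>2"
        by (intro bound) (simp add: dist_norm)
      show ?case
      proof (cases "x = z")
        case False
        then show ?thesis using b by (simp add: divide_le_eq power2_eq_square mult.assoc)
      qed simp
    qed
    show "((\<lambda>x. K * norm (x - z)) \<longlongrightarrow> 0) (at z)"
      by (rule tendsto_eq_intros refl | simp)+
  qed
  have "bounded_linear ?D"
  proof (rule bounded_linear_intro)
    fix u v and r :: real
    have "?D u + ?D v = (LINT y|lborel. g y * L u y * exp (L z y) + g y * L v y * exp (L z y))"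
      by (rule Bochner_Integration.integral_add [OF integrable_deriv_term integrable_deriv_term, symmetric])
    also have "\<dots> = ?D (u + v)"
      by (rule Bochner_Integration.integral_cong [OF refl])
         (subst linear_add [OF L_linear], simp only: distrib_left distrib_right)
    finally show "?D (u + v) = ?D u + ?D v" ..
    have "?D (r *\<^sub>R u) = (LINT y|lborel. r *\<^sub>R (g y * L u y * exp (L z y)))"
      by (rule Bochner_Integration.integral_cong [OF refl])
         (subst linear_scale [OF L_linear], simp only: scaleR_conv_of_real mult_ac)
    then show "?D (r *\<^sub>R u) = r *\<^sub>R ?D u" by simp
    show "norm (?D u) \<le> norm u * (LINT y|lborel. M * (norm (y::'y) ^ 1 * (C * exp ((c + M * norm z) * norm y - a * (norm y)\<^sup>2))))"
    proof -
      have "norm (?D u) \<le> (LINT y|lborel. norm u * (M * (norm (y::'y) ^ 1 * (C * exp ((c + M * norm z) * norm y - a * (norm y)\<^sup>2)))))"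
      proof (intro Bochner_Integration.integral_norm_bound_integral integrable_deriv_term integrable_mult_right integrable_weight)
        fix y
        have "cmod (g y * L u y * exp (L z y)) = cmod (L u y) * cmod (g y * exp (L z y))"
          by (simp add: norm_mult)
        also have "\<dots> \<le> (M * norm u * norm y) * (C * exp ((c + M * norm z) * norm y - a * (norm y)\<^sup>2))"
          by (intro mult_mono L_bound term_bound) (simp_all add: L_bound_nonneg)
        finally show "cmod (g y * L u y * exp (L z y)) \<le> norm u * (M * (norm y ^ 1 * (C * exp ((c + M * norm z) * norm y - a * (norm y)\<^sup>2))))"
          by (simp add: algebra_simps)
      qed
      then show ?thesis by simp
    qed
  qed
  with lim show ?thesis by (simp add: has_derivative_iff_norm)
qed

end

section \<open>Limits at infinity that propagate from real to complex parameters\<close>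

lemma not_tendsto_at_infinityE:
  fixes f :: "'a::real_normed_vector \<Rightarrow> 'b::metric_space"
  assumes "\<not> (f \<longlongrightarrow> l) at_infinity"
  obtains e w where "e > 0" "filterlim w at_infinity sequentially" "\<And>n::nat. dist (f (w n)) l \<ge> e"
proof -
  obtain e where e: "e > 0" "\<And>b. \<exists>w. norm w \<ge> b \<and> dist (f w) l \<ge> e"
    using assms unfolding Lim_at_infinity by (auto simp: not_less)
  then have "\<forall>n::nat. \<exists>w. norm w \<ge> real n \<and> dist (f w) l \<ge> e" by blast
  then obtain w where w: "\<And>n::nat. norm (w n) \<ge> real n" "\<And>n. dist (f (w n)) l \<ge> e"
    by metis
  have "filterlim w at_infinity sequentially"
    unfolding filterlim_at_infinity_conv_norm_at_top
    by (rule filterlim_at_top_mono [OF filterlim_real_sequentially]) (use w in auto)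
  with e(1) w(2) show ?thesis using that by blast
qed

lemma tendsto_at_infinity_sequentially:
  fixes f :: "'a::real_normed_vector \<Rightarrow> 'b::metric_space"
  assumes "\<And>x. filterlim x at_infinity sequentially \<Longrightarrow> (\<lambda>n. f (x n)) \<longlonglongrightarrow> l"
  shows "(f \<longlongrightarrow> l) at_infinity"
proof (rule ccontr)
  assume "\<not> ?thesis"
  then obtain e w where "e > 0" and w: "filterlim w at_infinity sequentially" "\<And>n::nat. dist (f (w n)) l \<ge> e"
    by (rule not_tendsto_at_infinityE) blast
  from tendstoD [OF assms [OF w(1)] this(1)] obtain n where "dist (f (w n)) l < e"
    by (auto simp: eventually_sequentially)
  with w(2) [of n] show False by simp
qed

lemma zero_islimpt_Reals: "(0::complex) islimpt \<real>"
proof -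
  have "\<exists>x\<in>\<real>. x \<noteq> (0::complex) \<and> dist x 0 < d" if "d > 0" for d
    using that by (intro bexI [of _ "complex_of_real (d / 2)"]) auto
  then show ?thesis by (simp add: islimpt_approachable)
qed

text \<open>If the limit failed at some \<open>\<zeta>\<close>, a sequence \<open>w\<^sub>n \<rightarrow> \<infinity>\<close> would keep \<open>\<Phi> w\<^sub>n \<zeta>\<close> away from 0. By Montel a
  subsequence converges to an entire function, which is 0 on the real axis and hence everywhere.\<close>

lemma vanishing_from_real_axis:
  fixes \<Phi> :: "'w::real_normed_vector \<Rightarrow> complex \<Rightarrow> complex"
  assumes hol: "\<And>w. \<Phi> w holomorphic_on UNIV"
    and bound: "\<And>r. \<exists>B. \<forall>w. \<forall>\<zeta>. cmod \<zeta> \<le> r \<longrightarrow> cmod (\<Phi> w \<zeta>) \<le> B"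
    and lim: "\<And>x::real. ((\<lambda>w. \<Phi> w (complex_of_real x)) \<longlongrightarrow> 0) at_infinity"
  shows "((\<lambda>w. \<Phi> w \<zeta>) \<longlongrightarrow> 0) at_infinity"
proof (rule ccontr)
  assume "\<not> ?thesis"
  then obtain e w where e: "e > 0" and w_inf: "filterlim w at_infinity sequentially"
    and "\<And>n::nat. dist (\<Phi> (w n) \<zeta>) 0 \<ge> e"
    by (rule not_tendsto_at_infinityE) blast
  then have w: "\<And>n. cmod (\<Phi> (w n) \<zeta>) \<ge> e" by simp
  obtain g r where g: "g holomorphic_on UNIV" and r: "strict_mono (r :: nat \<Rightarrow> nat)"
    and conv: "\<And>x. ((\<lambda>n. \<Phi> (w (r n)) x) \<longlongrightarrow> g x) sequentially"
  proof (rule Montel [of UNIV "range (\<lambda>n. \<Phi> (w n))" "\<lambda>n. \<Phi> (w n)"])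
    fix K :: "complex set" assume "compact K"
    then obtain R where "\<And>z. z \<in> K \<Longrightarrow> cmod z \<le> R"
      using compact_imp_bounded bounded_iff by metis
    then show "\<exists>B. \<forall>h\<in>range (\<lambda>n. \<Phi> (w n)). \<forall>z\<in>K. cmod (h z) \<le> B"
      using bound [of R] by blast
  qed (use hol in auto)
  have g0: "g (complex_of_real x) = 0" for x
  proof (rule LIMSEQ_unique [OF conv])
    have "filterlim (\<lambda>n. w (r n)) at_infinity sequentially"
      by (rule filterlim_compose [OF w_inf filterlim_subseq [OF r]])
    then show "(\<lambda>n. \<Phi> (w (r n)) (complex_of_real x)) \<longlonglongrightarrow> 0"
      by (rule filterlim_compose [OF lim])
  qed
  have "g \<zeta> = 0"
    by (rule analytic_continuation [OF g, of \<real> 0]) (use g0 zero_islimpt_Reals in \<open>auto simp: Reals_def\<close>)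
  then have "(\<lambda>n. cmod (\<Phi> (w (r n)) \<zeta>)) \<longlonglongrightarrow> 0"
    using tendsto_norm_zero [of "\<lambda>n. \<Phi> (w (r n)) \<zeta>"] conv [of \<zeta>] by simp
  then have "e \<le> 0"
    using w by (intro LIMSEQ_le_const) auto
  with e show False by simp
qed

section \<open>Square-integrable functions\<close>

lemma integrable_mult_L2:
  fixes f g :: "'a \<Rightarrow> complex"
  assumes [measurable]: "f \<in> borel_measurable M" "g \<in> borel_measurable M"
    and "integrable M (\<lambda>x. (cmod (f x))\<^sup>2)" "integrable M (\<lambda>x. (cmod (g x))\<^sup>2)"
  shows "integrable M (\<lambda>x. f x * g x)"
proof (rule Bochner_Integration.integrable_bound)
  show "integrable M (\<lambda>x. (cmod (f x))\<^sup>2 + (cmod (g x))\<^sup>2)" using assms by simp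
  have "cmod (f x * g x) \<le> norm ((cmod (f x))\<^sup>2 + (cmod (g x))\<^sup>2)" for x
  proof -
    have "2 * (cmod (f x) * cmod (g x)) \<le> (cmod (f x))\<^sup>2 + (cmod (g x))\<^sup>2"
      using sum_squares_bound [of "cmod (f x)" "cmod (g x)"] by simp
    moreover have "0 \<le> cmod (f x) * cmod (g x)" by simp
    ultimately show ?thesis unfolding norm_mult real_norm_def by linarith
  qed
  then show "AE x in M. cmod (f x * g x) \<le> norm ((cmod (f x))\<^sup>2 + (cmod (g x))\<^sup>2)" by simp
qed measurable

lemma Cauchy_Schwarz_integral:
  fixes f g :: "'a \<Rightarrow> complex"
  assumes [measurable]: "f \<in> borel_measurable M" "g \<in> borel_measurable M"
    and f: "integrable M (\<lambda>x. (cmod (f x))\<^sup>2)" and g: "integrable M (\<lambda>x. (cmod (g x))\<^sup>2)"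
  shows "(LINT x|M. cmod (f x) * cmod (g x))\<^sup>2 \<le> (LINT x|M. (cmod (f x))\<^sup>2) * (LINT x|M. (cmod (g x))\<^sup>2)"
proof -
  have "integrable M (\<lambda>x. cmod (f x * g x))"
    by (intro integrable_norm integrable_mult_L2 assms)
  then have i: "integrable M (\<lambda>x. cmod (f x) * cmod (g x))" by (simp add: norm_mult)
  have "ennreal ((LINT x|M. cmod (f x) * cmod (g x))\<^sup>2) = (\<integral>\<^sup>+x. ennreal (cmod (f x)) * ennreal (cmod (g x)) \<partial>M)\<^sup>2"
    using i by (simp add: nn_integral_eq_integral ennreal_mult' [symmetric] ennreal_power)
  also have "\<dots> \<le> (\<integral>\<^sup>+x. (ennreal (cmod (f x)))\<^sup>2 \<partial>M) * (\<integral>\<^sup>+x. (ennreal (cmod (g x)))\<^sup>2 \<partial>M)"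
    by (rule Cauchy_Schwarz_nn_integral) measurable
  also have "\<dots> = ennreal ((LINT x|M. (cmod (f x))\<^sup>2) * (LINT x|M. (cmod (g x))\<^sup>2))"
    using f g by (simp add: ennreal_power nn_integral_eq_integral ennreal_mult')
  finally show ?thesis by (simp add: ennreal_le_iff)
qed

text \<open>The Schur test with unequal rows and columns: the row bound \<open>C\<close> is spent on the Cauchy-Schwarz
  inequality for \<open>\<surd>k \<cdot> (\<surd>k g)\<close>, while the column integrals stay inside as a weight. Keeping that
  weight is what allows a decay of the columns to be used.\<close>

lemma Schur_test:
  fixes k :: "'a::euclidean_space \<Rightarrow> 'a \<Rightarrow> real" and g :: "'a \<Rightarrow> real"
  assumes [measurable]: "case_prod k \<in> borel_measurable (borel \<Otimes>\<^sub>M borel)" "g \<in> borel_measurable borel"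
    and nonneg: "\<And>z w. k z w \<ge> 0" "\<And>w. g w \<ge> 0"
    and rows: "\<And>z. (\<integral>\<^sup>+w. ennreal (k z w) \<partial>lborel) \<le> ennreal C"
  shows "(\<integral>\<^sup>+z. (\<integral>\<^sup>+w. ennreal (k z w * g w) \<partial>lborel)\<^sup>2 \<partial>lborel)
     \<le> ennreal C * (\<integral>\<^sup>+w. (\<integral>\<^sup>+z. ennreal (k z w) \<partial>lborel) * ennreal ((g w)\<^sup>2) \<partial>lborel)"
proof -
  have [measurable]: "(\<lambda>w. k z w) \<in> borel_measurable borel" "(\<lambda>z. k z w) \<in> borel_measurable borel" for z w
    by measurable
  have "(\<integral>\<^sup>+w. ennreal (k z w * g w) \<partial>lborel)\<^sup>2 \<le> ennreal C * (\<integral>\<^sup>+w. ennreal (k z w * (g w)\<^sup>2) \<partial>lborel)" for z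
  proof -
    have "(\<integral>\<^sup>+w. ennreal (k z w * g w) \<partial>lborel)\<^sup>2
        = (\<integral>\<^sup>+w. ennreal (sqrt (k z w)) * ennreal (sqrt (k z w) * g w) \<partial>lborel)\<^sup>2"
      by (simp add: nonneg ennreal_mult' [symmetric] mult.assoc [symmetric])
    also have "\<dots> \<le> (\<integral>\<^sup>+w. (ennreal (sqrt (k z w)))\<^sup>2 \<partial>lborel) * (\<integral>\<^sup>+w. (ennreal (sqrt (k z w) * g w))\<^sup>2 \<partial>lborel)"
      by (rule Cauchy_Schwarz_nn_integral) measurable
    also have "\<dots> = (\<integral>\<^sup>+w. ennreal (k z w) \<partial>lborel) * (\<integral>\<^sup>+w. ennreal (k z w * (g w)\<^sup>2) \<partial>lborel)"
      by (simp add: nonneg ennreal_power power_mult_distrib)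
    also have "\<dots> \<le> ennreal C * (\<integral>\<^sup>+w. ennreal (k z w * (g w)\<^sup>2) \<partial>lborel)"
      by (intro mult_right_mono rows) simp
    finally show ?thesis .
  qed
  then have "(\<integral>\<^sup>+z. (\<integral>\<^sup>+w. ennreal (k z w * g w) \<partial>lborel)\<^sup>2 \<partial>lborel)
      \<le> (\<integral>\<^sup>+z. ennreal C * (\<integral>\<^sup>+w. ennreal (k z w * (g w)\<^sup>2) \<partial>lborel) \<partial>lborel)"
    by (intro nn_integral_mono)
  also have "\<dots> = ennreal C * (\<integral>\<^sup>+z. (\<integral>\<^sup>+w. ennreal (k z w * (g w)\<^sup>2) \<partial>lborel) \<partial>lborel)"
    by (rule nn_integral_cmult) measurable
  also have "(\<integral>\<^sup>+z. (\<integral>\<^sup>+w. ennreal (k z w * (g w)\<^sup>2) \<partial>lborel) \<partial>lborel) = (\<integral>\<^sup>+w. (\<integral>\<^sup>+z. ennreal (k z w * (g w)\<^sup>2) \<partial>lborel) \<partial>lborel)"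
    by (rule lborel_pair.Fubini') measurable
  also have "\<dots> = (\<integral>\<^sup>+w. (\<integral>\<^sup>+z. ennreal (k z w) \<partial>lborel) * ennreal ((g w)\<^sup>2) \<partial>lborel)"
    by (simp add: nonneg ennreal_mult nn_integral_multc)
  finally show ?thesis .
qed

section \<open>Laplace-type Gaussian integrals\<close>

lemma exp_integral_scalar:
  fixes g :: "'y::euclidean_space \<Rightarrow> complex" and p :: "'y \<Rightarrow> real"
  assumes [measurable]: "g \<in> borel_measurable borel" "p \<in> borel_measurable borel"
    and g: "\<And>y. cmod (g y) \<le> C * exp (c * norm y - a * (norm y)\<^sup>2)" and a: "a > 0"
    and p: "\<And>y. \<bar>p y\<bar> \<le> M * norm y"
  shows "exp_integral g (\<lambda>\<zeta> y. \<zeta> * complex_of_real (p y)) C c a M"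
proof (rule exp_integral.intro)
  show "linear (\<lambda>\<zeta>. \<zeta> * complex_of_real (p y))" for y
    by (rule linearI) (simp_all add: algebra_simps)
  show "cmod (\<zeta> * complex_of_real (p y)) \<le> M * norm \<zeta> * norm y" for \<zeta> y
    using mult_left_mono [OF p [of y], of "cmod \<zeta>"] by (simp add: norm_mult mult_ac)
qed (simp_all add: g a)

lemma holomorphic_exp_integral_scalar:
  assumes "exp_integral g (\<lambda>\<zeta> y. \<zeta> * complex_of_real (p y)) C c a M"
  shows "(\<lambda>\<zeta>. LINT y|lborel. g y * exp (\<zeta> * complex_of_real (p y))) holomorphic_on UNIV"
proof (rule holomorphic_onI)
  interpret exp_integral g "\<lambda>\<zeta> y. \<zeta> * complex_of_real (p y)" C c a M by (rule assms)
  fix \<zeta> :: complex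
  have "(\<lambda>v. LINT y|lborel. g y * (v * complex_of_real (p y)) * exp (\<zeta> * complex_of_real (p y)))
      = (\<lambda>v. (LINT y|lborel. g y * complex_of_real (p y) * exp (\<zeta> * complex_of_real (p y))) * v)"
    by (simp add: mult_ac flip: integral_mult_right_zero integral_mult_left_zero)
  then show "(\<lambda>\<zeta>. LINT y|lborel. g y * exp (\<zeta> * complex_of_real (p y))) field_differentiable at \<zeta> within UNIV"
    using has_derivative_integral [of \<zeta>]
    unfolding field_differentiable_def has_field_derivative_def by metis
qed

text \<open>Gaussian decay of \<open>g\<close>, uniform in \<open>w\<close>, makes the integral entire in \<open>\<zeta>\<close> and locally bounded uniformly
  in \<open>w\<close>.\<close>

lemma vanishing_gaussian_laplace:
  fixes g :: "'w::real_normed_vector \<Rightarrow> 'y::euclidean_space \<Rightarrow> complex" and p :: "'y \<Rightarrow> real"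
  assumes [measurable]: "\<And>w. g w \<in> borel_measurable borel" "p \<in> borel_measurable borel"
    and g: "\<And>w y. cmod (g w y) \<le> C * exp (c * norm y - a * (norm y)\<^sup>2)" and a: "a > 0"
    and p: "\<And>y. \<bar>p y\<bar> \<le> M * norm y"
    and lim: "\<And>x::real. ((\<lambda>w. LINT y|lborel. g w y * exp (complex_of_real x * complex_of_real (p y))) \<longlongrightarrow> 0) at_infinity"
  shows "((\<lambda>w. LINT y|lborel. g w y * exp (\<zeta> * complex_of_real (p y))) \<longlongrightarrow> 0) at_infinity"
proof (rule vanishing_from_real_axis [where \<Phi> = "\<lambda>w \<zeta>. LINT y|lborel. g w y * exp (\<zeta> * complex_of_real (p y))"])
  show "((\<lambda>w. LINT y|lborel. g w y * exp (complex_of_real x * complex_of_real (p y))) \<longlongrightarrow> 0) at_infinity" for x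
    by (rule lim)
  have loc: "exp_integral (g w) (\<lambda>\<zeta> y. \<zeta> * complex_of_real (p y)) C c a M" for w
    by (rule exp_integral_scalar) (simp_all add: g a p)
  then show "(\<lambda>\<zeta>. LINT y|lborel. g w y * exp (\<zeta> * complex_of_real (p y))) holomorphic_on UNIV" for w
    by (rule holomorphic_exp_integral_scalar)
  fix r :: real
  have "cmod (LINT y|lborel. g w y * exp (\<zeta> * complex_of_real (p y)))
      \<le> (LINT y|lborel. C * exp ((c + \<bar>M\<bar> * \<bar>r\<bar>) * norm (y::'y) - a * (norm y)\<^sup>2))" if r: "cmod \<zeta> \<le> r" for w \<zeta>
  proof -
    interpret exp_integral "g w" "\<lambda>\<zeta> y. \<zeta> * complex_of_real (p y)" C c a M by (rule loc)
    have m: "M * cmod \<zeta> \<le> \<bar>M\<bar> * \<bar>r\<bar>"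
      using r by (intro mult_mono) auto
    show ?thesis
    proof (rule order_trans [OF integral_bound integral_mono])
      show "C * exp ((c + M * cmod \<zeta>) * norm y - a * (norm y)\<^sup>2) \<le> C * exp ((c + \<bar>M\<bar> * \<bar>r\<bar>) * norm y - a * (norm y)\<^sup>2)" for y :: 'y
        using C_nonneg m by (intro mult_left_mono) (auto intro!: mult_right_mono)
    qed (use integrable_weight [of 0] in simp_all)
  qed
  then show "\<exists>B. \<forall>w \<zeta>. cmod \<zeta> \<le> r \<longrightarrow> cmod (LINT y|lborel. g w y * exp (\<zeta> * complex_of_real (p y))) \<le> B"
    by blast
qed

text \<open>For real \<open>\<zeta>\<close> this is completion of the square; both sides are entire in \<open>\<zeta>\<close>. At imaginary \<open>\<zeta>\<close> it
  is the Fourier transform of the Gaussian.\<close>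

lemma gaussian_laplace_transform:
  fixes \<omega> :: "'a::euclidean_space"
  assumes a: "a > 0"
  shows "(LINT s|lborel. complex_of_real (exp (- a * (norm s)\<^sup>2)) * exp (\<zeta> * complex_of_real (\<omega> \<bullet> s)))
    = complex_of_real (sqrt (pi / a) ^ DIM('a)) * exp (\<zeta>\<^sup>2 * complex_of_real ((norm \<omega>)\<^sup>2 / (4 * a)))" (is "?f \<zeta> = ?g \<zeta>")
proof -
  have "exp_integral (\<lambda>s::'a. complex_of_real (exp (- a * (norm s)\<^sup>2))) (\<lambda>\<zeta> s. \<zeta> * complex_of_real (\<omega> \<bullet> s)) 1 0 a (norm \<omega>)"
    using a by (intro exp_integral_scalar Cauchy_Schwarz_ineq2) simp_all
  then have hol: "?f holomorphic_on UNIV" by (rule holomorphic_exp_integral_scalar)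
  have real: "?f (complex_of_real x) = ?g (complex_of_real x)" for x
  proof -
    define c where "c = (x / (2 * a)) *\<^sub>R \<omega>"
    have "- a * (norm s)\<^sup>2 + x * (\<omega> \<bullet> s) = x\<^sup>2 * ((norm \<omega>)\<^sup>2 / (4 * a)) + - a * (norm (c - s))\<^sup>2" for s
      using a unfolding c_def power2_norm_eq_inner
      by (simp add: inner_diff inner_commute field_simps power2_eq_square)
    then have "exp (- a * (norm s)\<^sup>2) * exp (x * (\<omega> \<bullet> s)) = exp (x\<^sup>2 * ((norm \<omega>)\<^sup>2 / (4 * a))) * exp (- a * (norm (c - s))\<^sup>2)" for s
      by (simp only: exp_add [symmetric])
    then have eq: "complex_of_real (exp (- a * (norm s)\<^sup>2)) * exp (complex_of_real x * complex_of_real (\<omega> \<bullet> s))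
       = complex_of_real (exp (x\<^sup>2 * ((norm \<omega>)\<^sup>2 / (4 * a))) * exp (- a * (norm (c - s))\<^sup>2))" for s
      unfolding of_real_mult [symmetric] exp_of_real by (rule arg_cong)
    have "(LINT s|lborel. complex_of_real (exp (- a * (norm s)\<^sup>2)) * exp (complex_of_real x * complex_of_real (\<omega> \<bullet> s)))
       = complex_of_real (exp (x\<^sup>2 * ((norm \<omega>)\<^sup>2 / (4 * a))) * sqrt (pi / a) ^ DIM('a))"
      unfolding eq integral_complex_of_real integral_mult_right_zero integral_gauss_shift [OF a] ..
    then show ?thesis by (simp add: exp_of_real [symmetric])
  qed
  have "?f \<zeta> - ?g \<zeta> = 0"
  proof (rule analytic_continuation [of "\<lambda>\<zeta>. ?f \<zeta> - ?g \<zeta>" UNIV \<real> 0])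
    show "(\<lambda>\<zeta>. ?f \<zeta> - ?g \<zeta>) holomorphic_on UNIV" by (intro holomorphic_intros hol)
    show "?f z - ?g z = 0" if "z \<in> \<real>" for z using that real by (auto simp: Reals_def)
  qed (use zero_islimpt_Reals in auto)
  then show ?thesis by simp
qed

section \<open>The Hermitian product\<close>

definition cdot :: "complex^'n \<Rightarrow> complex^'n \<Rightarrow> complex" where
  "cdot z w = (\<Sum>i\<in>UNIV. z $ i * cnj (w $ i))"

lemma cdot_add_left: "cdot (x + y) w = cdot x w + cdot y w"
  by (simp add: cdot_def distrib_right sum.distrib)

lemma cdot_add_right: "cdot w (x + y) = cdot w x + cdot w y"
  by (simp add: cdot_def distrib_left sum.distrib)

lemma cdot_scale_left: "cdot (c *s x) w = c * cdot x w"
  by (simp add: cdot_def sum_distrib_left mult.assoc)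

lemma cdot_scaleR_left: "cdot (r *\<^sub>R x) w = r *\<^sub>R cdot x w"
  by (simp add: cdot_def scaleR_sum_right)

lemma cdot_commute: "cdot w z = cnj (cdot z w)"
  by (simp add: cdot_def mult.commute)

lemma Re_cdot: "Re (cdot z w) = z \<bullet> w"
  by (simp add: cdot_def inner_vec_def inner_complex_def Re_sum)

lemma cdot_self: "cdot z z = complex_of_real ((norm z)\<^sup>2)"
proof (rule complex_eqI)
  show "Re (cdot z z) = Re (complex_of_real ((norm z)\<^sup>2))"
    by (simp only: Re_cdot Re_complex_of_real power2_norm_eq_inner)
  show "Im (cdot z z) = Im (complex_of_real ((norm z)\<^sup>2))"
    using arg_cong [OF cdot_commute [of z z], of Im] by simp
qed

lemma norm_scale: "norm (c *s z) = cmod c * norm z" for z :: "complex^'n"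
  by (simp add: norm_vec_def norm_mult L2_set_right_distrib)

lemma cmod_cdot_le: "cmod (cdot z w) \<le> norm z * norm w"
proof (cases "cdot z w = 0")
  case False
  define u where "u = cnj (sgn (cdot z w))"
  have u: "cmod u = 1" using False by (simp add: u_def norm_sgn)
  have "u * cdot z w = complex_of_real (cmod (cdot z w))"
    by (simp add: u_def sgn_eq complex_norm_square [symmetric] power2_eq_square mult.commute)
  then have "cmod (cdot z w) = Re (cdot (u *s z) w)"
    by (simp add: cdot_scale_left)
  also have "\<dots> \<le> norm (u *s z) * norm w"
    unfolding Re_cdot by (rule norm_cauchy_schwarz)
  also have "\<dots> = norm z * norm w" by (simp add: norm_scale u)
  finally show ?thesis .
qed simp

lemma linear_cdot_left: "linear (\<lambda>z. cdot z w)"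
  by (rule linearI) (simp_all add: cdot_add_left cdot_scaleR_left)

lemma continuous_on_cdot [continuous_intros]:
  "continuous_on S f \<Longrightarrow> continuous_on S g \<Longrightarrow> continuous_on S (\<lambda>x. cdot (f x) (g x))"
  unfolding cdot_def by (intro continuous_intros) 

lemma borel_measurable_cdot [measurable]:
  "f \<in> borel_measurable M \<Longrightarrow> g \<in> borel_measurable M \<Longrightarrow> (\<lambda>x. cdot (f x) (g x)) \<in> borel_measurable M"
  by (rule borel_measurable_continuous_Pair) (auto intro!: continuous_intros simp: case_prod_unfold)

lemma norm_diff_squared: "(norm (z - w))\<^sup>2 = (norm z)\<^sup>2 + (norm w)\<^sup>2 - 2 * Re (cdot z w)"
  by (simp add: Re_cdot power2_norm_eq_inner inner_diff inner_commute)

section \<open>The Gaussian mean value property of entire functions\<close>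

lemma entire_continuous: "entire H \<Longrightarrow> continuous_on UNIV H"
  unfolding entire_def by (meson continuous_at_imp_continuous_on has_derivative_continuous)

lemma entire_measurable [measurable_dest]: "entire H \<Longrightarrow> H \<in> borel_measurable borel"
  by (rule borel_measurable_continuous_onI [OF entire_continuous])

text \<open>Complex homogeneity of the derivative turns the restriction to a complex line into a
  holomorphic function of one variable.\<close>

lemma entire_holomorphic_slice:
  assumes "entire H"
  shows "(\<lambda>\<zeta>. H (z + \<zeta> *s w)) holomorphic_on S"
proof (rule holomorphic_onI)
  fix \<zeta>
  obtain D where D: "(H has_derivative D) (at (z + \<zeta> *s w))" "\<And>c v. D (c *s v) = c * D v"
    using assms unfolding entire_def by metis
  have "linear (\<lambda>\<zeta>::complex. \<zeta> *s w)"
    by (rule linearI) (simp_all add: vec_eq_iff algebra_simps)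
  then have "((\<lambda>\<zeta>. z + \<zeta> *s w) has_derivative (\<lambda>h. h *s w)) (at \<zeta>)"
    by (intro has_derivative_add_const [THEN has_derivative_eq_rhs] derivative_eq_intros bounded_linear_imp_has_derivative)
       (auto simp: linear_conv_bounded_linear intro: bounded_linear_imp_has_derivative)
  from has_derivative_compose [OF this D(1)]
  have "((\<lambda>\<zeta>. H (z + \<zeta> *s w)) has_derivative (\<lambda>h. D w * h)) (at \<zeta>)"
    by (simp add: D(2) mult.commute)
  then show "(\<lambda>\<zeta>. H (z + \<zeta> *s w)) field_differentiable at \<zeta> within S"
    unfolding field_differentiable_def has_field_derivative_def
    by (metis has_derivative_at_withinI)
qed

lemma circle_mean_value:
  assumes "f holomorphic_on UNIV"
  shows "(LINT t:{0..1}|lborel. f (exp (2 * complex_of_real pi * \<i> * complex_of_real t))) = f 0"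
proof -
  let ?e = "\<lambda>t. exp (2 * complex_of_real pi * \<i> * complex_of_real t)"
  have "((\<lambda>u. f u / (u - 0)) has_contour_integral (2 * of_real pi * \<i> * f 0)) (circlepath 0 1)"
    using assms by (intro Cauchy_integral_circlepath_simple) (auto intro: holomorphic_on_subset)
  then have "((\<lambda>t. 2 * of_real pi * \<i> * f (?e t)) has_integral (2 * of_real pi * \<i> * f 0)) {0..1}"
    unfolding has_contour_integral
    by (rule has_integral_eq [rotated]) (subst vector_derivative_circlepath, simp add: circlepath)
  then have "((\<lambda>t. f (?e t)) has_integral f 0) {0..1}"
    using has_integral_mult_right [of "\<lambda>t. 2 * of_real pi * \<i> * f (?e t)" "2 * of_real pi * \<i> * f 0" "{0..1}" "1 / (2 * of_real pi * \<i>)"]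
    by simp
  moreover have "set_integrable lborel {0..1} (\<lambda>t. f (?e t))"
  proof -
    have "continuous_on {0..1} (\<lambda>t. f (?e t))"
      by (rule continuous_on_compose2 [OF holomorphic_on_imp_continuous_on [OF assms]])
         (auto intro!: continuous_intros)
    then show ?thesis
      unfolding set_integrable_def by (intro borel_integrable_compact) auto
  qed
  ultimately show ?thesis
    by (simp add: set_borel_integral_eq_integral(2) integral_unique)
qed

lemma surj_scale: "cmod c = 1 \<Longrightarrow> surj ((*s) c :: complex^'n \<Rightarrow> complex^'n)"
proof (rule surjI [of _ "(*s) (inverse c)"])
  fix x :: "complex^'n"
  assume "cmod c = 1"
  then have "c \<noteq> 0" by auto
  then show "c *s (inverse c *s x) = x" by (simp add: vec_eq_iff)
qed

lemma linear_scale_complex: "linear ((*s) c :: complex^'n \<Rightarrow> complex^'n)"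
  by (rule linearI) (simp_all add: vec_eq_iff algebra_simps)

definition gweight :: "complex^'n \<Rightarrow> complex" where
  "gweight w = complex_of_real (exp (- pi * (norm w)\<^sup>2))"

lemma gweight_measurable [measurable]: "gweight \<in> borel_measurable borel"
  unfolding gweight_def [abs_def] by measurable

lemma has_bochner_integral_gweight: "has_bochner_integral lborel (gweight :: complex^'n \<Rightarrow> complex) 1"
  using has_bochner_integral_of_real [OF has_bochner_integral_gauss [of pi, where 'a="complex^'n"], where 'a=complex]
  unfolding gweight_def [abs_def] by simp

text \<open>Gaussian measure is invariant under \<open>w \<mapsto> e(t) w\<close> for unimodular \<open>e(t)\<close>. Averaging over \<open>t\<close> and
  exchanging the integrals, the inner one is the mean of \<open>H\<close> over a circle in a complex line
  through 0, which is \<open>H 0\<close> by Cauchy's formula.\<close>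

lemma gaussian_mean_value:
  fixes H :: "complex^'n \<Rightarrow> complex"
  assumes cont: "continuous_on UNIV H"
    and hol: "\<And>w. (\<lambda>\<zeta>. H (\<zeta> *s w)) holomorphic_on UNIV"
    and int: "integrable lborel (\<lambda>w. H w * gweight w)"
  shows "(LINT w|lborel. H w * gweight w) = H 0"
proof -
  define e where "e = (\<lambda>t. exp (2 * complex_of_real pi * \<i> * complex_of_real t))"
  have e1: "cmod (e t) = 1" for t by (simp add: e_def)
  have conte: "continuous_on UNIV e" unfolding e_def by (intro continuous_intros)
  have ge: "gweight (e t *s w) = gweight w" for t and w :: "complex^'n"
    by (simp add: gweight_def norm_scale e1)
  note [measurable] = borel_measurable_continuous_onI [OF cont]
  have rot: "(LINT w|lborel. H (e t *s w) * gweight w) = (LINT w|lborel. H w * gweight w)"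
    "integrable lborel (\<lambda>w. H (e t *s w) * gweight w)"
    "(LINT w|lborel. cmod (H (e t *s w) * gweight w)) = (LINT w|lborel. cmod (H w * gweight w))" for t
    using integral_lborel_isometry [OF linear_scale_complex _ surj_scale [OF e1], of t "\<lambda>w. H w * gweight w"]
      integrable_lborel_isometry [OF linear_scale_complex _ surj_scale [OF e1], of t "\<lambda>w. H w * gweight w"] int
      integral_lborel_isometry [OF linear_scale_complex _ surj_scale [OF e1], of t "\<lambda>w. cmod (H w * gweight w)"]
    by (simp_all add: ge norm_scale e1)
  define f where "f = (\<lambda>(t::real) (w::complex^'n). indicator {0..1} t *\<^sub>R (H (e t *s w) * gweight w))"
  have cs: "continuous_on UNIV (\<lambda>p. e (fst p) *s (snd p :: complex^'n))"
    unfolding vector_scalar_mult_def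
    by (intro continuous_on_vec_lambda continuous_intros continuous_on_compose2 [OF conte]) auto
  have "continuous_on UNIV (\<lambda>p. H (e (fst p) *s (snd p)))"
    by (rule continuous_on_compose2 [OF cont cs]) auto
  then have m0: "(\<lambda>p. H (e (fst p) *s (snd p))) \<in> borel_measurable (borel \<Otimes>\<^sub>M borel)"
    unfolding borel_prod by (rule borel_measurable_continuous_onI)
  have fm: "case_prod f \<in> borel_measurable (lborel \<Otimes>\<^sub>M lborel)"
    using m0 unfolding f_def case_prod_unfold by (simp cong: measurable_cong_sets) measurable
  have "integrable lborel (\<lambda>t. indicator {0..1::real} t *\<^sub>R (LINT w|lborel. cmod (H w * gweight w)))"
    by (intro integrable_scaleR_left integrable_real_indicator) auto
  then have fi: "integrable (lborel \<Otimes>\<^sub>M lborel) (case_prod f)"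
    using rot fm
    by (intro lborel_pair.Fubini_integrable) (auto simp: f_def abs_mult split: split_indicator)
  have slice: "(LINT t|lborel. f t w) = H 0 * gweight w" for w
  proof -
    have "(LINT t|lborel. f t w) = (LINT t|lborel. (indicator {0..1} t *\<^sub>R H (e t *s w)) * gweight w)"
      by (simp add: f_def)
    also have "\<dots> = (LINT t|lborel. indicator {0..1} t *\<^sub>R H (e t *s w)) * gweight w"
      by (rule integral_mult_left_zero)
    also have "(LINT t|lborel. indicator {0..1} t *\<^sub>R H (e t *s w)) = H (0 *s w)"
      using circle_mean_value [of "\<lambda>\<zeta>. H (\<zeta> *s w)", OF hol]
      unfolding set_lebesgue_integral_def e_def .
    also have "0 *s w = 0" by simp
    finally show ?thesis .
  qed
  have "(LINT w|lborel. f t w) = indicator {0..1} t *\<^sub>R (LINT w|lborel. H w * gweight w)" for t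
    unfolding f_def rot(1) [of t, symmetric] by (rule integral_scaleR_right)
  then have "(LINT w|lborel. H w * gweight w) = (LINT t|lborel. LINT w|lborel. f t w)"
    by simp
  moreover have "(LINT t|lborel. LINT w|lborel. f t w) = (LINT w|lborel. LINT t|lborel. f t w)"
    by (rule lborel_pair.Fubini_integral [OF fi, symmetric])
  moreover have "(LINT w|lborel. LINT t|lborel. f t w) = H 0"
    unfolding slice using has_bochner_integral_gweight [where 'n='n] by (simp add: has_bochner_integral_iff)
  ultimately show ?thesis by simp
qed

section \<open>The reproducing formula in the Fock space\<close>

text \<open>Weighting makes the Fock norm an \<open>L\<^sup>2\<close> norm with respect to Lebesgue measure, so that the weight need not be
  carried through estimates.\<close>

definition wtd :: "(complex^'n \<Rightarrow> complex) \<Rightarrow> complex^'n \<Rightarrow> complex" where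
  "wtd H z = H z * complex_of_real (exp (- (pi / 2) * (norm z)\<^sup>2))"

text \<open>The reproducing kernel \<open>e^(\<pi> cdot z w)\<close>, weighted in both variables.\<close>

definition kern :: "complex^'n \<Rightarrow> complex^'n \<Rightarrow> complex" where
  "kern z w = exp (complex_of_real pi * cdot z w - complex_of_real ((pi / 2) * ((norm z)\<^sup>2 + (norm w)\<^sup>2)))"

lemma wtd_measurable [measurable]: "H \<in> borel_measurable borel \<Longrightarrow> wtd H \<in> borel_measurable borel"
  unfolding wtd_def [abs_def]
  by (rule borel_measurable_times [OF _ borel_measurable_continuous_onI]) (auto intro!: continuous_intros)

lemma kern_measurable [measurable]:
  "f \<in> borel_measurable M \<Longrightarrow> g \<in> borel_measurable M \<Longrightarrow> (\<lambda>x. kern (f x) (g x)) \<in> borel_measurable M"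
  by (rule borel_measurable_continuous_Pair [of _ _ _ kern])
     (auto simp: case_prod_unfold kern_def intro!: continuous_intros)

lemma cmod_kern: "cmod (kern z w) = exp (- (pi / 2) * (norm (z - w))\<^sup>2)"
  by (simp add: kern_def norm_diff_squared algebra_simps add_divide_distrib)

lemma borel_measurable_cnj [measurable]: "f \<in> borel_measurable M \<Longrightarrow> (\<lambda>x. cnj (f x)) \<in> borel_measurable M"
  by (rule borel_measurable_continuous_on [of cnj]) (intro continuous_intros)

lemma
  fixes g :: "complex^'n \<Rightarrow> 'b::{banach, second_countable_topology}"
  assumes [measurable]: "g \<in> borel_measurable borel"
  shows integral_fock_measure: "(LINT z|fock_measure. g z) = (LINT z|lborel. exp (- pi * (norm z)\<^sup>2) *\<^sub>R g z)"
    and integrable_fock_measure: "integrable fock_measure g \<longleftrightarrow> integrable lborel (\<lambda>z. exp (- pi * (norm z)\<^sup>2) *\<^sub>R g z)"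
proof -
  have m: "g \<in> borel_measurable lebesgue" "(\<lambda>z::complex^'n. exp (- pi * (norm z)\<^sup>2)) \<in> borel_measurable lebesgue"
    by (rule measurable_completion; simp)+
  show "(LINT z|fock_measure. g z) = (LINT z|lborel. exp (- pi * (norm z)\<^sup>2) *\<^sub>R g z)"
    unfolding fock_measure_def using m by (subst integral_density) (simp_all add: integral_completion)
  show "integrable fock_measure g \<longleftrightarrow> integrable lborel (\<lambda>z. exp (- pi * (norm z)\<^sup>2) *\<^sub>R g z)"
    unfolding fock_measure_def using m by (subst integrable_density) (simp_all add: integrable_completion)
qed

lemma cmod_wtd_squared: "(cmod (wtd H z))\<^sup>2 = exp (- pi * (norm z)\<^sup>2) * (cmod (H z))\<^sup>2"
  by (simp add: wtd_def norm_mult power_mult_distrib exp_double [symmetric] mult.commute)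

lemma fock_iff: "H \<in> fock \<longleftrightarrow> entire H \<and> integrable lborel (\<lambda>z. (cmod (wtd H z))\<^sup>2)"
  unfolding fock_def cmod_wtd_squared
  using integrable_fock_measure [of "\<lambda>z. (cmod (H z))\<^sup>2"] by (auto dest: entire_measurable)

lemma fock_norm_squared: 
  assumes [measurable]: "H \<in> borel_measurable borel"
  shows "(fock_norm H)\<^sup>2 = (LINT z|lborel. (cmod (wtd H z))\<^sup>2)"
  unfolding fock_norm_def cmod_wtd_squared
  by (subst integral_fock_measure) simp_all

lemma fock_norm_nonneg: "fock_norm H \<ge> 0"
  by (simp add: fock_norm_def)

lemma fock_inner_wtd: 
  assumes [measurable]: "G \<in> borel_measurable borel" "H \<in> borel_measurable borel"
  shows "fock_inner G H = (LINT z|lborel. wtd G z * cnj (wtd H z))"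
proof -
  have "exp (- pi * (norm z)\<^sup>2) *\<^sub>R (G z * cnj (H z)) = wtd G z * cnj (wtd H z)" for z
  proof -
    have "exp (- pi * (norm z)\<^sup>2) = exp (- (pi / 2) * (norm z)\<^sup>2) * exp (- (pi / 2) * (norm z)\<^sup>2)"
      by (simp add: exp_add [symmetric])
    then show ?thesis by (simp only: wtd_def scaleR_conv_of_real) simp
  qed
  then show ?thesis
    unfolding fock_inner_def by (subst integral_fock_measure) simp_all
qed

lemma fock_measurable [measurable_dest]: "H \<in> fock \<Longrightarrow> H \<in> borel_measurable borel"
  by (simp add: fock_iff entire_measurable)

lemma fock_integrable: "H \<in> fock \<Longrightarrow> integrable lborel (\<lambda>z. (cmod (wtd H z))\<^sup>2)"
  by (simp add: fock_iff)

lemma fock_wtd_kern_integrable: 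
  assumes "H \<in> fock" shows "integrable lborel (\<lambda>w. wtd H w * kern z w)"
  using assms integrable_gauss_shift [of pi z] 
  by (intro integrable_mult_L2) (auto simp: cmod_kern exp_double [symmetric] fock_integrable dest: fock_measurable)

text \<open>At \<open>z = 0\<close> this is the mean value property. In general it is the mean value property of
  \<open>w \<mapsto> H (z + w) e^(-\<pi> cdot w z)\<close>, the translate of \<open>H\<close> by the unitary Weyl operator (up to a constant).\<close>

theorem fock_reproducing:
  assumes H: "H \<in> fock"
  shows "(LINT w|lborel. wtd H w * kern z w) = wtd H z"
proof -
  note [measurable] = fock_measurable [OF H]
  have ent: "entire H" using H by (simp add: fock_iff)
  \<comment> \<open>shifted by \<open>-z\<close> and multiplied by the Gaussian weight, this is a constant times the integrand of the claim\<close>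
  define H' where "H' w = H (z + w) * exp (- complex_of_real pi * cdot w z)" for w
  define c where "c = complex_of_real (exp (- (pi / 2) * (norm z)\<^sup>2))"
  have c0: "c \<noteq> 0" by (simp add: c_def)
  have cont: "continuous_on UNIV H'"
    unfolding H'_def
    by (intro continuous_intros continuous_on_compose2 [OF entire_continuous [OF ent]]) auto
  note [measurable] = borel_measurable_continuous_onI [OF cont]
  have eq: "wtd H u * kern z u = c * (H' (u + - z) * gweight (u + - z))" for u
  proof -
    have "complex_of_real ((norm (u - z))\<^sup>2) = complex_of_real ((norm u)\<^sup>2) + complex_of_real ((norm z)\<^sup>2) - (cdot u z + cdot z u)"
      unfolding norm_diff_squared by (simp add: complex_eq_iff cdot_commute [of z u])
    moreover have "cdot (u - z) z = cdot u z - complex_of_real ((norm z)\<^sup>2)"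
      by (metis add_diff_cancel cdot_add_left cdot_self diff_add_cancel)
    ultimately have "complex_of_real (- (pi / 2) * (norm u)\<^sup>2) + (complex_of_real pi * cdot z u - complex_of_real ((pi / 2) * ((norm z)\<^sup>2 + (norm u)\<^sup>2)))
      = complex_of_real (- (pi / 2) * (norm z)\<^sup>2) + (- complex_of_real pi * cdot (u - z) z + complex_of_real (- pi * (norm (u - z))\<^sup>2))"
      by (simp only: of_real_mult of_real_add of_real_minus of_real_divide) (simp add: field_simps)
    then have "exp (complex_of_real (- (pi / 2) * (norm u)\<^sup>2)) * kern z u
      = c * (exp (- complex_of_real pi * cdot (u - z) z) * gweight (u - z))"
      unfolding kern_def c_def gweight_def exp_of_real [symmetric] exp_add [symmetric] by (rule arg_cong)
    then show ?thesis by (simp add: wtd_def H'_def exp_of_real del: of_real_mult of_real_minus of_real_divide)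
  qed
  have "integrable lborel (\<lambda>u. c * (H' (u + - z) * gweight (u + - z)))"
    using fock_wtd_kern_integrable [OF H, of z] by (simp only: eq)
  from integrable_mult_right [OF this, of "inverse c"]
  have "integrable lborel (\<lambda>u. H' (u + - z) * gweight (u + - z))"
    using c0 by (simp add: mult.assoc [symmetric])
  then have int: "integrable lborel (\<lambda>u. H' u * gweight u)"
    using integrable_lborel_plus [of "\<lambda>u. H' u * gweight u" "- z"] by simp
  have "(LINT w|lborel. wtd H w * kern z w) = c * (LINT u|lborel. H' (u + - z) * gweight (u + - z))"
    unfolding eq by simp
  also have "(LINT u|lborel. H' (u + - z) * gweight (u + - z)) = (LINT u|lborel. H' u * gweight u)"
    by (rule integral_lborel_plus [of "\<lambda>u. H' u * gweight u" "- z"]) measurable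
  also have "\<dots> = H' 0"
  proof (rule gaussian_mean_value [OF cont _ int])
    show "(\<lambda>\<zeta>. H' (\<zeta> *s w)) holomorphic_on UNIV" for w
      unfolding H'_def cdot_scale_left
      by (intro holomorphic_intros entire_holomorphic_slice ent)
  qed
  also have "c * H' 0 = wtd H z" by (simp add: H'_def wtd_def c_def cdot_def)
  finally show ?thesis .
qed

section \<open>Pointwise estimates for Fock functions\<close>

definition kern_mass :: "'n::finite itself \<Rightarrow> real" where
  "kern_mass _ = sqrt (pi / (pi / 2)) ^ DIM(complex^'n)"

lemma nn_integral_cmod_kern:
  "(\<integral>\<^sup>+w. ennreal (cmod (kern z w)) \<partial>lborel) = ennreal (kern_mass TYPE('n))" for z :: "complex^'n"
  using integrable_gauss_shift [of "pi/2" z] integral_gauss_shift [of "pi/2" z]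
  by (subst nn_integral_eq_integral) (simp_all add: cmod_kern kern_mass_def del: mult_minus_left)

lemma cmod_kern_commute: "cmod (kern z w) = cmod (kern w z)"
  by (simp add: cmod_kern norm_minus_commute)

lemma cnj_kern: "cnj (kern z w) = kern w z"
  by (simp add: kern_def exp_cnj cdot_commute [of w z] add.commute)

lemma kern_square_integrable:
  "integrable lborel (\<lambda>w. (cmod (kern z w))\<^sup>2)" "(LINT w|lborel. (cmod (kern z w))\<^sup>2) = 1"
  using integrable_gauss_shift [of pi z] integral_gauss_shift [of pi z]
  by (simp_all add: cmod_kern exp_double [symmetric])

lemma L2_kern_integrable:
  assumes [measurable]: "g \<in> borel_measurable borel" and "integrable lborel (\<lambda>w. (cmod (g w))\<^sup>2)"
  shows "integrable lborel (\<lambda>w. g w * kern z w)"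
  using assms by (intro integrable_mult_L2 kern_square_integrable) auto

lemma fock_pointwise_bound:
  assumes H: "H \<in> fock"
  shows "cmod (wtd H z) \<le> fock_norm H"
proof (rule power2_le_imp_le [OF _ fock_norm_nonneg])
  note [measurable] = fock_measurable [OF H]
  have "cmod (wtd H z) \<le> (LINT w|lborel. cmod (wtd H w * kern z w))"
    unfolding fock_reproducing [OF H, of z, symmetric] by (rule integral_norm_bound)
  also have "\<dots> = (LINT w|lborel. cmod (wtd H w) * cmod (kern z w))" by (simp add: norm_mult)
  finally have "(cmod (wtd H z))\<^sup>2 \<le> (LINT w|lborel. cmod (wtd H w) * cmod (kern z w))\<^sup>2"
    by (rule power_mono) simp
  also have "\<dots> \<le> (LINT w|lborel. (cmod (wtd H w))\<^sup>2) * (LINT w|lborel. (cmod (kern z w))\<^sup>2)"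
    by (intro Cauchy_Schwarz_integral fock_integrable H kern_square_integrable) measurable
  also have "\<dots> = (fock_norm H)\<^sup>2"
    by (simp add: kern_square_integrable fock_norm_squared)
  finally show "(cmod (wtd H z))\<^sup>2 \<le> (fock_norm H)\<^sup>2" .
qed

text \<open>Cauchy-Schwarz with half of the kernel on each side. Unlike \<open>fock_pointwise_bound\<close> it localises
  near \<open>z\<close>, which makes Fock functions vanish at infinity.\<close>

lemma fock_local_bound:
  fixes H :: "complex^'n \<Rightarrow> complex"
  assumes H: "H \<in> fock"
  shows "(cmod (wtd H z))\<^sup>2 \<le> kern_mass TYPE('n) * (LINT w|lborel. (cmod (wtd H w))\<^sup>2 * exp (- (pi / 2) * (norm (z - w))\<^sup>2))"
proof -
  note [measurable] = fock_measurable [OF H]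
  \<comment> \<open>the square root of the modulus of the kernel\<close>
  define s where "s w = complex_of_real (exp (- (pi / 4) * (norm (z - w))\<^sup>2))" for w
  have [measurable]: "s \<in> borel_measurable borel"
    unfolding s_def [abs_def] by (intro borel_measurable_continuous_onI continuous_intros) simp
  have ss: "(cmod (s w))\<^sup>2 = exp (- (pi / 2) * (norm (z - w))\<^sup>2)" for w
    by (simp add: s_def exp_double [symmetric])
  have int: "integrable lborel (\<lambda>w. (cmod (wtd H w * s w))\<^sup>2)"
  proof (rule Bochner_Integration.integrable_bound [OF fock_integrable [OF H]])
    show "AE w in lborel. norm ((cmod (wtd H w * s w))\<^sup>2) \<le> norm ((cmod (wtd H w))\<^sup>2)"
      by (intro AE_I2) (simp add: norm_mult power_mult_distrib ss mult_left_le)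
  qed measurable
  have "cmod (wtd H z) \<le> (LINT w|lborel. cmod (wtd H w * kern z w))"
    unfolding fock_reproducing [OF H, of z, symmetric] by (rule integral_norm_bound)
  also have "\<dots> = (LINT w|lborel. cmod (wtd H w * s w) * cmod (s w))"
    unfolding norm_mult cmod_kern ss [symmetric] unfolding power2_eq_square mult.assoc ..
  finally have "(cmod (wtd H z))\<^sup>2 \<le> (LINT w|lborel. cmod (wtd H w * s w) * cmod (s w))\<^sup>2"
    by (rule power_mono) simp
  also have "\<dots> \<le> (LINT w|lborel. (cmod (wtd H w * s w))\<^sup>2) * (LINT w|lborel. (cmod (s w))\<^sup>2)"
  proof (intro Cauchy_Schwarz_integral int)
    show "integrable lborel (\<lambda>w. (cmod (s w))\<^sup>2)" unfolding ss by (rule integrable_gauss_shift) simp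
  qed measurable
  also have "(LINT w|lborel. (cmod (s w))\<^sup>2) = kern_mass TYPE('n)"
    unfolding ss by (subst integral_gauss_shift) (simp_all add: kern_mass_def)
  finally show ?thesis
    by (simp only: norm_mult power_mult_distrib ss mult.commute)
qed

lemma exp_neg_norm_at_infinity:
  fixes w :: "'a::real_normed_vector"
  assumes "filterlim x at_infinity sequentially" "a > 0"
  shows "(\<lambda>n. exp (- a * (norm (x n - w))\<^sup>2)) \<longlonglongrightarrow> 0"
proof -
  have "filterlim (\<lambda>n. x n + (- w)) at_infinity sequentially"
    by (rule tendsto_add_filterlim_at_infinity' [OF assms(1) tendsto_const])
  then have "filterlim (\<lambda>n. norm (x n - w)) at_top sequentially"
    by (simp add: filterlim_at_infinity_conv_norm_at_top)
  then have "filterlim (\<lambda>n. a * (norm (x n - w))\<^sup>2) at_top sequentially"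
    using assms(2) by (intro filterlim_tendsto_pos_mult_at_top [OF tendsto_const] filterlim_pow_at_top) auto
  then have "filterlim (\<lambda>n. - a * (norm (x n - w))\<^sup>2) at_bot sequentially"
    by (simp add: filterlim_uminus_at_bot)
  then show ?thesis by (rule filterlim_compose [OF exp_at_bot])
qed

lemma fock_vanishes_at_infinity:
  fixes H :: "complex^'n \<Rightarrow> complex"
  assumes H: "H \<in> fock"
  shows "(wtd H \<longlongrightarrow> 0) at_infinity"
proof (rule tendsto_at_infinity_sequentially)
  fix x :: "nat \<Rightarrow> complex^'n" assume x: "filterlim x at_infinity sequentially"
  note [measurable] = fock_measurable [OF H]
  let ?I = "\<lambda>n. LINT w|lborel. (cmod (wtd H w))\<^sup>2 * exp (- (pi / 2) * (norm (x n - w))\<^sup>2)"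
  have m [measurable]: "(\<lambda>w. exp (- (pi / 2) * (norm (x n - w))\<^sup>2)) \<in> borel_measurable borel" for n
    by (intro borel_measurable_continuous_onI continuous_intros)
  have "?I \<longlonglongrightarrow> (LINT w|(lborel :: (complex^'n) measure). 0)"
  proof (rule integral_dominated_convergence [OF _ _ fock_integrable [OF H]])
    show "AE w in lborel. (\<lambda>n. (cmod (wtd H w))\<^sup>2 * exp (- (pi / 2) * (norm (x n - w))\<^sup>2)) \<longlonglongrightarrow> 0"
      using exp_neg_norm_at_infinity [OF x, of "pi / 2"] by (intro AE_I2 tendsto_mult_right_zero) simp
    show "AE w in lborel. norm ((cmod (wtd H w))\<^sup>2 * exp (- (pi / 2) * (norm (x n - w))\<^sup>2)) \<le> (cmod (wtd H w))\<^sup>2" for n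
      by (intro AE_I2) (simp add: mult_left_le)
  qed measurable
  then have "(\<lambda>n. kern_mass TYPE('n) * ?I n) \<longlonglongrightarrow> 0"
    by (intro tendsto_mult_right_zero) simp
  then have "(\<lambda>n. (cmod (wtd H (x n)))\<^sup>2) \<longlonglongrightarrow> 0"
    by (rule Lim_null_comparison [rotated]) (use fock_local_bound [OF H] in auto)
  from tendsto_real_sqrt [OF this] show "(\<lambda>n. wtd H (x n)) \<longlonglongrightarrow> 0"
    by (simp add: tendsto_norm_zero_iff)
qed

section \<open>The orthogonal projection as an integral operator\<close>

lemma entire_lincomb:
  assumes "entire G" "entire H"
  shows "entire (\<lambda>z. a * G z + b * H z)"
  unfolding entire_def
proof
  fix z
  obtain D E where D: "(G has_derivative D) (at z)" "\<And>c v. D (c *s v) = c * D v"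
    and E: "(H has_derivative E) (at z)" "\<And>c v. E (c *s v) = c * E v"
    using assms unfolding entire_def by metis
  have "((\<lambda>z. a * G z + b * H z) has_derivative (\<lambda>v. a * D v + b * E v)) (at z)"
    by (intro has_derivative_add has_derivative_mult_right D E)
  then show "\<exists>D. ((\<lambda>z. a * G z + b * H z) has_derivative D) (at z) \<and> (\<forall>c v. D (c *s v) = c * D v)"
    by (intro exI conjI) (auto simp: D E algebra_simps)
qed

lemma wtd_lincomb: "wtd (\<lambda>z. a * G z + b * H z) z = a * wtd G z + b * wtd H z"
  by (simp add: wtd_def algebra_simps)

lemma wtd_diff: "wtd (\<lambda>z. G z - H z) z = wtd G z - wtd H z"
  by (simp add: wtd_def algebra_simps)

lemma wtd_eq_iff: "wtd G z = wtd H z \<longleftrightarrow> G z = H z"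
  by (simp add: wtd_def)

lemma wtd_eq_0_iff: "wtd G z = 0 \<longleftrightarrow> G z = 0"
  by (simp add: wtd_def)

lemma L2_lincomb:
  fixes f g :: "'a \<Rightarrow> complex"
  assumes [measurable]: "f \<in> borel_measurable M" "g \<in> borel_measurable M"
    and "integrable M (\<lambda>x. (cmod (f x))\<^sup>2)" "integrable M (\<lambda>x. (cmod (g x))\<^sup>2)"
  shows "integrable M (\<lambda>x. (cmod (a * f x + b * g x))\<^sup>2)"
proof (rule Bochner_Integration.integrable_bound)
  show "integrable M (\<lambda>x. 2 * (cmod a)\<^sup>2 * (cmod (f x))\<^sup>2 + 2 * (cmod b)\<^sup>2 * (cmod (g x))\<^sup>2)" using assms by simp
  have "norm ((cmod (a * f x + b * g x))\<^sup>2) \<le> norm (2 * (cmod a)\<^sup>2 * (cmod (f x))\<^sup>2 + 2 * (cmod b)\<^sup>2 * (cmod (g x))\<^sup>2)" for x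
  proof -
    have "(cmod (a * f x + b * g x))\<^sup>2 \<le> (cmod (a * f x) + cmod (b * g x))\<^sup>2"
      by (intro power_mono norm_triangle_ineq) simp
    also have "\<dots> \<le> 2 * (cmod (a * f x))\<^sup>2 + 2 * (cmod (b * g x))\<^sup>2"
      using sum_squares_bound [of "cmod (a * f x)" "cmod (b * g x)"] by (simp add: power2_sum)
    finally show ?thesis by (simp add: norm_mult power_mult_distrib)
  qed
  then show "AE x in M. norm ((cmod (a * f x + b * g x))\<^sup>2) \<le> norm (2 * (cmod a)\<^sup>2 * (cmod (f x))\<^sup>2 + 2 * (cmod b)\<^sup>2 * (cmod (g x))\<^sup>2)" by simp
qed measurable

lemma fock_lincomb:
  assumes "G \<in> fock" "H \<in> fock"
  shows "(\<lambda>z. a * G z + b * H z) \<in> fock"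
proof -
  note [measurable] = fock_measurable [OF assms(1)] fock_measurable [OF assms(2)]
  show ?thesis
    using assms unfolding fock_iff wtd_lincomb by (auto intro!: entire_lincomb L2_lincomb)
qed

lemma fock_diff: "G \<in> fock \<Longrightarrow> H \<in> fock \<Longrightarrow> (\<lambda>z. G z - H z) \<in> fock"
  using fock_lincomb [of G H 1 "-1"] by simp

text \<open>The Bargmann projection in integral form; \<open>fock_proj_eq_bproj\<close> identifies it with the orthogonal
  projection on functions that are square integrable and pointwise bounded after weighting. Products of a bounded
  function and a Fock function are of this kind.\<close>

definition bproj :: "(complex^'n \<Rightarrow> complex) \<Rightarrow> complex^'n \<Rightarrow> complex" where
  "bproj G z = (LINT w|lborel. G w * gweight w * exp (complex_of_real pi * cdot z w))"

lemma wtd_bproj: "wtd (bproj G) z = (LINT w|lborel. wtd G w * kern z w)"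
proof -
  define c where "c = complex_of_real (exp (- (pi / 2) * (norm z)\<^sup>2))"
  have "G w * gweight w * exp (complex_of_real pi * cdot z w) * c = wtd G w * kern z w" for w
  proof -
    have "complex_of_real (- pi * (norm w)\<^sup>2) + complex_of_real pi * cdot z w + complex_of_real (- (pi / 2) * (norm z)\<^sup>2)
      = complex_of_real (- (pi / 2) * (norm w)\<^sup>2) + (complex_of_real pi * cdot z w - complex_of_real ((pi / 2) * ((norm z)\<^sup>2 + (norm w)\<^sup>2)))"
      by (simp add: field_simps)
    then have "gweight w * exp (complex_of_real pi * cdot z w) * c = exp (complex_of_real (- (pi / 2) * (norm w)\<^sup>2)) * kern z w"
      unfolding kern_def c_def gweight_def exp_of_real [symmetric] exp_add [symmetric] by (rule arg_cong)
    then show ?thesis by (simp add: wtd_def exp_of_real mult.assoc del: of_real_mult of_real_minus of_real_divide)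
  qed
  then show ?thesis
    unfolding wtd_def [of "bproj G"] bproj_def c_def [symmetric]
    by (simp flip: integral_mult_left_zero)
qed

lemma cmod_mult_gweight: "cmod (G w * gweight w) = cmod (wtd G w) * exp (- (pi / 2) * (norm w)\<^sup>2)"
  by (simp add: wtd_def gweight_def norm_mult mult.assoc exp_add [symmetric])

lemma entire_bproj:
  fixes G :: "complex^'n \<Rightarrow> complex"
  assumes [measurable]: "G \<in> borel_measurable borel" and bound: "\<And>w. cmod (wtd G w) \<le> C"
  shows "entire (bproj G)"
proof -
  interpret exp_integral "\<lambda>w. G w * gweight w" "\<lambda>z w. complex_of_real pi * cdot z w" C 0 "pi / 2" pi
  proof (rule exp_integral.intro)
    fix w :: "complex^'n"
    have "cmod (G w * gweight w) = cmod (wtd G w) * exp (- (pi / 2) * (norm w)\<^sup>2)"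
      by (rule cmod_mult_gweight)
    also have "\<dots> \<le> C * exp (- (pi / 2) * (norm w)\<^sup>2)"
      by (intro mult_right_mono bound) simp
    finally show "cmod (G w * gweight w) \<le> C * exp (0 * norm w - pi / 2 * (norm w)\<^sup>2)" by simp
    show "linear (\<lambda>z. complex_of_real pi * cdot z w)"
      using linear_compose_scale_right [OF linear_cdot_left [of w], of pi]
      by (simp add: scaleR_conv_of_real)
    show "cmod (complex_of_real pi * cdot z w) \<le> pi * norm z * norm w" for z
      using cmod_cdot_le [of z w] by (simp add: norm_mult)
  qed simp_all
  show ?thesis
    unfolding entire_def bproj_def [abs_def]
    using has_derivative_integral
    by (intro allI exI conjI) (auto simp: cdot_scale_left mult_ac simp flip: integral_mult_right_zero)
qed

text \<open>The kernel has Gaussian modulus, so the Schur test applies even to the integral of the absolute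
  values; this stronger form also justifies Fubini in \<open>bproj_orthogonal\<close>.\<close>

lemma bproj_L2:
  fixes G :: "complex^'n \<Rightarrow> complex"
  assumes [measurable]: "G \<in> borel_measurable borel" and L2: "integrable lborel (\<lambda>z. (cmod (wtd G z))\<^sup>2)"
  shows "integrable lborel (\<lambda>z. (LINT w|lborel. cmod (wtd G w * kern z w))\<^sup>2)"
proof (rule integrableI_nonneg)
  have [measurable]: "(\<lambda>p. wtd G (snd p) * kern (fst p) (snd p)) \<in> borel_measurable (lborel \<Otimes>\<^sub>M lborel)"
    by (simp cong: measurable_cong_sets)
  show "(\<lambda>z. (LINT w|lborel. cmod (wtd G w * kern z w))\<^sup>2) \<in> borel_measurable lborel"
    by (intro borel_measurable_power lborel.borel_measurable_lebesgue_integral) (simp add: case_prod_unfold)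
  have "(\<integral>\<^sup>+z. ennreal ((LINT w|lborel. cmod (wtd G w * kern z w))\<^sup>2) \<partial>lborel)
      = (\<integral>\<^sup>+z. (\<integral>\<^sup>+w. ennreal (cmod (kern z w) * cmod (wtd G w)) \<partial>lborel)\<^sup>2 \<partial>lborel)"
  proof (rule nn_integral_cong)
    fix z
    have "(\<integral>\<^sup>+w. ennreal (cmod (wtd G w * kern z w)) \<partial>lborel) = ennreal (LINT w|lborel. cmod (wtd G w * kern z w))"
      by (intro nn_integral_eq_integral integrable_norm L2_kern_integrable L2) simp_all
    then show "ennreal ((LINT w|lborel. cmod (wtd G w * kern z w))\<^sup>2) = (\<integral>\<^sup>+w. ennreal (cmod (kern z w) * cmod (wtd G w)) \<partial>lborel)\<^sup>2"
      by (simp add: norm_mult mult.commute ennreal_power)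
  qed
  also have "\<dots> \<le> ennreal (kern_mass TYPE('n)) * (\<integral>\<^sup>+w. (\<integral>\<^sup>+z. ennreal (cmod (kern z w)) \<partial>lborel) * ennreal ((cmod (wtd G w))\<^sup>2) \<partial>lborel)"
    by (rule Schur_test) (auto simp: nn_integral_cmod_kern)
  also have "\<dots> = ennreal (kern_mass TYPE('n)) * (ennreal (kern_mass TYPE('n)) * (\<integral>\<^sup>+w. ennreal ((cmod (wtd G w))\<^sup>2) \<partial>lborel))"
    by (simp add: cmod_kern_commute [of _ "_ :: complex^'n"] nn_integral_cmod_kern nn_integral_cmult)
  also have "\<dots> < \<infinity>"
    using L2 by (simp add: nn_integral_eq_integral ennreal_mult_less_top)
  finally show "(\<integral>\<^sup>+z. ennreal ((LINT w|lborel. cmod (wtd G w * kern z w))\<^sup>2) \<partial>lborel) < \<infinity>" .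
qed simp

lemma bproj_in_fock:
  fixes G :: "complex^'n \<Rightarrow> complex"
  assumes [measurable]: "G \<in> borel_measurable borel" and L2: "integrable lborel (\<lambda>z. (cmod (wtd G z))\<^sup>2)"
    and bound: "\<And>w. cmod (wtd G w) \<le> C"
  shows "bproj G \<in> fock"
proof -
  have ent: "entire (bproj G)" by (rule entire_bproj) fact+
  note [measurable] = entire_measurable [OF ent]
  have "integrable lborel (\<lambda>z. (cmod (wtd (bproj G) z))\<^sup>2)"
  proof (rule Bochner_Integration.integrable_bound [OF bproj_L2 [OF assms(1) L2]])
    show "AE z in lborel. norm ((cmod (wtd (bproj G) z))\<^sup>2) \<le> norm ((LINT w|lborel. cmod (wtd G w * kern z w))\<^sup>2)"
      by (intro AE_I2) (simp add: wtd_bproj power_mono)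
  qed measurable
  with ent show ?thesis by (simp add: fock_iff)
qed

text \<open>Fubini moves the projection to the other factor, where the reproducing formula removes it.\<close>

lemma bproj_orthogonal:
  fixes G :: "complex^'n \<Rightarrow> complex"
  assumes [measurable]: "G \<in> borel_measurable borel" and L2: "integrable lborel (\<lambda>z. (cmod (wtd G z))\<^sup>2)"
    and bound: "\<And>w. cmod (wtd G w) \<le> C" and H: "H \<in> fock"
  shows "fock_inner (\<lambda>z. G z - bproj G z) H = 0"
proof -
  have P: "bproj G \<in> fock" by (rule bproj_in_fock) fact+
  note [measurable] = fock_measurable [OF P] fock_measurable [OF H]
  define f where "f z w = wtd G w * kern z w * cnj (wtd H z)" for z w
  have fm: "case_prod f \<in> borel_measurable (lborel \<Otimes>\<^sub>M lborel)"
    unfolding f_def by (simp cong: measurable_cong_sets)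
  have "integrable lborel (\<lambda>z. complex_of_real (LINT w|lborel. cmod (wtd G w * kern z w)) * wtd H z)"
  proof (rule integrable_mult_L2)
    have [measurable]: "(\<lambda>p. wtd G (snd p) * kern (fst p) (snd p)) \<in> borel_measurable (lborel \<Otimes>\<^sub>M lborel)"
      by (simp cong: measurable_cong_sets)
    have [measurable]: "(\<lambda>z. LINT w|lborel. cmod (wtd G w * kern z w)) \<in> borel_measurable lborel"
      by (rule lborel.borel_measurable_lebesgue_integral) (simp add: case_prod_unfold)
    show "(\<lambda>z. complex_of_real (LINT w|lborel. cmod (wtd G w * kern z w))) \<in> borel_measurable lborel"
      by measurable
    show "integrable lborel (\<lambda>z. (cmod (complex_of_real (LINT w|lborel. cmod (wtd G w * kern z w))))\<^sup>2)"
      using bproj_L2 [OF assms(1) L2] by simp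
  qed (use fock_integrable [OF H] in auto)
  from integrable_norm [OF this] have "integrable lborel (\<lambda>z. LINT w|lborel. norm (f z w))"
    by (simp add: f_def norm_mult)
  then have fi: "integrable (lborel \<Otimes>\<^sub>M lborel) (case_prod f)"
    by (intro lborel_pair.Fubini_integrable fm) (auto simp: f_def L2_kern_integrable L2)
  have "(LINT z|lborel. wtd (bproj G) z * cnj (wtd H z)) = (LINT z|lborel. LINT w|lborel. f z w)"
    by (simp add: wtd_bproj f_def flip: integral_mult_left_zero)
  also have "\<dots> = (LINT w|lborel. LINT z|lborel. f z w)"
    by (rule lborel_pair.Fubini_integral [OF fi, symmetric])
  also have "\<dots> = (LINT w|lborel. wtd G w * cnj (wtd H w))"
  proof -
    have "(LINT z|lborel. f z w) = wtd G w * cnj (wtd H w)" for w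
    proof -
      have "(LINT z|lborel. f z w) = (LINT z|lborel. wtd G w * cnj (wtd H z * kern w z))"
        by (simp add: f_def cnj_kern mult_ac)
      also have "\<dots> = wtd G w * cnj (LINT z|lborel. wtd H z * kern w z)"
        by (simp only: integral_mult_right_zero Bochner_Integration.integral_cnj)
      finally show ?thesis by (simp add: fock_reproducing H)
    qed
    then show ?thesis by simp
  qed
  finally have eq: "(LINT z|lborel. wtd (bproj G) z * cnj (wtd H z)) = (LINT w|lborel. wtd G w * cnj (wtd H w))" .
  have i: "integrable lborel (\<lambda>z. wtd G z * cnj (wtd H z))" "integrable lborel (\<lambda>z. wtd (bproj G) z * cnj (wtd H z))"
    by (intro integrable_mult_L2; use L2 fock_integrable [OF H] fock_integrable [OF P] in simp)+
  show ?thesis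
    using eq i by (simp add: fock_inner_wtd wtd_diff left_diff_distrib)
qed

lemma fock_norm_0_imp_0:
  assumes "H \<in> fock" "fock_norm H = 0" shows "H = (\<lambda>z. 0)"
  using fock_pointwise_bound [OF assms(1)] assms(2) by (simp add: fun_eq_iff wtd_eq_0_iff)

lemma fock_proj_eq_bproj:
  fixes G :: "complex^'n \<Rightarrow> complex"
  assumes [measurable]: "G \<in> borel_measurable borel" and L2: "integrable lborel (\<lambda>z. (cmod (wtd G z))\<^sup>2)"
    and bound: "\<And>w. cmod (wtd G w) \<le> C"
  shows "fock_proj G = bproj G"
  unfolding fock_proj_def
proof (rule the_equality)
  have P: "bproj G \<in> fock" by (rule bproj_in_fock) fact+
  show "bproj G \<in> fock \<and> (\<forall>H\<in>fock. fock_inner (\<lambda>z. G z - bproj G z) H = 0)"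
    using P bproj_orthogonal [OF assms] by blast
  fix K assume K: "K \<in> fock \<and> (\<forall>H\<in>fock. fock_inner (\<lambda>z. G z - K z) H = 0)"
  define H where "H z = K z - bproj G z" for z
  have H: "H \<in> fock" unfolding H_def by (intro fock_diff P) (use K in blast)
  note [measurable] = fock_measurable [OF P] fock_measurable [OF H] fock_measurable [OF conjunct1 [OF K]]
  have i: "integrable lborel (\<lambda>z. wtd G z * cnj (wtd H z))" "integrable lborel (\<lambda>z. wtd (bproj G) z * cnj (wtd H z))"
    "integrable lborel (\<lambda>z. wtd K z * cnj (wtd H z))"
    by (intro integrable_mult_L2; use L2 fock_integrable [OF H] fock_integrable [OF P] fock_integrable [OF conjunct1 [OF K]] in simp)+
  have "fock_inner (\<lambda>z. G z - K z) H = 0" "fock_inner (\<lambda>z. G z - bproj G z) H = 0"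
    using K H bproj_orthogonal [OF assms H] by auto
  then have "(LINT z|lborel. wtd K z * cnj (wtd H z)) = (LINT z|lborel. wtd (bproj G) z * cnj (wtd H z))"
    using i by (simp add: fock_inner_wtd wtd_diff left_diff_distrib)
  moreover have "(LINT z|lborel. wtd H z * cnj (wtd H z))
      = (LINT z|lborel. wtd K z * cnj (wtd H z) - wtd (bproj G) z * cnj (wtd H z))"
    by (simp add: left_diff_distrib [symmetric] H_def [abs_def] wtd_diff)
  ultimately have "(LINT z|lborel. wtd H z * cnj (wtd H z)) = 0"
    using i by simp
  then have "complex_of_real (LINT z|lborel. (cmod (wtd H z))\<^sup>2) = 0"
    by (simp only: complex_norm_square [symmetric] integral_complex_of_real)
  then have "fock_norm H = 0"
    by (simp add: fock_norm_squared [symmetric])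
  from fock_norm_0_imp_0 [OF H this] show "K = bproj G" by (simp add: H_def fun_eq_iff)
qed

section \<open>The Fock space as a metric space\<close>

lemma fock_norm_add:
  assumes G: "G \<in> fock" and H: "H \<in> fock"
  shows "fock_norm (\<lambda>z. G z + H z) \<le> fock_norm G + fock_norm H"
proof (rule power2_le_imp_le)
  note [measurable] = fock_measurable [OF G] fock_measurable [OF H]
  have wa: "wtd (\<lambda>z. G z + H z) z = wtd G z + wtd H z" for z by (simp add: wtd_def algebra_simps)
  have i: "integrable lborel (\<lambda>z. cmod (wtd G z) * cmod (wtd H z))"
    using integrable_norm [OF integrable_mult_L2 [OF _ _ fock_integrable [OF G] fock_integrable [OF H]]]
    by (simp add: norm_mult)
  have s: "integrable lborel (\<lambda>z. (cmod (wtd G z + wtd H z))\<^sup>2)"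
    using L2_lincomb [OF _ _ fock_integrable [OF G] fock_integrable [OF H], of 1 1] by simp
  have "(fock_norm (\<lambda>z. G z + H z))\<^sup>2 = (LINT z|lborel. (cmod (wtd G z + wtd H z))\<^sup>2)"
    by (simp add: fock_norm_squared wa)
  also have "\<dots> \<le> (LINT z|lborel. (cmod (wtd G z))\<^sup>2 + (cmod (wtd H z))\<^sup>2 + 2 * (cmod (wtd G z) * cmod (wtd H z)))"
  proof (rule integral_mono [OF s])
    fix z
    have "(cmod (wtd G z + wtd H z))\<^sup>2 \<le> (cmod (wtd G z) + cmod (wtd H z))\<^sup>2"
      by (intro power_mono norm_triangle_ineq) simp
    then show "(cmod (wtd G z + wtd H z))\<^sup>2 \<le> (cmod (wtd G z))\<^sup>2 + (cmod (wtd H z))\<^sup>2 + 2 * (cmod (wtd G z) * cmod (wtd H z))"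
      by (simp add: power2_sum)
  qed (use i fock_integrable [OF G] fock_integrable [OF H] in simp)
  also have "\<dots> = (fock_norm G)\<^sup>2 + (fock_norm H)\<^sup>2 + 2 * (LINT z|lborel. cmod (wtd G z) * cmod (wtd H z))"
    using i fock_integrable [OF G] fock_integrable [OF H] by (simp add: fock_norm_squared)
  also have "(LINT z|lborel. cmod (wtd G z) * cmod (wtd H z)) \<le> fock_norm G * fock_norm H"
  proof (rule power2_le_imp_le)
    show "(LINT z|lborel. cmod (wtd G z) * cmod (wtd H z))\<^sup>2 \<le> (fock_norm G * fock_norm H)\<^sup>2"
      using Cauchy_Schwarz_integral [OF _ _ fock_integrable [OF G] fock_integrable [OF H]]
      by (simp add: power_mult_distrib fock_norm_squared)
  qed (simp add: fock_norm_nonneg)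
  finally show "(fock_norm (\<lambda>z. G z + H z))\<^sup>2 \<le> (fock_norm G + fock_norm H)\<^sup>2"
    by (simp add: power2_sum)
qed (simp add: fock_norm_nonneg)

lemma fock_dist_commute: "fock_dist G H = fock_dist H G"
  by (simp add: fock_dist_def fock_norm_def norm_minus_commute)

interpretation fock: Metric_space fock fock_dist
proof
  fix G H K :: "complex^'n \<Rightarrow> complex"
  show "0 \<le> fock_dist G H" by (simp add: fock_dist_def fock_norm_nonneg)
  show "fock_dist G H = fock_dist H G" by (rule fock_dist_commute)
  show "fock_dist G K \<le> fock_dist G H + fock_dist H K" if "G \<in> fock" "H \<in> fock" "K \<in> fock"
    using fock_norm_add [OF fock_diff fock_diff, of G H H K] that by (simp add: fock_dist_def)
  show "fock_dist G H = 0 \<longleftrightarrow> G = H" if "G \<in> fock" "H \<in> fock"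
  proof
    assume "fock_dist G H = 0"
    then show "G = H"
      using fock_norm_0_imp_0 [OF fock_diff [OF that]] by (simp add: fock_dist_def fun_eq_iff)
  qed (simp add: fock_dist_def fock_norm_def)
qed

lemma fock_norm_diff:
  assumes G: "G \<in> fock" and H: "H \<in> fock"
  shows "fock_norm (\<lambda>z. G z - H z) \<le> fock_norm G + fock_norm H"
proof -
  have "fock_norm (\<lambda>z. - H z) = fock_norm H" by (simp add: fock_norm_def)
  moreover have "(\<lambda>z. - H z) \<in> fock" using fock_lincomb [OF H H, of "-1" 0] by simp
  ultimately show ?thesis using fock_norm_add [OF G, of "\<lambda>z. - H z"] by simp
qed

text \<open>Sequences in the closure are shadowed by sequences in \<open>S\<close>, so it suffices to extract
  subsequences from the latter.\<close>

lemma (in Metric_space) compactin_closure_of_sequentially: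
  assumes S: "S \<subseteq> M"
  shows "compactin mtopology (mtopology closure_of S) \<longleftrightarrow>
    (\<forall>\<sigma>. range \<sigma> \<subseteq> S \<longrightarrow> (\<exists>l\<in>M. \<exists>r::nat\<Rightarrow>nat. strict_mono r \<and> (\<lambda>n. d (\<sigma> (r n)) l) \<longlonglongrightarrow> 0))"
proof
  assume L: "compactin mtopology (mtopology closure_of S)"
  show "\<forall>\<sigma>. range \<sigma> \<subseteq> S \<longrightarrow> (\<exists>l\<in>M. \<exists>r::nat\<Rightarrow>nat. strict_mono r \<and> (\<lambda>n. d (\<sigma> (r n)) l) \<longlonglongrightarrow> 0)"
  proof (intro allI impI)
    fix \<sigma> :: "nat \<Rightarrow> 'a" assume "range \<sigma> \<subseteq> S"
    moreover have "S \<subseteq> mtopology closure_of S" using S by (simp add: closure_of_subset)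
    ultimately have "range \<sigma> \<subseteq> mtopology closure_of S" by blast
    with L obtain l r where "strict_mono r" "limitin mtopology (\<sigma> \<circ> r) l sequentially"
      unfolding compactin_sequentially by blast
    then show "\<exists>l\<in>M. \<exists>r::nat\<Rightarrow>nat. strict_mono r \<and> (\<lambda>n. d (\<sigma> (r n)) l) \<longlonglongrightarrow> 0"
      by (auto simp: limitin_metric_dist_null)
  qed
next
  assume R: "\<forall>\<sigma>. range \<sigma> \<subseteq> S \<longrightarrow> (\<exists>l\<in>M. \<exists>r::nat\<Rightarrow>nat. strict_mono r \<and> (\<lambda>n. d (\<sigma> (r n)) l) \<longlonglongrightarrow> 0)"
  show "compactin mtopology (mtopology closure_of S)"
    unfolding compactin_sequentially
  proof (intro conjI allI impI)
    show "mtopology closure_of S \<subseteq> M"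
      using closure_of_subset_topspace [of mtopology S] by simp
    fix \<sigma> :: "nat \<Rightarrow> 'a" assume \<sigma>: "range \<sigma> \<subseteq> mtopology closure_of S"
    have "\<exists>y\<in>S. y \<in> mball (\<sigma> n) (1 / real (Suc n))" for n
    proof -
      have "\<sigma> n \<in> mtopology closure_of S" using \<sigma> by blast
      then show ?thesis unfolding metric_closure_of by simp
    qed
    then obtain \<tau> where \<tau>: "\<And>n. \<tau> n \<in> S" "\<And>n. \<tau> n \<in> mball (\<sigma> n) (1 / real (Suc n))" by metis
    then obtain l r where l: "l \<in> M" and r: "strict_mono (r :: nat \<Rightarrow> nat)" and lim: "(\<lambda>n. d (\<tau> (r n)) l) \<longlonglongrightarrow> 0"
      using R by (metis image_subsetI)
    have "(\<lambda>n. 1 / real (Suc (r n)) + d (\<tau> (r n)) l) \<longlonglongrightarrow> 0 + 0"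
    proof (intro tendsto_add lim)
      show "(\<lambda>n. 1 / real (Suc (r n))) \<longlonglongrightarrow> 0"
        using LIMSEQ_subseq_LIMSEQ [OF LIMSEQ_inverse_real_of_nat r] by (simp add: o_def divide_inverse)
    qed
    then have lim0: "(\<lambda>n. 1 / real (Suc (r n)) + d (\<tau> (r n)) l) \<longlonglongrightarrow> 0" by simp
    have "(\<lambda>n. d (\<sigma> (r n)) l) \<longlonglongrightarrow> 0"
    proof (rule Lim_null_comparison [OF always_eventually lim0])
      show "\<forall>n. norm (d (\<sigma> (r n)) l) \<le> 1 / real (Suc (r n)) + d (\<tau> (r n)) l"
      proof
        fix n
        have "d (\<sigma> (r n)) l \<le> d (\<sigma> (r n)) (\<tau> (r n)) + d (\<tau> (r n)) l"
          using \<tau>(2) [of "r n"] l by (intro triangle) auto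
        also have "d (\<sigma> (r n)) (\<tau> (r n)) \<le> 1 / real (Suc (r n))"
          using \<tau>(2) [of "r n"] by simp
        finally show "norm (d (\<sigma> (r n)) l) \<le> 1 / real (Suc (r n)) + d (\<tau> (r n)) l" by simp
      qed
    qed
    moreover have "\<sigma> n \<in> M" "\<tau> n \<in> M" for n using \<tau>(2) [of n] by auto
    ultimately have "limitin mtopology (\<sigma> \<circ> r) l sequentially" "limitin mtopology (\<tau> \<circ> r) l sequentially"
      using lim l by (simp_all add: limitin_metric_dist_null)
    moreover from this(2) have "l \<in> mtopology closure_of S"
      unfolding closure_of_sequentially using \<tau> S l by (auto intro!: exI [of _ "\<tau> \<circ> r"])
    ultimately show "\<exists>l r. l \<in> mtopology closure_of S \<and> strict_mono r \<and> limitin mtopology (\<sigma> \<circ> r) l sequentially"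
      using r by blast
  qed
qed

section \<open>Pointwise convergent subsequences and compact operators\<close>

lemma cmod_exp_diff_le: "cmod (exp a - exp b) \<le> cmod (a - b) * exp (cmod a + cmod b)"
proof -
  have "cmod (exp a - exp b) \<le> exp (cmod a + cmod b) * cmod (a - b)"
  proof (rule field_differentiable_bound [of "cball 0 (cmod a + cmod b)" exp exp])
    fix z :: complex assume "z \<in> cball 0 (cmod a + cmod b)"
    then show "cmod (exp z) \<le> exp (cmod a + cmod b)"
      using complex_Re_le_cmod [of z] by simp
  qed (auto intro!: derivative_eq_intros)
  then show ?thesis by (simp add: mult.commute)
qed

lemma fock_eq_bproj:
  assumes "H \<in> fock" shows "bproj H z = H z"
  using fock_reproducing [OF assms, of z] by (simp add: wtd_bproj [symmetric] wtd_eq_iff)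

text \<open>Evaluation at \<open>z\<close> is integration against \<open>e^(\<pi> cdot z u)\<close>, which is Lipschitz in \<open>z\<close> on the unit ball around
  a point with a Gaussian-integrable constant.\<close>

lemma fock_equicontinuous:
  fixes z :: "complex^'n"
  shows "\<exists>K\<ge>0. \<forall>H\<in>fock. \<forall>w. norm (z - w) \<le> 1 \<longrightarrow> cmod (H z - H w) \<le> fock_norm H * K * norm (z - w)"
proof -
  define c where "c = pi * (2 * norm z + 1)"
  define K where "K = pi * (LINT u|lborel. norm u ^ 1 * exp (c * norm u - (pi / 2) * (norm (u :: complex^'n))\<^sup>2))"
  have int: "integrable lborel (\<lambda>u::complex^'n. norm u ^ 1 * exp (c * norm u - (pi / 2) * (norm u)\<^sup>2))"
    by (rule integrable_gauss_weight) simp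
  have "cmod (H z - H w) \<le> fock_norm H * K * norm (z - w)" if H: "H \<in> fock" and w: "norm (z - w) \<le> 1" for H w
  proof -
    note [measurable] = fock_measurable [OF H]
    let ?e = "\<lambda>z u. exp (complex_of_real pi * cdot z u)"
    have pw: "cmod (H u * gweight u * ?e z u - H u * gweight u * ?e w u)
       \<le> (fock_norm H * pi * norm (z - w)) * (norm u ^ 1 * exp (c * norm u - (pi / 2) * (norm u)\<^sup>2))" for u
    proof -
      have wz: "norm w \<le> norm z + 1" using w norm_triangle_ineq2 [of w z] by (simp add: norm_minus_commute)
      have c1: "cmod (complex_of_real pi * cdot x u) \<le> pi * (norm x * norm u)" for x
        using cmod_cdot_le [of x u] by (simp add: norm_mult)
      have "cmod (?e z u - ?e w u) \<le> cmod (complex_of_real pi * cdot (z - w) u) * exp (cmod (complex_of_real pi * cdot z u) + cmod (complex_of_real pi * cdot w u))"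
        using cmod_exp_diff_le [of "complex_of_real pi * cdot z u" "complex_of_real pi * cdot w u"]
          linear_diff [OF linear_cdot_left, of z w u]
        by (simp add: right_diff_distrib)
      also have "\<dots> \<le> (pi * (norm (z - w) * norm u)) * exp (c * norm u)"
      proof (intro mult_mono c1)
        have "pi * (norm w * norm u) \<le> pi * ((norm z + 1) * norm u)"
          by (intro mult_left_mono mult_right_mono wz) auto
        then show "exp (cmod (complex_of_real pi * cdot z u) + cmod (complex_of_real pi * cdot w u)) \<le> exp (c * norm u)"
          using c1 [of z] c1 [of w] by (simp add: c_def algebra_simps)
      qed auto
      finally have e: "cmod (?e z u - ?e w u) \<le> (pi * (norm (z - w) * norm u)) * exp (c * norm u)" .
      have "cmod (H u * gweight u * ?e z u - H u * gweight u * ?e w u) = cmod (H u * gweight u) * cmod (?e z u - ?e w u)"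
        by (simp add: norm_mult [symmetric] right_diff_distrib)
      also have "\<dots> \<le> (fock_norm H * exp (- (pi / 2) * (norm u)\<^sup>2)) * ((pi * (norm (z - w) * norm u)) * exp (c * norm u))"
        unfolding cmod_mult_gweight
        by (intro mult_mono e mult_right_mono fock_pointwise_bound H) (simp_all add: fock_norm_nonneg)
      also have "\<dots> = (fock_norm H * pi * norm (z - w)) * (norm u ^ 1 * (exp (c * norm u) * exp (- (pi / 2) * (norm u)\<^sup>2)))"
        by simp
      also have "exp (c * norm u) * exp (- (pi / 2) * (norm u)\<^sup>2) = exp (c * norm u - (pi / 2) * (norm u)\<^sup>2)"
        by (simp add: exp_add [symmetric])
      finally show ?thesis .
    qed
    have i: "integrable lborel (\<lambda>u. H u * gweight u * ?e x u)" for x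
    proof (rule Bochner_Integration.integrable_bound)
      show "integrable lborel (\<lambda>u::complex^'n. fock_norm H * (norm u ^ 0 * exp ((pi * norm x) * norm u - (pi / 2) * (norm u)\<^sup>2)))"
        by (intro integrable_mult_right integrable_gauss_weight) simp
      have "cmod (H u * gweight u * ?e x u) \<le> fock_norm H * (norm u ^ 0 * exp ((pi * norm x) * norm u - (pi / 2) * (norm u)\<^sup>2))" for u
      proof -
        have "cmod (H u * gweight u * ?e x u) \<le> (fock_norm H * exp (- (pi / 2) * (norm u)\<^sup>2)) * exp (pi * norm x * norm u)"
          unfolding norm_mult [of "H u * gweight u"] cmod_mult_gweight
          using cmod_cdot_le [of x u] complex_Re_le_cmod [of "cdot x u"]
          by (intro mult_mono mult_right_mono fock_pointwise_bound H) (simp_all add: fock_norm_nonneg mult.assoc)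
        then show ?thesis by (simp add: mult.assoc exp_add [symmetric])
      qed
      then show "AE u in lborel. cmod (H u * gweight u * ?e x u) \<le> norm (fock_norm H * (norm u ^ 0 * exp ((pi * norm x) * norm u - (pi / 2) * (norm u)\<^sup>2)))"
        by (intro AE_I2) (simp add: fock_norm_nonneg)
    qed measurable
    have "H z - H w = (LINT u|lborel. H u * gweight u * ?e z u - H u * gweight u * ?e w u)"
      using i by (simp add: bproj_def [symmetric] fock_eq_bproj [OF H])
    also have "cmod \<dots> \<le> (LINT u|lborel. (fock_norm H * pi * norm (z - w)) * (norm (u::complex^'n) ^ 1 * exp (c * norm u - (pi / 2) * (norm u)\<^sup>2)))"
      by (rule Bochner_Integration.integral_norm_bound_integral [OF Bochner_Integration.integrable_diff [OF i i] integrable_mult_right [OF int] pw])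
    also have "\<dots> = fock_norm H * K * norm (z - w)" by (simp add: K_def)
    finally show ?thesis .
  qed
  moreover have "K \<ge> 0" unfolding K_def by (intro mult_nonneg_nonneg integral_nonneg_AE) auto
  ultimately show ?thesis by blast
qed

text \<open>Weak sequential compactness of balls in concrete form: a diagonal sequence converges on a countable
  dense set, equicontinuity extends this to all points, dominated convergence in the
  reproducing formula makes the limit entire, and Fatou's lemma bounds its norm.\<close>

lemma fock_pointwise_subsequence:
  fixes H :: "nat \<Rightarrow> complex^'n \<Rightarrow> complex"
  assumes H: "\<And>n. H n \<in> fock" and B: "\<And>n. fock_norm (H n) \<le> B"
  obtains r L where "strict_mono (r :: nat \<Rightarrow> nat)" "L \<in> fock" "\<And>z. (\<lambda>n. H (r n) z) \<longlonglongrightarrow> L z"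
proof -
  note [measurable] = fock_measurable [OF H]
  have B0: "B \<ge> 0" using order_trans [OF fock_norm_nonneg B [of 0]] .
  have wB: "cmod (wtd (H n) z) \<le> B" for n z
    using fock_pointwise_bound [OF H, of n z] B [of n] by simp
  obtain D :: "(complex^'n) set" where D: "countable D" "\<And>X. open X \<Longrightarrow> X \<noteq> {} \<Longrightarrow> \<exists>d\<in>D. d \<in> X"
    using countable_dense_exists by metis
  obtain r where r: "strict_mono (r :: nat \<Rightarrow> nat)" and conv: "\<And>z. z \<in> D \<Longrightarrow> \<exists>l. (\<lambda>n. wtd (H (r n)) z) \<longlonglongrightarrow> l"
    by (rule function_convergent_subsequence [OF D(1), of "\<lambda>n. wtd (H n)" B]) (use wB in auto)
  have convD: "Cauchy (\<lambda>n. H (r n) z)" if zD: "z \<in> D" for z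
  proof -
    obtain l where l: "(\<lambda>n. wtd (H (r n)) z) \<longlonglongrightarrow> l" using conv [OF zD] by blast
    have eq: "wtd (H (r n)) z * complex_of_real (exp ((pi / 2) * (norm z)\<^sup>2)) = H (r n) z" for n
      by (simp add: wtd_def mult.assoc exp_add [symmetric] flip: of_real_mult)
    show ?thesis
      using tendsto_mult_right [OF l, of "complex_of_real (exp ((pi / 2) * (norm z)\<^sup>2))"]
      unfolding eq by (rule LIMSEQ_imp_Cauchy)
  qed
  have "Cauchy (\<lambda>n. H (r n) z)" for z
  proof (rule metric_CauchyI)
    fix e :: real assume e: "e > 0"
    obtain K where K: "K \<ge> 0" "\<And>G w. G \<in> fock \<Longrightarrow> norm (z - w) \<le> 1 \<Longrightarrow> cmod (G z - G w) \<le> fock_norm G * K * norm (z - w)"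
      using fock_equicontinuous [of z] by blast
    \<comment> \<open>the summand 1 in the denominator avoids division by 0\<close>
    define d where "d = min 1 (e / (4 * (B * K + 1)))"
    have BK: "B * K \<ge> 0" using B0 K by simp
    have d: "d > 0" "d \<le> 1" using e BK by (simp_all add: d_def)
    have dd: "B * K * d \<le> e / 4"
    proof -
      have "B * K * d \<le> (B * K + 1) * (e / (4 * (B * K + 1)))"
        using d BK by (intro mult_mono) (auto simp: d_def)
      also have "\<dots> = e / 4" using BK by (simp add: field_simps)
      finally show ?thesis .
    qed
    obtain w where w: "w \<in> D" "dist z w < d" using D(2) [of "ball z d"] d by auto
    have near: "cmod (H n z - H n w) \<le> e / 4" for n
    proof -
      have "cmod (H n z - H n w) \<le> fock_norm (H n) * K * norm (z - w)"
        using K(2) [OF H, of w n] w d by (simp add: dist_norm)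
      also have "\<dots> \<le> B * K * d"
        using w K B by (intro mult_mono) (auto simp: dist_norm fock_norm_nonneg B0)
      finally show ?thesis using dd by simp
    qed
    obtain N where N: "\<And>m n. m \<ge> N \<Longrightarrow> n \<ge> N \<Longrightarrow> dist (H (r m) w) (H (r n) w) < e / 4"
      using metric_CauchyD [OF convD [OF w(1)], of "e / 4"] e by auto
    have "dist (H (r m) z) (H (r n) z) < e" if "m \<ge> N" "n \<ge> N" for m n
    proof -
      have "dist (H (r m) z) (H (r n) z) \<le> dist (H (r m) z) (H (r m) w) + (dist (H (r m) w) (H (r n) w) + dist (H (r n) w) (H (r n) z))"
        by (meson add_left_mono dist_triangle order_trans)
      also have "\<dots> \<le> e / 4 + (e / 4 + e / 4)"
        using near [of "r m"] near [of "r n"] N [OF that]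
        by (intro add_mono) (simp_all add: dist_norm norm_minus_commute)
      also have "\<dots> < e" using e by simp
      finally show ?thesis .
    qed
    then show "\<exists>M. \<forall>m\<ge>M. \<forall>n\<ge>M. dist (H (r m) z) (H (r n) z) < e" by blast
  qed
  then have "\<forall>z. \<exists>l. (\<lambda>n. H (r n) z) \<longlonglongrightarrow> l" by (meson Cauchy_convergent_iff convergent_def)
  then obtain L where L: "\<And>z. (\<lambda>n. H (r n) z) \<longlonglongrightarrow> L z" by metis
  have [measurable]: "L \<in> borel_measurable borel"
    by (rule borel_measurable_LIMSEQ_metric [OF _ L]) measurable
  have wL: "(\<lambda>n. wtd (H (r n)) z) \<longlonglongrightarrow> wtd L z" for z
    unfolding wtd_def by (intro tendsto_mult_right L)
  have LB: "cmod (wtd L z) \<le> B" for z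
    by (rule LIMSEQ_le_const2 [OF tendsto_norm [OF wL]]) (use wB in auto)
  have "bproj L z = L z" for z
  proof -
    have "(\<lambda>n. bproj (H (r n)) z) \<longlonglongrightarrow> bproj L z"
      unfolding bproj_def
    proof (rule integral_dominated_convergence)
      show "integrable lborel (\<lambda>u::complex^'n. B * (norm u ^ 0 * exp ((pi * norm z) * norm u - (pi / 2) * (norm u)\<^sup>2)))"
        by (intro integrable_mult_right integrable_gauss_weight) simp
      show "AE u in lborel. (\<lambda>n. H (r n) u * gweight u * exp (complex_of_real pi * cdot z u)) \<longlonglongrightarrow> L u * gweight u * exp (complex_of_real pi * cdot z u)"
        by (intro AE_I2 tendsto_mult_right L)
      fix n
      have "cmod (H (r n) u * gweight u * exp (complex_of_real pi * cdot z u)) \<le> B * (norm u ^ 0 * exp ((pi * norm z) * norm u - (pi / 2) * (norm u)\<^sup>2))" for u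
      proof -
        have "cmod (H (r n) u * gweight u * exp (complex_of_real pi * cdot z u)) \<le> (B * exp (- (pi / 2) * (norm u)\<^sup>2)) * exp (pi * norm z * norm u)"
          unfolding norm_mult [of "H (r n) u * gweight u"] cmod_mult_gweight
          using cmod_cdot_le [of z u] complex_Re_le_cmod [of "cdot z u"]
          by (intro mult_mono mult_right_mono wB) (simp_all add: B0 mult.assoc)
        then show ?thesis by (simp add: mult.assoc exp_add [symmetric])
      qed
      then show "AE u in lborel. cmod (H (r n) u * gweight u * exp (complex_of_real pi * cdot z u)) \<le> B * (norm u ^ 0 * exp ((pi * norm z) * norm u - (pi / 2) * (norm u)\<^sup>2))"
        by (intro AE_I2)
    qed measurable
    then have "(\<lambda>n. H (r n) z) \<longlonglongrightarrow> bproj L z" by (simp add: fock_eq_bproj [OF H])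
    then show ?thesis using L LIMSEQ_unique by blast
  qed
  then have ent: "entire L"
    using entire_bproj [of L B] LB by (simp add: ext [of "bproj L" L])
  have "integrable lborel (\<lambda>z. (cmod (wtd L z))\<^sup>2)"
  proof (rule integrableI_nonneg)
    have "(\<integral>\<^sup>+z. ennreal ((cmod (wtd L z))\<^sup>2) \<partial>lborel) = (\<integral>\<^sup>+z. liminf (\<lambda>n. ennreal ((cmod (wtd (H (r n)) z))\<^sup>2)) \<partial>lborel)"
      by (intro nn_integral_cong lim_imp_Liminf [symmetric] tendsto_ennrealI tendsto_power tendsto_norm wL) simp
    also have "\<dots> \<le> liminf (\<lambda>n. \<integral>\<^sup>+z. ennreal ((cmod (wtd (H (r n)) z))\<^sup>2) \<partial>lborel)"
      by (rule nn_integral_liminf) measurable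
    also have "\<dots> \<le> liminf (\<lambda>n::nat. ennreal (B\<^sup>2))"
    proof (intro Liminf_mono always_eventually allI)
      fix n
      have "(\<integral>\<^sup>+z. ennreal ((cmod (wtd (H (r n)) z))\<^sup>2) \<partial>lborel) = ennreal ((fock_norm (H (r n)))\<^sup>2)"
        by (simp add: fock_norm_squared nn_integral_eq_integral fock_integrable H)
      also have "\<dots> \<le> ennreal (B\<^sup>2)" by (intro ennreal_leI power_mono B fock_norm_nonneg)
      finally show "(\<integral>\<^sup>+z. ennreal ((cmod (wtd (H (r n)) z))\<^sup>2) \<partial>lborel) \<le> ennreal (B\<^sup>2)" .
    qed
    also have "\<dots> < \<infinity>" by (simp add: Liminf_const)
    finally show "(\<integral>\<^sup>+z. ennreal ((cmod (wtd L z))\<^sup>2) \<partial>lborel) < \<infinity>" .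
  qed measurable
  with ent have "L \<in> fock" by (simp add: fock_iff)
  with r L show ?thesis using that by blast
qed

text \<open>An operator is compact as soon as it maps bounded, pointwise null sequences to norm null sequences:
  subtract from a bounded sequence its pointwise limit along a subsequence.\<close>

lemma fock_compact_operatorI:
  fixes T :: "(complex^'n \<Rightarrow> complex) \<Rightarrow> complex^'n \<Rightarrow> complex"
  assumes maps: "\<And>H. H \<in> fock \<Longrightarrow> T H \<in> fock"
    and lin: "\<And>a b G H. G \<in> fock \<Longrightarrow> H \<in> fock \<Longrightarrow> T (\<lambda>z. a * G z + b * H z) = (\<lambda>z. a * T G z + b * T H z)"
    and cont: "\<And>h B. (\<And>n. h n \<in> fock) \<Longrightarrow> (\<And>n. fock_norm (h n) \<le> B) \<Longrightarrow> (\<And>z. (\<lambda>n. h n z) \<longlonglongrightarrow> 0)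
        \<Longrightarrow> (\<lambda>n::nat. fock_norm (T (h n))) \<longlonglongrightarrow> 0"
  shows "fock_compact_operator T"
  unfolding fock_compact_operator_def
proof (intro conjI allI ballI impI)
  show "T ` fock \<subseteq> fock" using maps by blast
  fix S :: "(complex^'n \<Rightarrow> complex) set" assume "fock.mbounded S"
  then obtain c where S: "S \<subseteq> fock" and c: "\<And>G H. G \<in> S \<Longrightarrow> H \<in> S \<Longrightarrow> fock_dist G H \<le> c"
    unfolding fock.mbounded_alt by blast
  have TS: "T ` S \<subseteq> fock" using S maps by blast
  show "compactin fock.mtopology (fock.mtopology closure_of T ` S)"
    unfolding fock.compactin_closure_of_sequentially [OF TS]
  proof (intro allI impI)
    fix \<sigma> :: "nat \<Rightarrow> complex^'n \<Rightarrow> complex" assume "range \<sigma> \<subseteq> T ` S"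
    then have "\<forall>n. \<exists>H. H \<in> S \<and> \<sigma> n = T H" by blast
    then obtain H where HS: "\<And>n. H n \<in> S" and \<sigma>: "\<And>n. \<sigma> n = T (H n)" by metis
    have H: "H n \<in> fock" for n using HS S by blast
    define B where "B = c + fock_norm (H 0)"
    have B: "fock_norm (H n) \<le> B" for n
    proof -
      have "fock_norm (H n) = fock_norm (\<lambda>z. (H n z - H 0 z) + H 0 z)" by simp
      also have "\<dots> \<le> fock_norm (\<lambda>z. H n z - H 0 z) + fock_norm (H 0)"
        by (intro fock_norm_add fock_diff H)
      also have "\<dots> \<le> B" using c [OF HS HS, of n 0] by (simp add: B_def fock_dist_def)
      finally show ?thesis .
    qed
    obtain r L where r: "strict_mono (r :: nat \<Rightarrow> nat)" and L: "L \<in> fock" "\<And>z. (\<lambda>n. H (r n) z) \<longlonglongrightarrow> L z"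
      using fock_pointwise_subsequence [of H B] H B by blast
    have "(\<lambda>n. fock_norm (T (\<lambda>z. H (r n) z - L z))) \<longlonglongrightarrow> 0"
    proof (rule cont)
      show "fock_norm (\<lambda>z. H (r n) z - L z) \<le> B + fock_norm L" for n
        using fock_norm_diff [OF H L(1), of "r n"] B [of "r n"] by simp
      show "(\<lambda>n. H (r n) z - L z) \<longlonglongrightarrow> 0" for z
        using tendsto_diff [OF L(2) tendsto_const, of z "L z"] by simp
    qed (intro fock_diff H L)
    moreover have "T (\<lambda>z. H (r n) z - L z) = (\<lambda>z. T (H (r n)) z - T L z)" for n
      using lin [OF H L(1), of 1 "r n" "-1"] by simp
    ultimately have "(\<lambda>n. fock_dist (\<sigma> (r n)) (T L)) \<longlonglongrightarrow> 0"
      by (simp add: \<sigma> fock_dist_def)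
    with r maps [OF L(1)] show "\<exists>l\<in>fock. \<exists>r::nat\<Rightarrow>nat. strict_mono r \<and> (\<lambda>n. fock_dist (\<sigma> (r n)) l) \<longlonglongrightarrow> 0"
      by blast
  qed
qed (use lin in auto)

section \<open>The Berezin transform and off-diagonal matrix elements\<close>

definition berezin :: "(complex^'n \<Rightarrow> complex) \<Rightarrow> complex^'n \<Rightarrow> complex" where
  "berezin F w = (LINT y|lborel. F (w + y) * gweight y)"

definition gauss_laplace :: "(complex^'n \<Rightarrow> complex) \<Rightarrow> complex^'n \<Rightarrow> complex^'n \<Rightarrow> complex" where
  "gauss_laplace F v w = (LINT y|lborel. F (w + y) * gweight y * exp (complex_of_real pi * cdot v y))"

lemma filterlim_add_at_infinity: "filterlim (\<lambda>w. w + a) at_infinity at_infinity" for a :: "'a::real_normed_vector"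
  by (rule tendsto_add_filterlim_at_infinity' [OF filterlim_ident tendsto_const])

text \<open>With \<open>p = 2\<pi> Re (cdot v y)\<close> and \<open>q = -2\<pi> Im (cdot v y)\<close>, the integral with exponent \<open>\<alpha> p + \<beta> q\<close> is for
  real \<open>\<alpha>, \<beta>\<close> a constant times the Berezin transform at \<open>w + (\<alpha> + i\<beta>) v\<close>. Both parameters are
  complexified in turn, and \<open>\<alpha> = 1/2\<close>, \<open>\<beta> = -i/2\<close> gives the holomorphic exponent \<open>\<pi> cdot v y\<close>.\<close>

lemma gauss_laplace_vanishes:
  fixes F :: "complex^'n \<Rightarrow> complex"
  assumes [measurable]: "F \<in> borel_measurable borel" and F: "\<And>z. cmod (F z) \<le> C"
    and lim: "(berezin F \<longlongrightarrow> 0) at_infinity"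
  shows "(gauss_laplace F v \<longlongrightarrow> 0) at_infinity"
proof -
  define p q where "p y = 2 * pi * Re (cdot v y)" and "q y = - 2 * pi * Im (cdot v y)" for y
  have [measurable]: "p \<in> borel_measurable borel" "q \<in> borel_measurable borel"
    unfolding p_def [abs_def] q_def [abs_def] by measurable
  have pq: "\<bar>p y\<bar> \<le> (2 * pi * norm v) * norm y" "\<bar>q y\<bar> \<le> (2 * pi * norm v) * norm y" for y
    using order_trans [OF abs_Re_le_cmod cmod_cdot_le, of v y] order_trans [OF abs_Im_le_cmod cmod_cdot_le, of v y]
    by (simp_all add: p_def q_def abs_mult)
  have C0: "C \<ge> 0" using order_trans [OF norm_ge_zero F] .
  have bound: "cmod (F (w + y) * gweight y * exp (\<zeta> * complex_of_real s)) \<le> C * exp ((cmod \<zeta> * (2 * pi * norm v)) * norm y - pi * (norm y)\<^sup>2)"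
    if s: "\<bar>s\<bar> \<le> (2 * pi * norm v) * norm y" for w y \<zeta> s
  proof -
    have "Re (\<zeta> * complex_of_real s) \<le> cmod \<zeta> * \<bar>s\<bar>"
      using complex_Re_le_cmod [of "\<zeta> * complex_of_real s"] by (simp add: norm_mult)
    also have "\<dots> \<le> cmod \<zeta> * ((2 * pi * norm v) * norm y)" by (intro mult_left_mono s) simp
    finally have "cmod (F (w + y) * gweight y * exp (\<zeta> * complex_of_real s)) \<le> C * exp (- pi * (norm y)\<^sup>2) * exp (cmod \<zeta> * (2 * pi * norm v) * norm y)"
      unfolding norm_mult gweight_def by (intro mult_mono F) (simp_all add: C0 mult.assoc)
    then show ?thesis by (simp add: mult.assoc exp_add [symmetric] algebra_simps)
  qed
  have real: "((\<lambda>w. LINT y|lborel. F (w + y) * gweight y * exp (complex_of_real \<beta> * complex_of_real (q y)) * exp (complex_of_real \<alpha> * complex_of_real (p y))) \<longlongrightarrow> 0) at_infinity"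
    for \<alpha> \<beta> :: real
  proof -
    define u where "u = Complex \<alpha> \<beta> *s v"
    have "(LINT y|lborel. F (w + y) * gweight y * exp (complex_of_real \<beta> * complex_of_real (q y)) * exp (complex_of_real \<alpha> * complex_of_real (p y)))
        = complex_of_real (exp (pi * (norm u)\<^sup>2)) * berezin F (w + u)" for w
    proof -
      have eq: "F (w + y) * gweight y * exp (complex_of_real \<beta> * complex_of_real (q y)) * exp (complex_of_real \<alpha> * complex_of_real (p y))
          = complex_of_real (exp (pi * (norm u)\<^sup>2)) * (F ((w + u) + (y + - u)) * gweight (y + - u))" for y
      proof -
        have "cdot u y = Complex \<alpha> \<beta> * cdot v y" by (simp add: u_def cdot_scale_left)
        then have "2 * pi * Re (cdot u y) = \<beta> * q y + \<alpha> * p y"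
          by (simp add: p_def q_def algebra_simps)
        moreover have "(norm (y + - u))\<^sup>2 = (norm u)\<^sup>2 + (norm y)\<^sup>2 - 2 * Re (cdot u y)"
          using norm_diff_squared [of u y] by (simp add: norm_minus_commute)
        ultimately have "- pi * (norm y)\<^sup>2 + \<beta> * q y + \<alpha> * p y = pi * (norm u)\<^sup>2 + - pi * (norm (y + - u))\<^sup>2"
          by (simp only:) (simp add: algebra_simps)
        then have "exp (- pi * (norm y)\<^sup>2) * exp (\<beta> * q y) * exp (\<alpha> * p y) = exp (pi * (norm u)\<^sup>2) * exp (- pi * (norm (y + - u))\<^sup>2)"
          by (simp only: exp_add [symmetric])
        then have "gweight y * exp (complex_of_real \<beta> * complex_of_real (q y)) * exp (complex_of_real \<alpha> * complex_of_real (p y)) = complex_of_real (exp (pi * (norm u)\<^sup>2)) * gweight (y + - u)"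
          unfolding gweight_def of_real_mult [symmetric] exp_of_real by simp
        then show ?thesis by (simp add: mult.assoc)
      qed
      have "(LINT y|lborel. F ((w + u) + (y + - u)) * gweight (y + - u)) = berezin F (w + u)"
        unfolding berezin_def by (rule integral_lborel_plus [of "\<lambda>y. F ((w + u) + y) * gweight y" "- u"]) measurable
      then show ?thesis
        unfolding eq by (simp only: integral_mult_right_zero)
    qed
    moreover have "((\<lambda>w. complex_of_real (exp (pi * (norm u)\<^sup>2)) * berezin F (w + u)) \<longlongrightarrow> 0) at_infinity"
      by (intro tendsto_mult_right_zero filterlim_compose [OF lim filterlim_add_at_infinity])
    ultimately show ?thesis by simp
  qed
  have step: "((\<lambda>w. LINT y|lborel. F (w + y) * gweight y * exp (complex_of_real \<beta> * complex_of_real (q y)) * exp (\<alpha> * complex_of_real (p y))) \<longlongrightarrow> 0) at_infinity"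
    for \<alpha> :: complex and \<beta> :: real
    by (rule vanishing_gaussian_laplace [OF _ _ bound _ pq(1) real]) (use pq in simp_all)
  have "((\<lambda>w. LINT y|lborel. F (w + y) * gweight y * exp (\<alpha> * complex_of_real (p y)) * exp (\<beta> * complex_of_real (q y))) \<longlongrightarrow> 0) at_infinity"
    for \<alpha> \<beta> :: complex
    by (rule vanishing_gaussian_laplace [OF _ _ bound _ pq(2)]) (use pq step in \<open>simp_all add: mult_ac\<close>)
  \<comment> \<open>at these parameters the antiholomorphic part of the exponent cancels\<close>
  from this [of "1 / 2" "- \<i> / 2"]
  have "((\<lambda>w. LINT y|lborel. F (w + y) * gweight y * exp (1 / 2 * complex_of_real (p y)) * exp (- \<i> / 2 * complex_of_real (q y))) \<longlongrightarrow> 0) at_infinity" .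
  moreover have "exp (1 / 2 * complex_of_real (p y)) * exp (- \<i> / 2 * complex_of_real (q y)) = exp (complex_of_real pi * cdot v y)" for y
    unfolding exp_add [symmetric] by (rule arg_cong [of _ _ exp]) (simp add: p_def q_def complex_eq_iff)
  ultimately show ?thesis by (simp add: gauss_laplace_def [abs_def] mult.assoc)
qed

section \<open>The integral kernel of a Toeplitz operator\<close>

text \<open>The matrix element of the Toeplitz operator between the normalised coherent states at \<open>w\<close> and
  \<open>z\<close>, and at the same time its integral kernel after weighting (\<open>wtd_toeplitz_kern\<close>).\<close>

definition toeplitz_kern :: "(complex^'n \<Rightarrow> complex) \<Rightarrow> complex^'n \<Rightarrow> complex^'n \<Rightarrow> complex" where
  "toeplitz_kern F z w = (LINT u|lborel. F u * kern u w * kern z u)"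

lemma kern_cdot: "kern z w = exp (complex_of_real pi * (cdot z w - (cdot z z + cdot w w) / 2))"
  by (simp add: kern_def cdot_self algebra_simps add_divide_distrib)

text \<open>Translating the integration variable by \<open>w\<close> leaves of the two kernels only a phase depending on
  \<open>v, w\<close> and the factor \<open>e^(-\<pi>|v|\<^sup>2/2)\<close> in front of the integral.\<close>

lemma cmod_toeplitz_kern_shift:
  fixes F :: "complex^'n \<Rightarrow> complex"
  assumes [measurable]: "F \<in> borel_measurable borel"
  shows "cmod (toeplitz_kern F (v + w) w) = exp (- (pi / 2) * (norm v)\<^sup>2) * cmod (gauss_laplace F v w)"
proof -
  define c where "c = exp (complex_of_real pi * (- cdot v v / 2 + (cdot v w - cdot w v) / 2))"
  have Rc: "Re (complex_of_real pi * (- cdot v v / 2 + (cdot v w - cdot w v) / 2)) = - (pi / 2) * (norm v)\<^sup>2"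
    by (simp add: cdot_self cdot_commute [of w v])
  have "F (y + w) * kern (y + w) w * kern (v + w) (y + w) = c * (F (w + y) * gweight y * exp (complex_of_real pi * cdot v y))" for y
  proof -
    have "complex_of_real pi * (cdot (y + w) w - (cdot (y + w) (y + w) + cdot w w) / 2)
       + complex_of_real pi * (cdot (v + w) (y + w) - (cdot (v + w) (v + w) + cdot (y + w) (y + w)) / 2)
       = complex_of_real pi * (- cdot v v / 2 + (cdot v w - cdot w v) / 2) + (complex_of_real pi * - cdot y y + complex_of_real pi * cdot v y)"
      by (simp add: cdot_add_left cdot_add_right field_simps)
    then have "kern (y + w) w * kern (v + w) (y + w) = c * (exp (complex_of_real pi * - cdot y y) * exp (complex_of_real pi * cdot v y))"
      unfolding kern_cdot c_def exp_add [symmetric] by (rule arg_cong)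
    moreover have "exp (complex_of_real pi * - cdot y y) = gweight y"
      by (simp add: cdot_self gweight_def exp_of_real [symmetric])
    ultimately show ?thesis by (simp add: mult_ac add.commute)
  qed
  then have "(LINT y|lborel. F (y + w) * kern (y + w) w * kern (v + w) (y + w)) = c * gauss_laplace F v w"
    by (simp add: gauss_laplace_def)
  then have "toeplitz_kern F (v + w) w = c * gauss_laplace F v w"
    unfolding toeplitz_kern_def
    using integral_lborel_plus [of "\<lambda>u. F u * kern u w * kern (v + w) u" w] by simp
  moreover have "cmod c = exp (- (pi / 2) * (norm v)\<^sup>2)"
    unfolding c_def norm_exp_eq_Re Rc ..
  ultimately show ?thesis by (simp add: norm_mult)
qed

text \<open>The product of the kernels \<open>e^(-\<pi>|u-w|\<^sup>2/2)\<close> and \<open>e^(-\<pi>|z-u|\<^sup>2/2)\<close> decays in \<open>|z - w|\<close> because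
  \<open>|z - w|\<^sup>2 \<le> 2|z - u|\<^sup>2 + 2|u - w|\<^sup>2\<close>; part of the decay in \<open>z - u\<close> is kept for integrating over \<open>u\<close>.\<close>

lemma toeplitz_kern_bound:
  fixes F :: "complex^'n \<Rightarrow> complex"
  assumes [measurable]: "F \<in> borel_measurable borel" and F: "\<And>z. cmod (F z) \<le> C"
  shows "cmod (toeplitz_kern F z w) \<le> C * sqrt (pi / (pi / 4)) ^ DIM(complex^'n) * exp (- (pi / 8) * (norm (z - w))\<^sup>2)"
proof -
  have C0: "C \<ge> 0" using order_trans [OF norm_ge_zero F] .
  have pw: "cmod (F u * kern u w * kern z u) \<le> (C * exp (- (pi / 8) * (norm (z - w))\<^sup>2)) * exp (- (pi / 4) * (norm (z - u))\<^sup>2)" for u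
  proof -
    have "norm (z - w) \<le> norm (z - u) + norm (u - w)" using norm_triangle_ineq [of "z - u" "u - w"] by simp
    then have "(norm (z - w))\<^sup>2 \<le> (norm (z - u) + norm (u - w))\<^sup>2" by (rule power_mono) simp
    also have "\<dots> \<le> 2 * (norm (z - u))\<^sup>2 + 2 * (norm (u - w))\<^sup>2"
      using sum_squares_bound [of "norm (z - u)" "norm (u - w)"] by (simp add: power2_sum)
    finally have 1: "(norm (z - w))\<^sup>2 / 2 \<le> (norm (z - u))\<^sup>2 + (norm (u - w))\<^sup>2" by simp
    have "(pi / 8) * (norm (z - w))\<^sup>2 + (pi / 4) * (norm (z - u))\<^sup>2 = (pi / 4) * ((norm (z - w))\<^sup>2 / 2 + (norm (z - u))\<^sup>2)"
      by (simp add: field_simps)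
    also have "\<dots> \<le> (pi / 4) * (2 * ((norm (z - u))\<^sup>2 + (norm (u - w))\<^sup>2))"
    proof (rule mult_left_mono)
      have "D / 2 + Z \<le> 2 * (Z + U)" if "D / 2 \<le> Z + U" "0 \<le> U" for D Z U :: real
        using that by simp
      from this [OF 1 zero_le_power2]
      show "(norm (z - w))\<^sup>2 / 2 + (norm (z - u))\<^sup>2 \<le> 2 * ((norm (z - u))\<^sup>2 + (norm (u - w))\<^sup>2)" .
    qed simp
    finally have 2: "- (pi / 2) * (norm (u - w))\<^sup>2 + - (pi / 2) * (norm (z - u))\<^sup>2 \<le> - (pi / 8) * (norm (z - w))\<^sup>2 + - (pi / 4) * (norm (z - u))\<^sup>2"
      by (simp add: algebra_simps)
    have "cmod (F u * kern u w * kern z u) = cmod (F u) * exp (- (pi / 2) * (norm (u - w))\<^sup>2 + - (pi / 2) * (norm (z - u))\<^sup>2)"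
      by (simp only: norm_mult cmod_kern exp_add mult.assoc)
    also have "\<dots> \<le> C * exp (- (pi / 8) * (norm (z - w))\<^sup>2 + - (pi / 4) * (norm (z - u))\<^sup>2)"
      using 2 by (intro mult_mono F) (simp_all add: C0)
    finally show ?thesis by (simp only: exp_add mult.assoc)
  qed
  have int: "integrable lborel (\<lambda>u. (C * exp (- (pi / 8) * (norm (z - w))\<^sup>2)) * exp (- (pi / 4) * (norm (z - u))\<^sup>2))"
    by (intro integrable_mult_right integrable_gauss_shift) simp
  have "integrable lborel (\<lambda>u. F u * kern u w * kern z u)"
  proof (rule Bochner_Integration.integrable_bound [OF int])
    show "AE u in lborel. cmod (F u * kern u w * kern z u) \<le> norm ((C * exp (- (pi / 8) * (norm (z - w))\<^sup>2)) * exp (- (pi / 4) * (norm (z - u))\<^sup>2))"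
      by (intro AE_I2 order_trans [OF pw]) simp
  qed measurable
  note bound = Bochner_Integration.integral_norm_bound_integral [OF this int pw]
  have "(LINT u|lborel. exp (- (pi / 4) * (norm (z - u))\<^sup>2)) = sqrt (pi / (pi / 4)) ^ DIM(complex^'n)"
    by (rule integral_gauss_shift) simp
  with bound show ?thesis
    unfolding toeplitz_kern_def by (simp only: integral_mult_right_zero, simp only: mult_ac)
qed

lemma toeplitz_kern_measurable:
  fixes F :: "complex^'n \<Rightarrow> complex"
  assumes [measurable]: "F \<in> borel_measurable borel"
  shows "case_prod (\<lambda>z w. cmod (toeplitz_kern F z w)) \<in> borel_measurable (borel \<Otimes>\<^sub>M borel)"
proof -
  have "(\<lambda>p. LINT u|lborel. F u * kern u (snd p) * kern (fst p) u) \<in> borel_measurable (borel \<Otimes>\<^sub>M borel)"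
    by (rule lborel.borel_measurable_lebesgue_integral) (simp add: case_prod_unfold cong: measurable_cong_sets)
  then show ?thesis unfolding toeplitz_kern_def case_prod_unfold by measurable
qed

lemma wtd_toeplitz_kern:
  fixes F :: "complex^'n \<Rightarrow> complex"
  assumes [measurable]: "F \<in> borel_measurable borel" and F: "\<And>z. cmod (F z) \<le> C" and H: "H \<in> fock"
  shows "wtd (bproj (\<lambda>z. F z * H z)) z = (LINT w|lborel. toeplitz_kern F z w * wtd H w)"
proof -
  note [measurable] = fock_measurable [OF H]
  have C0: "C \<ge> 0" using order_trans [OF norm_ge_zero F] .
  define f where "f u w = F u * kern u w * kern z u * wtd H w" for u w
  have fm: "case_prod f \<in> borel_measurable (lborel \<Otimes>\<^sub>M lborel)"
    unfolding f_def by (simp cong: measurable_cong_sets)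
  have i1: "integrable lborel (\<lambda>w. wtd H w * kern u w)" for u by (rule fock_wtd_kern_integrable [OF H])
  have "integrable lborel (\<lambda>u. LINT w|lborel. norm (f u w))"
  proof (rule Bochner_Integration.integrable_bound)
    show "integrable lborel (\<lambda>u. (C * fock_norm H) * exp (- (pi / 2) * (norm (z - u))\<^sup>2))"
      by (intro integrable_mult_right integrable_gauss_shift) simp
    show "(\<lambda>u. LINT w|lborel. norm (f u w)) \<in> borel_measurable lborel"
      using fm by (intro lborel.borel_measurable_lebesgue_integral) (simp add: case_prod_unfold)
    have "(LINT w|lborel. norm (f u w)) \<le> (C * fock_norm H) * exp (- (pi / 2) * (norm (z - u))\<^sup>2)" for u
    proof -
      have "(LINT w|lborel. norm (f u w)) = (cmod (F u) * cmod (kern z u)) * (LINT w|lborel. cmod (wtd H w) * cmod (kern u w))"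
        by (simp add: f_def norm_mult mult_ac flip: integral_mult_right_zero)
      also have "\<dots> \<le> (C * cmod (kern z u)) * fock_norm H"
      proof (intro mult_mono F)
        have "(LINT w|lborel. cmod (wtd H w) * cmod (kern u w))\<^sup>2 \<le> (LINT w|lborel. (cmod (wtd H w))\<^sup>2) * (LINT w|lborel. (cmod (kern u w))\<^sup>2)"
          by (intro Cauchy_Schwarz_integral fock_integrable H kern_square_integrable) measurable
        also have "\<dots> = (fock_norm H)\<^sup>2" by (simp add: kern_square_integrable fock_norm_squared)
        finally show "(LINT w|lborel. cmod (wtd H w) * cmod (kern u w)) \<le> fock_norm H"
          by (rule power2_le_imp_le [OF _ fock_norm_nonneg])
      qed (simp_all add: C0)
      finally show ?thesis by (simp add: cmod_kern mult_ac)
    qed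
    then show "AE u in lborel. norm (LINT w|lborel. norm (f u w)) \<le> norm ((C * fock_norm H) * exp (- (pi / 2) * (norm (z - u))\<^sup>2))"
      using C0 by (intro AE_I2) (simp add: fock_norm_nonneg)
  qed
  moreover have fw: "f u w = (F u * kern z u) * (wtd H w * kern u w)" for u w by (simp add: f_def mult_ac)
  then have "f u = (\<lambda>w. (F u * kern z u) * (wtd H w * kern u w))" for u by (simp add: fun_eq_iff)
  then have "AE u in lborel. integrable lborel (f u)"
    using i1 by (intro AE_I2) simp
  ultimately have fi: "integrable (lborel \<Otimes>\<^sub>M lborel) (case_prod f)"
    by (intro lborel_pair.Fubini_integrable fm) auto
  have "wtd (bproj (\<lambda>z. F z * H z)) z = (LINT u|lborel. LINT w|lborel. f u w)"
  proof -
    have "(LINT w|lborel. f u w) = (F u * kern z u) * wtd H u" for u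
      unfolding fw by (simp only: integral_mult_right_zero fock_reproducing [OF H])
    then have "wtd (\<lambda>z. F z * H z) u * kern z u = (LINT w|lborel. f u w)" for u
      by (simp add: wtd_def)
    then show ?thesis by (simp add: wtd_bproj)
  qed
  also have "\<dots> = (LINT w|lborel. LINT u|lborel. f u w)"
    by (rule lborel_pair.Fubini_integral [OF fi, symmetric])
  also have "\<dots> = (LINT w|lborel. toeplitz_kern F z w * wtd H w)"
    unfolding toeplitz_kern_def f_def by (simp only: integral_mult_left_zero)
  finally show ?thesis .
qed

lemma
  fixes F :: "complex^'n \<Rightarrow> complex"
  assumes [measurable]: "F \<in> borel_measurable borel" and F: "\<And>z. cmod (F z) \<le> C" and H: "H \<in> fock"
  shows bounded_mult_fock_L2: "integrable lborel (\<lambda>z. (cmod (wtd (\<lambda>z. F z * H z) z))\<^sup>2)"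
    and bounded_mult_fock_bound: "cmod (wtd (\<lambda>z. F z * H z) w) \<le> C * fock_norm H"
proof -
  note [measurable] = fock_measurable [OF H]
  have C0: "C \<ge> 0" using order_trans [OF norm_ge_zero F] .
  have 1: "cmod (wtd (\<lambda>z. F z * H z) w) \<le> C * cmod (wtd H w)" for w
    by (simp add: wtd_def norm_mult mult.assoc mult_right_mono F)
  show "integrable lborel (\<lambda>z. (cmod (wtd (\<lambda>z. F z * H z) z))\<^sup>2)"
  proof (rule Bochner_Integration.integrable_bound [OF integrable_mult_right [OF fock_integrable [OF H], of "C\<^sup>2"]])
    show "AE z in lborel. norm ((cmod (wtd (\<lambda>z. F z * H z) z))\<^sup>2) \<le> norm (C\<^sup>2 * (cmod (wtd H z))\<^sup>2)"
      using power_mono [OF 1, of _ 2] by (intro AE_I2) (simp add: power_mult_distrib)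
  qed measurable
  show "cmod (wtd (\<lambda>z. F z * H z) w) \<le> C * fock_norm H"
    using 1 [of w] mult_left_mono [OF fock_pointwise_bound [OF H] C0] by (rule order_trans)
qed

lemma bproj_bounded_mult_in_fock:
  fixes F :: "complex^'n \<Rightarrow> complex"
  assumes [measurable]: "F \<in> borel_measurable borel" and F: "\<And>z. cmod (F z) \<le> C" and H: "H \<in> fock"
  shows "bproj (\<lambda>z. F z * H z) \<in> fock"
proof (rule bproj_in_fock)
  note [measurable] = fock_measurable [OF H]
  show "(\<lambda>z. F z * H z) \<in> borel_measurable borel" by measurable
qed (rule bounded_mult_fock_L2 bounded_mult_fock_bound; fact)+

lemma fock_proj_bounded_mult:
  fixes F :: "complex^'n \<Rightarrow> complex"
  assumes [measurable]: "F \<in> borel_measurable borel" and F: "\<And>z. cmod (F z) \<le> C" and H: "H \<in> fock"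
  shows "fock_proj (\<lambda>z. F z * H z) = bproj (\<lambda>z. F z * H z)"
proof (rule fock_proj_eq_bproj)
  note [measurable] = fock_measurable [OF H]
  show "(\<lambda>z. F z * H z) \<in> borel_measurable borel" by measurable
qed (rule bounded_mult_fock_L2 bounded_mult_fock_bound; fact)+

lemma toeplitz_kern_vanishes:
  fixes F :: "complex^'n \<Rightarrow> complex"
  assumes [measurable]: "F \<in> borel_measurable borel" and F: "\<And>z. cmod (F z) \<le> C"
    and lim: "(berezin F \<longlongrightarrow> 0) at_infinity"
  shows "((\<lambda>w. LINT z|lborel. cmod (toeplitz_kern F z w)) \<longlongrightarrow> 0) at_infinity"
proof (rule tendsto_at_infinity_sequentially)
  fix x :: "nat \<Rightarrow> complex^'n" assume x: "filterlim x at_infinity sequentially"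
  define c where "c = C * sqrt (pi / (pi / 4)) ^ DIM(complex^'n)"
  note [measurable] = toeplitz_kern_measurable [OF assms(1)]
  have [measurable]: "(\<lambda>z. cmod (toeplitz_kern F z w)) \<in> borel_measurable borel" for w
    by (rule measurable_compose [of "\<lambda>z. (z, w)" _ "borel \<Otimes>\<^sub>M borel" "case_prod (\<lambda>z w. cmod (toeplitz_kern F z w))", simplified]) auto
  have "(\<lambda>n. LINT v|lborel. cmod (toeplitz_kern F (v + x n) (x n))) \<longlonglongrightarrow> (LINT v|(lborel :: (complex^'n) measure). 0)"
  proof (rule integral_dominated_convergence)
    show "integrable lborel (\<lambda>v::complex^'n. c * exp (- (pi / 8) * (norm v)\<^sup>2))"
      using has_bochner_integral_gauss [of "pi / 8", where 'a="complex^'n"]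
      by (intro integrable_mult_right) (simp add: has_bochner_integral_iff)
    show "AE v in lborel. norm (cmod (toeplitz_kern F (v + x n) (x n))) \<le> c * exp (- (pi / 8) * (norm v)\<^sup>2)" for n
      using toeplitz_kern_bound [OF assms(1) F] by (intro AE_I2) (simp add: c_def del: mult_minus_left, metis add_diff_cancel_right')
    show "AE v in lborel. (\<lambda>n. cmod (toeplitz_kern F (v + x n) (x n))) \<longlonglongrightarrow> 0"
      unfolding cmod_toeplitz_kern_shift [OF assms(1)]
      by (intro AE_I2 tendsto_mult_right_zero tendsto_norm_zero
            filterlim_compose [OF gauss_laplace_vanishes [OF assms(1) F lim] x])
  qed measurable
  moreover have "(LINT v|lborel. cmod (toeplitz_kern F (v + x n) (x n))) = (LINT z|lborel. cmod (toeplitz_kern F z (x n)))" for n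
    by (rule integral_lborel_plus [of "\<lambda>z. cmod (toeplitz_kern F z (x n))" "x n"]) measurable
  ultimately show "(\<lambda>n. LINT z|lborel. cmod (toeplitz_kern F z (x n))) \<longlonglongrightarrow> 0" by simp
qed

text \<open>In the bound \<open>\<integral> \<kappa> w |wtd (h n) w|\<^sup>2 dw\<close> given by the Schur test, the part over a large ball tends to 0
  by dominated convergence, and outside of it the weight \<open>\<kappa>\<close> is small while the norms are bounded.\<close>

lemma toeplitz_norm_null_sequence:
  fixes F :: "complex^'n \<Rightarrow> complex"
  assumes [measurable]: "F \<in> borel_measurable borel" and F: "\<And>z. cmod (F z) \<le> C"
    and lim: "(berezin F \<longlongrightarrow> 0) at_infinity"
    and h: "\<And>n. h n \<in> fock" "\<And>n. fock_norm (h n) \<le> B" "\<And>z. (\<lambda>n. h n z) \<longlonglongrightarrow> 0"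
  shows "(\<lambda>n::nat. fock_norm (bproj (\<lambda>z. F z * h n z))) \<longlonglongrightarrow> 0"
proof -
  note [measurable] = fock_measurable [OF h(1)] toeplitz_kern_measurable [OF assms(1)]
  have B0: "B \<ge> 0" using order_trans [OF fock_norm_nonneg h(2) [of 0]] .
  have C0: "C \<ge> 0" using order_trans [OF norm_ge_zero F] .
  define k where "k z w = cmod (toeplitz_kern F z w)" for z w
  have k0: "k z w \<ge> 0" for z w by (simp add: k_def)
  have km [measurable]: "case_prod k \<in> borel_measurable (borel \<Otimes>\<^sub>M borel)"
    unfolding k_def by measurable
  have ks [measurable]: "(\<lambda>z. k z w) \<in> borel_measurable borel" "(\<lambda>w. k z w) \<in> borel_measurable borel" for z w
    by measurable
  define c where "c = C * sqrt (pi / (pi / 4)) ^ DIM(complex^'n)"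
  define A where "A = c * sqrt (pi / (pi / 8)) ^ DIM(complex^'n)"
  have c0: "c \<ge> 0" and A0: "A \<ge> 0" using C0 by (simp_all add: c_def A_def)
  have kb: "k z w \<le> c * exp (- (pi / 8) * (norm (z - w))\<^sup>2)" for z w
    unfolding k_def c_def by (rule toeplitz_kern_bound [OF assms(1) F])
  have gi: "integrable lborel (\<lambda>w. c * exp (- (pi / 8) * (norm (z - w))\<^sup>2))" "(LINT w|lborel. c * exp (- (pi / 8) * (norm (z - w))\<^sup>2)) = A"
    for z :: "complex^'n"
    using integrable_gauss_shift [of "pi / 8" z] integral_gauss_shift [of "pi / 8" z] by (simp_all add: A_def)
  have ki: "integrable lborel (\<lambda>z. k z w)" "integrable lborel (\<lambda>w. k z w)" for z w
  proof -
    show "integrable lborel (\<lambda>w. k z w)"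
      by (rule Bochner_Integration.integrable_bound [OF gi(1) [of z]]) (use kb [of z] c0 in \<open>auto intro!: AE_I2 simp: k_def\<close>)
    show "integrable lborel (\<lambda>z. k z w)"
      by (rule Bochner_Integration.integrable_bound [OF gi(1) [of w]]) (use kb [of _ w] c0 in \<open>auto intro!: AE_I2 simp: k_def norm_minus_commute\<close>)
  qed
  have rows: "(LINT w|lborel. k z w) \<le> A" for z
    unfolding gi(2) [of z, symmetric] by (intro integral_mono ki gi kb)
  define \<kappa> where "\<kappa> w = (LINT z|lborel. k z w)" for w
  have \<kappa>A: "\<kappa> w \<le> A" for w
    unfolding gi(2) [of w, symmetric] \<kappa>_def by (intro integral_mono ki gi) (metis kb norm_minus_commute)
  have \<kappa>0: "\<kappa> w \<ge> 0" for w unfolding \<kappa>_def k_def by (intro integral_nonneg_AE) simp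
  have \<kappa>m [measurable]: "\<kappa> \<in> borel_measurable borel"
  proof -
    have "(\<lambda>w. LINT z|lborel. k z w) \<in> borel_measurable lborel"
      by (rule lborel.borel_measurable_lebesgue_integral) (simp add: case_prod_unfold cong: measurable_cong_sets)
    then show ?thesis by (simp add: \<kappa>_def [abs_def])
  qed
  have \<kappa>lim: "(\<kappa> \<longlongrightarrow> 0) at_infinity"
    unfolding \<kappa>_def [abs_def] k_def by (rule toeplitz_kern_vanishes [OF assms(1) F lim])
  let ?T = "\<lambda>n. bproj (\<lambda>z. F z * h n z)"
  let ?g = "\<lambda>n w. (cmod (wtd (h n) w))\<^sup>2"
  have gint: "integrable lborel (?g n)" for n by (rule fock_integrable [OF h(1)])
  have g\<kappa>: "integrable lborel (\<lambda>w. \<kappa> w * ?g n w)" for n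
    by (rule Bochner_Integration.integrable_bound [OF integrable_mult_right [OF gint [of n], of A]])
       (use \<kappa>A \<kappa>0 A0 in \<open>auto intro!: AE_I2 mult_right_mono simp: abs_mult\<close>)
  have Tfock: "?T n \<in> fock" for n
    by (rule bproj_bounded_mult_in_fock [OF assms(1) F h(1)])
  have schur: "(fock_norm (?T n))\<^sup>2 \<le> A * (LINT w|lborel. \<kappa> w * ?g n w)" for n
  proof -
    note [measurable] = fock_measurable [OF Tfock]
    have "ennreal ((fock_norm (?T n))\<^sup>2) = (\<integral>\<^sup>+z. ennreal ((cmod (wtd (?T n) z))\<^sup>2) \<partial>lborel)"
      by (simp add: fock_norm_squared nn_integral_eq_integral fock_integrable [OF Tfock])
    also have "\<dots> \<le> (\<integral>\<^sup>+z. (\<integral>\<^sup>+w. ennreal (k z w * cmod (wtd (h n) w)) \<partial>lborel)\<^sup>2 \<partial>lborel)"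
    proof (rule nn_integral_mono)
      fix z
      have i: "integrable lborel (\<lambda>w. toeplitz_kern F z w * wtd (h n) w)"
      proof (rule Bochner_Integration.integrable_bound [OF integrable_mult_left [OF ki(2) [of z], of B]])
        have [measurable]: "(\<lambda>w. toeplitz_kern F z w) \<in> borel_measurable borel"
        proof -
          have "(\<lambda>w. LINT u|lborel. F u * kern u w * kern z u) \<in> borel_measurable lborel"
            by (rule lborel.borel_measurable_lebesgue_integral) (simp add: case_prod_unfold cong: measurable_cong_sets)
          then show ?thesis by (simp add: toeplitz_kern_def)
        qed
        show "(\<lambda>w. toeplitz_kern F z w * wtd (h n) w) \<in> borel_measurable lborel" by measurable
        show "AE w in lborel. cmod (toeplitz_kern F z w * wtd (h n) w) \<le> norm (k z w * B)"
          using order_trans [OF fock_pointwise_bound [OF h(1)] h(2)] B0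
          by (intro AE_I2) (simp add: norm_mult k_def mult_left_mono)
      qed
      have "cmod (wtd (?T n) z) \<le> (LINT w|lborel. cmod (toeplitz_kern F z w * wtd (h n) w))"
        unfolding wtd_toeplitz_kern [OF assms(1) F h(1)] by (rule integral_norm_bound)
      then have "ennreal ((cmod (wtd (?T n) z))\<^sup>2) \<le> ennreal ((LINT w|lborel. cmod (toeplitz_kern F z w * wtd (h n) w))\<^sup>2)"
        by (intro ennreal_leI power_mono) auto
      also have "\<dots> = (ennreal (LINT w|lborel. cmod (toeplitz_kern F z w * wtd (h n) w)))\<^sup>2"
        by (simp add: ennreal_power)
      also have "ennreal (LINT w|lborel. cmod (toeplitz_kern F z w * wtd (h n) w)) = (\<integral>\<^sup>+w. ennreal (cmod (toeplitz_kern F z w * wtd (h n) w)) \<partial>lborel)"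
        by (intro nn_integral_eq_integral [symmetric] integrable_norm i) simp
      finally show "ennreal ((cmod (wtd (?T n) z))\<^sup>2) \<le> (\<integral>\<^sup>+w. ennreal (k z w * cmod (wtd (h n) w)) \<partial>lborel)\<^sup>2"
        by (simp add: k_def norm_mult)
    qed
    also have "\<dots> \<le> ennreal A * (\<integral>\<^sup>+w. (\<integral>\<^sup>+z. ennreal (k z w) \<partial>lborel) * ennreal (?g n w) \<partial>lborel)"
    proof (rule Schur_test [OF km])
      show "(\<integral>\<^sup>+w. ennreal (k z w) \<partial>lborel) \<le> ennreal A" for z
        using ki(2) rows by (subst nn_integral_eq_integral) (auto simp: k0 ennreal_leI)
    qed (auto simp: k0)
    also have "(\<integral>\<^sup>+w. (\<integral>\<^sup>+z. ennreal (k z w) \<partial>lborel) * ennreal (?g n w) \<partial>lborel) = (\<integral>\<^sup>+w. ennreal (\<kappa> w * ?g n w) \<partial>lborel)"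
    proof (rule nn_integral_cong)
      fix w
      have "(\<integral>\<^sup>+z. ennreal (k z w) \<partial>lborel) = ennreal (\<kappa> w)"
        unfolding \<kappa>_def by (rule nn_integral_eq_integral [OF ki(1)]) (simp add: k_def)
      then show "(\<integral>\<^sup>+z. ennreal (k z w) \<partial>lborel) * ennreal (?g n w) = ennreal (\<kappa> w * ?g n w)"
        by (simp add: ennreal_mult' \<kappa>0)
    qed
    also have "\<dots> = ennreal (LINT w|lborel. \<kappa> w * ?g n w)"
      by (rule nn_integral_eq_integral [OF g\<kappa>]) (simp add: \<kappa>0)
    also have "ennreal A * \<dots> = ennreal (A * (LINT w|lborel. \<kappa> w * ?g n w))"
      by (simp add: ennreal_mult' A0)
    finally show ?thesis
      by (subst (asm) ennreal_le_iff) (auto intro!: mult_nonneg_nonneg A0 integral_nonneg_AE simp: \<kappa>0)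
  qed
  have "(\<lambda>n. LINT w|lborel. \<kappa> w * ?g n w) \<longlonglongrightarrow> 0"
  proof (rule LIMSEQ_I)
    fix e :: real assume e: "e > 0"
    \<comment> \<open>the summand 1 covers the case that \<open>B\<close> is 0\<close>
    define \<epsilon> where "\<epsilon> = e / (2 * (B\<^sup>2 + 1))"
    have \<epsilon>: "\<epsilon> > 0" using e by (simp add: \<epsilon>_def add_nonneg_pos)
    obtain R where R: "\<And>w. norm w \<ge> R \<Longrightarrow> \<kappa> w < \<epsilon>"
      using tendstoD [OF \<kappa>lim \<epsilon>] \<kappa>0 unfolding eventually_at_infinity by (auto simp: abs_of_nonneg)
    have [measurable]: "cball (0::complex^'n) R \<in> sets borel" by simp
    let ?q = "\<lambda>n. LINT w|lborel. indicator (cball (0::complex^'n) R) w * ?g n w"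
    have q: "?q \<longlonglongrightarrow> (LINT w|(lborel :: (complex^'n) measure). 0)"
    proof (rule integral_dominated_convergence)
      show "integrable lborel (\<lambda>w. indicator (cball (0::complex^'n) R) w * B\<^sup>2)"
        using emeasure_lborel_cball_finite [of "0::complex^'n" R]
        by (intro integrable_mult_left integrable_real_indicator) auto
      show "AE w in lborel. (\<lambda>n. indicator (cball 0 R) w * ?g n w) \<longlonglongrightarrow> 0"
      proof (intro AE_I2 tendsto_mult_right_zero)
        fix w
        have "(\<lambda>n. wtd (h n) w) \<longlonglongrightarrow> 0"
          unfolding wtd_def by (intro tendsto_mult_left_zero h)
        from tendsto_power [OF tendsto_norm [OF this], of 2] show "(\<lambda>n. ?g n w) \<longlonglongrightarrow> 0" by simp
      qed
      show "AE w in lborel. norm (indicator (cball 0 R) w * ?g n w) \<le> indicator (cball 0 R) w * B\<^sup>2" for n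
        using order_trans [OF fock_pointwise_bound [OF h(1)] h(2)]
        by (intro AE_I2) (auto split: split_indicator simp: power_mono)
    qed measurable
    have "(\<lambda>n. A * ?q n) \<longlonglongrightarrow> 0" using q by (intro tendsto_mult_right_zero) simp
    from LIMSEQ_D [OF this, of "e / 2"] e obtain N where N: "\<And>n. n \<ge> N \<Longrightarrow> \<bar>A * ?q n\<bar> < e / 2" by auto
    have "norm ((LINT w|lborel. \<kappa> w * ?g n w) - 0) < e" if n: "n \<ge> N" for n
    proof -
      have qi: "integrable lborel (\<lambda>w. indicator (cball 0 R) w * ?g n w)"
        using integrable_mult_indicator [OF _ gint [of n], of "cball 0 R"] by simp
      have "(LINT w|lborel. \<kappa> w * ?g n w) \<le> (LINT w|lborel. A * (indicator (cball 0 R) w * ?g n w) + \<epsilon> * ?g n w)"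
      proof (rule integral_mono [OF g\<kappa>])
        show "\<kappa> w * ?g n w \<le> A * (indicator (cball 0 R) w * ?g n w) + \<epsilon> * ?g n w" for w
        proof (cases "norm w \<le> R")
          case True
          then show ?thesis using mult_right_mono [OF \<kappa>A, of "?g n w" w] \<epsilon> by (simp add: add_increasing2)
        next
          case False
          then show ?thesis using mult_right_mono [OF less_imp_le [OF R], of w "?g n w"] by simp
        qed
      qed (intro Bochner_Integration.integrable_add integrable_mult_right qi gint)
      also have "\<dots> = A * ?q n + \<epsilon> * (fock_norm (h n))\<^sup>2"
        using qi gint [of n] by (simp add: fock_norm_squared)
      also have "\<dots> < e / 2 + e / 2"
      proof (rule add_less_le_mono)
        show "A * ?q n < e / 2" using N [OF n] by linarith
        have "\<epsilon> * (fock_norm (h n))\<^sup>2 \<le> \<epsilon> * (B\<^sup>2 + 1)"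
          using power_mono [OF h(2) fock_norm_nonneg, of n 2] \<epsilon> by (intro mult_left_mono) auto
        also have "\<dots> = e / 2"
        proof -
          have "e / (2 * D) * D = e / 2" if "D > 0" for D :: real using that by simp
          from this [of "B\<^sup>2 + 1"] show ?thesis unfolding \<epsilon>_def by (simp add: add_nonneg_pos)
        qed
        finally show "\<epsilon> * (fock_norm (h n))\<^sup>2 \<le> e / 2" .
      qed
      finally show ?thesis
        using integral_nonneg_AE [of "\<lambda>w. \<kappa> w * ?g n w" lborel] \<kappa>0 by (simp add: abs_of_nonneg)
    qed
    then show "\<exists>N. \<forall>n\<ge>N. norm ((LINT w|lborel. \<kappa> w * ?g n w) - 0) < e" by blast
  qed
  then have "(\<lambda>n. A * (LINT w|lborel. \<kappa> w * ?g n w)) \<longlonglongrightarrow> 0" by (rule tendsto_mult_right_zero)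
  then have "(\<lambda>n. (fock_norm (?T n))\<^sup>2) \<longlonglongrightarrow> 0"
    by (rule Lim_null_comparison [rotated]) (use schur in auto)
  from tendsto_real_sqrt [OF this] show ?thesis by (simp add: fock_norm_nonneg)
qed

section \<open>Compactness of Toeplitz operators\<close>

text \<open>The normalised reproducing kernel at \<open>w\<close>, a unit vector of the Fock space.\<close>

definition coherent :: "complex^'n \<Rightarrow> complex^'n \<Rightarrow> complex" where
  "coherent w z = exp (complex_of_real pi * cdot z w - complex_of_real ((pi / 2) * (norm w)\<^sup>2))"

lemma wtd_coherent: "wtd (coherent w) z = kern z w"
  unfolding wtd_def coherent_def kern_def exp_of_real [symmetric] exp_add [symmetric]
  by (rule arg_cong [of _ _ exp]) (simp add: algebra_simps)

lemma entire_coherent: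
  fixes w :: "complex^'n"
  shows "entire (coherent w)"
  unfolding entire_def
proof
  fix z :: "complex^'n"
  have lin: "((\<lambda>z. complex_of_real pi * cdot z w) has_derivative (\<lambda>v. complex_of_real pi * cdot v w)) (at z)"
    by (intro bounded_linear_imp_has_derivative)
       (simp add: linear_conv_bounded_linear [symmetric] linearI cdot_add_left cdot_scaleR_left algebra_simps)
  have "(coherent w has_derivative (\<lambda>v. coherent w z * (complex_of_real pi * cdot v w))) (at z)"
    unfolding coherent_def [abs_def]
    by (rule has_derivative_eq_rhs, rule has_derivative_compose [where g = exp, OF has_derivative_diff [OF lin has_derivative_const]])
       (use DERIV_exp in \<open>auto simp: has_field_derivative_def\<close>)
  then show "\<exists>D. (coherent w has_derivative D) (at z) \<and> (\<forall>c v. D (c *s v) = c * D v)"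
    by (intro exI conjI) (auto simp: cdot_scale_left)
qed

lemma coherent_in_fock: "coherent w \<in> fock"
  using kern_square_integrable(1) [of w] by (simp add: fock_iff entire_coherent wtd_coherent cmod_kern_commute [of _ w])

lemma fock_norm_coherent: "fock_norm (coherent w) = 1"
proof -
  have "(fock_norm (coherent w))\<^sup>2 = 1"
    using kern_square_integrable(2) [of w]
    by (simp add: fock_norm_squared entire_measurable [OF entire_coherent] wtd_coherent cmod_kern_commute [of _ w])
  then show ?thesis using fock_norm_nonneg [of "coherent w"] by (simp add: power2_eq_1_iff)
qed

lemma cmod_wtd_toeplitz_coherent:
  fixes F :: "complex^'n \<Rightarrow> complex"
  assumes [measurable]: "F \<in> borel_measurable borel"
  shows "cmod (wtd (bproj (\<lambda>z. F z * coherent w z)) w) = cmod (berezin F w)"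
proof -
  have "wtd (\<lambda>z. F z * coherent w z) u = F u * kern u w" for u
    using wtd_coherent [of w u] by (simp add: wtd_def)
  then have "wtd (bproj (\<lambda>z. F z * coherent w z)) w = toeplitz_kern F (0 + w) w"
    by (simp add: wtd_bproj toeplitz_kern_def)
  then show ?thesis
    using cmod_toeplitz_kern_shift [of F 0 w] by (simp add: gauss_laplace_def berezin_def cdot_def)
qed

text \<open>The images of coherent states at points tending to infinity would have a norm convergent
  subsequence, and pairing with the coherent states sends its limit to 0.\<close>

lemma berezin_vanishes_if_compact:
  fixes F :: "complex^'n \<Rightarrow> complex"
  assumes [measurable]: "F \<in> borel_measurable borel" 
    and T: "\<And>H. H \<in> fock \<Longrightarrow> T H = bproj (\<lambda>z. F z * H z)"
    and comp: "fock_compact_operator T"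
  shows "(berezin F \<longlongrightarrow> 0) at_infinity"
proof (rule ccontr)
  assume "\<not> ?thesis"
  then obtain e w where e: "e > 0" and w: "filterlim w at_infinity sequentially" "\<And>n::nat. dist (berezin F (w n)) 0 \<ge> e"
    by (rule not_tendsto_at_infinityE) blast
  let ?S = "range coherent :: (complex^'n \<Rightarrow> complex) set"
  have S: "?S \<subseteq> fock" using coherent_in_fock by blast
  have "fock.mbounded ?S"
    unfolding fock.mbounded_alt
  proof (intro conjI S exI ballI)
    fix G H assume "G \<in> ?S" "H \<in> ?S"
    then show "fock_dist G H \<le> 2"
      using fock_norm_diff [of G H] by (auto simp: fock_dist_def fock_norm_coherent coherent_in_fock)
  qed
  then have "compactin fock.mtopology (fock.mtopology closure_of (T ` ?S))" and TS: "T ` ?S \<subseteq> fock"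
    using comp S unfolding fock_compact_operator_def by blast+
  moreover have "range (\<lambda>n. T (coherent (w n))) \<subseteq> T ` ?S" by blast
  ultimately obtain L r where L: "L \<in> fock" and r: "strict_mono (r :: nat \<Rightarrow> nat)"
    and lim: "(\<lambda>n. fock_dist (T (coherent (w (r n)))) L) \<longlonglongrightarrow> 0"
    unfolding fock.compactin_closure_of_sequentially [OF TS] by blast
  have wr: "filterlim (\<lambda>n. w (r n)) at_infinity sequentially"
    by (rule filterlim_compose [OF w(1) filterlim_subseq [OF r]])
  have "(\<lambda>n. fock_dist (T (coherent (w (r n)))) L + cmod (wtd L (w (r n)))) \<longlonglongrightarrow> 0 + 0"
    by (intro tendsto_add lim tendsto_norm_zero filterlim_compose [OF fock_vanishes_at_infinity [OF L] wr])
  moreover have "e \<le> fock_dist (T (coherent (w (r n)))) L + cmod (wtd L (w (r n)))" for n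
  proof -
    let ?K = "T (coherent (w (r n)))"
    have K: "?K \<in> fock" using TS by blast
    have "e \<le> cmod (wtd ?K (w (r n)))"
      using w(2) [of "r n"] cmod_wtd_toeplitz_coherent [of F "w (r n)"] by (simp add: T coherent_in_fock)
    also have "wtd ?K (w (r n)) = wtd (\<lambda>z. ?K z - L z) (w (r n)) + wtd L (w (r n))" by (simp add: wtd_diff)
    also have "cmod \<dots> \<le> fock_norm (\<lambda>z. ?K z - L z) + cmod (wtd L (w (r n)))"
      by (rule order_trans [OF norm_triangle_ineq add_right_mono [OF fock_pointwise_bound [OF fock_diff [OF K L]]]])
    finally show ?thesis by (simp add: fock_dist_def)
  qed
  ultimately have "e \<le> 0 + 0"
    by (intro LIMSEQ_le_const) auto
  with e show False by simp
qed

lemma compact_if_berezin_vanishes: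
  fixes F :: "complex^'n \<Rightarrow> complex"
  assumes [measurable]: "F \<in> borel_measurable borel" and F: "\<And>z. cmod (F z) \<le> C"
    and T: "\<And>H. H \<in> fock \<Longrightarrow> T H = bproj (\<lambda>z. F z * H z)"
    and lim: "(berezin F \<longlongrightarrow> 0) at_infinity"
  shows "fock_compact_operator T"
proof (rule fock_compact_operatorI)
  show "T H \<in> fock" if "H \<in> fock" for H
    using bproj_bounded_mult_in_fock [OF assms(1) F that] by (simp add: T that)
  show "T (\<lambda>z. a * G z + b * H z) = (\<lambda>z. a * T G z + b * T H z)" if G: "G \<in> fock" and H: "H \<in> fock" for a b G H
  proof
    fix z
    note [measurable] = fock_measurable [OF G] fock_measurable [OF H]
    have i: "integrable lborel (\<lambda>w. wtd (\<lambda>z. F z * G z) w * kern z w)" "integrable lborel (\<lambda>w. wtd (\<lambda>z. F z * H z) w * kern z w)"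
      by (intro L2_kern_integrable bounded_mult_fock_L2 [OF assms(1) F] G H; measurable)+
    have "wtd (\<lambda>z. F z * (a * G z + b * H z)) w = a * wtd (\<lambda>z. F z * G z) w + b * wtd (\<lambda>z. F z * H z) w" for w
      by (simp add: wtd_def algebra_simps)
    then have "wtd (T (\<lambda>z. a * G z + b * H z)) z = (LINT w|lborel. a * (wtd (\<lambda>z. F z * G z) w * kern z w) + b * (wtd (\<lambda>z. F z * H z) w * kern z w))"
      by (simp add: T fock_lincomb G H wtd_bproj distrib_right mult.assoc)
    also have "\<dots> = a * wtd (T G) z + b * wtd (T H) z"
      using i by (simp add: T G H wtd_bproj)
    finally show "T (\<lambda>z. a * G z + b * H z) z = a * T G z + b * T H z"
      by (simp only: wtd_lincomb [symmetric] wtd_eq_iff)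
  qed
  fix h :: "nat \<Rightarrow> complex^'n \<Rightarrow> complex" and B :: real
  assume h: "\<And>n. h n \<in> fock" "\<And>n. fock_norm (h n) \<le> B" "\<And>z. (\<lambda>n. h n z) \<longlonglongrightarrow> 0"
  show "(\<lambda>n. fock_norm (T (h n))) \<longlonglongrightarrow> 0"
    using toeplitz_norm_null_sequence [OF assms(1) F lim h] by (simp add: T h)
qed

section \<open>Passage to the phase space\<close>

text \<open>The product of a Gaussian and its translate by \<open>x\<close> is \<open>e^(-\<pi>|x|\<^sup>2/2)\<close> times a Gaussian of twice the
  exponent centred at \<open>x/2\<close>; its Fourier transform is again a Gaussian.\<close>

lemma cmod_stft_gauss0:
  fixes z :: "(real^'n) \<times> (real^'n)"
  shows "(cmod (stft gauss0 gauss0 z))\<^sup>2 = exp (- pi * (norm z)\<^sup>2)"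
proof (cases z)
  case (Pair x \<omega>)
  define c where "c = complex_of_real (2 powr (real CARD('n) / 2) * exp (- (pi / 2) * (norm x)\<^sup>2)) * exp (- \<i> * complex_of_real (2 * pi) * complex_of_real (\<omega> \<bullet> ((1/2) *\<^sub>R x)))"
  let ?h = "\<lambda>s. c * (complex_of_real (exp (- (2 * pi) * (norm s)\<^sup>2)) * exp (- \<i> * complex_of_real (2 * pi) * complex_of_real (\<omega> \<bullet> s)))"
  have [measurable]: "?h \<in> borel_measurable borel"
    by (intro borel_measurable_continuous_onI continuous_intros)
  have eq: "gauss0 t * cnj (gauss0 (t - x)) * exp (- 2 * complex_of_real pi * \<i> * complex_of_real (\<omega> \<bullet> t)) = ?h (t + - ((1/2) *\<^sub>R x))" for t
  proof -
    have "- pi * (norm t)\<^sup>2 + - pi * (norm (t - x))\<^sup>2 = - (pi / 2) * (norm x)\<^sup>2 + - (2 * pi) * (norm (t + - ((1/2) *\<^sub>R x)))\<^sup>2"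
      unfolding power2_norm_eq_inner by (simp add: inner_diff inner_commute field_simps)
    then have 1: "exp (- pi * (norm t)\<^sup>2) * exp (- pi * (norm (t - x))\<^sup>2) = exp (- (pi / 2) * (norm x)\<^sup>2) * exp (- (2 * pi) * (norm (t + - ((1/2) *\<^sub>R x)))\<^sup>2)"
      by (simp only: exp_add [symmetric])
    have 2: "2 powr (real CARD('n) / 4) * 2 powr (real CARD('n) / 4) = (2::real) powr (real CARD('n) / 2)"
      by (simp add: powr_add [symmetric])
    have "gauss0 t * cnj (gauss0 (t - x)) = complex_of_real ((2 powr (real CARD('n) / 4) * 2 powr (real CARD('n) / 4)) * (exp (- pi * (norm t)\<^sup>2) * exp (- pi * (norm (t - x))\<^sup>2)))"
      by (simp add: gauss0_def)
    also have "\<dots> = complex_of_real (2 powr (real CARD('n) / 2) * exp (- (pi / 2) * (norm x)\<^sup>2)) * complex_of_real (exp (- (2 * pi) * (norm (t + - ((1/2) *\<^sub>R x)))\<^sup>2))"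
      unfolding 1 2 by (simp add: mult.assoc)
    finally have 3: "gauss0 t * cnj (gauss0 (t - x)) = \<dots>" .
    have "- 2 * complex_of_real pi * \<i> * complex_of_real (\<omega> \<bullet> t)
        = - \<i> * complex_of_real (2 * pi) * complex_of_real (\<omega> \<bullet> ((1/2) *\<^sub>R x)) + - \<i> * complex_of_real (2 * pi) * complex_of_real (\<omega> \<bullet> (t + - ((1/2) *\<^sub>R x)))"
      by (simp add: inner_diff_right algebra_simps)
    then have 4: "exp (- 2 * complex_of_real pi * \<i> * complex_of_real (\<omega> \<bullet> t))
        = exp (- \<i> * complex_of_real (2 * pi) * complex_of_real (\<omega> \<bullet> ((1/2) *\<^sub>R x))) * exp (- \<i> * complex_of_real (2 * pi) * complex_of_real (\<omega> \<bullet> (t + - ((1/2) *\<^sub>R x))))"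
      by (simp only: exp_add [symmetric])
    show ?thesis unfolding 3 4 c_def by (simp only: mult_ac)
  qed
  have "stft gauss0 gauss0 z = (LINT t|lebesgue. ?h (t + - ((1/2) *\<^sub>R x)))"
    unfolding Pair stft_def case_prod_conv eq ..
  also have "\<dots> = (LINT t|lborel. ?h (t + - ((1/2) *\<^sub>R x)))"
    by (rule integral_completion) measurable
  also have "\<dots> = (LINT t|lborel. ?h t)"
    by (rule integral_lborel_plus) measurable
  also have "\<dots> = c * (complex_of_real (sqrt (1 / 2) ^ CARD('n)) * exp (- complex_of_real (pi / 2 * (norm \<omega>)\<^sup>2)))"
  proof -
    have "(LINT s|lborel. complex_of_real (exp (- (2 * pi) * (norm s)\<^sup>2)) * exp (- \<i> * complex_of_real (2 * pi) * complex_of_real (\<omega> \<bullet> s)))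
      = complex_of_real (sqrt (pi / (2 * pi)) ^ DIM(real^'n)) * exp ((- \<i> * complex_of_real (2 * pi))\<^sup>2 * complex_of_real ((norm \<omega>)\<^sup>2 / (4 * (2 * pi))))"
      by (rule gaussian_laplace_transform) simp
    also have "(- \<i> * complex_of_real (2 * pi))\<^sup>2 * complex_of_real ((norm \<omega>)\<^sup>2 / (4 * (2 * pi))) = - complex_of_real (pi / 2 * (norm \<omega>)\<^sup>2)"
      by (simp add: power2_eq_square field_simps)
    finally show ?thesis by simp
  qed
  finally have "cmod (stft gauss0 gauss0 z) = 2 powr (real CARD('n) / 2) * exp (- (pi / 2) * (norm x)\<^sup>2) * (sqrt (1 / 2) ^ CARD('n) * exp (- (pi / 2) * (norm \<omega>)\<^sup>2))"
    by (simp add: c_def norm_mult norm_power)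
  moreover have "2 powr (real CARD('n) / 2) * sqrt (1 / 2) ^ CARD('n) = 1"
  proof -
    have "2 powr (real CARD('n) / 2) = sqrt 2 ^ CARD('n)"
      by (simp add: powr_half_sqrt_powr powr_realpow real_sqrt_power flip: powr_powr)
    then show ?thesis by (simp add: power_mult_distrib [symmetric] real_sqrt_mult [symmetric])
  qed
  ultimately have "cmod (stft gauss0 gauss0 z) = exp (- (pi / 2) * (norm x)\<^sup>2) * exp (- (pi / 2) * (norm \<omega>)\<^sup>2)"
    by (simp add: mult_ac)
  also have "\<dots> = exp (- (pi / 2) * (norm z)\<^sup>2)"
    by (simp add: Pair norm_Pair exp_add [symmetric] algebra_simps)
  finally show ?thesis by (simp add: exp_double [symmetric])
qed

lemma berezin_eq:
  fixes F :: "complex^'n \<Rightarrow> complex"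
  assumes [measurable]: "F \<in> borel_measurable borel"
  shows "berezin F w = (LINT u|lborel. F u * complex_of_real (exp (- pi * (norm (w - u))\<^sup>2)))"
proof -
  have "(LINT u|lborel. F u * complex_of_real (exp (- pi * (norm (w - u))\<^sup>2)))
      = (LINT y|lborel. F (y + w) * complex_of_real (exp (- pi * (norm (w - (y + w)))\<^sup>2)))"
    by (rule integral_lborel_plus [of "\<lambda>u. F u * complex_of_real (exp (- pi * (norm (w - u))\<^sup>2))" w, symmetric]) measurable
  then show ?thesis by (simp add: berezin_def gweight_def add.commute)
qed

text \<open>Expanding \<open>|w - u|\<^sup>2\<close> writes the transform as \<open>e^(-\<pi>|w|\<^sup>2)\<close> times an exponential integral in \<open>w\<close>.\<close>

lemma continuous_berezin:
  fixes F :: "complex^'n \<Rightarrow> complex"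
  assumes [measurable]: "F \<in> borel_measurable borel" and F: "\<And>z. cmod (F z) \<le> C"
  shows "continuous_on UNIV (berezin F)"
proof -
  interpret exp_integral "\<lambda>u. F u * gweight u" "\<lambda>w u. complex_of_real (2 * pi * (w \<bullet> u))" C 0 pi "2 * pi"
  proof (rule exp_integral.intro)
    show "cmod (F u * gweight u) \<le> C * exp (0 * norm u - pi * (norm u)\<^sup>2)" for u
      using F [of u] by (simp add: norm_mult gweight_def)
    show "linear (\<lambda>w. complex_of_real (2 * pi * (w \<bullet> u)))" for u :: "complex^'n"
    proof (rule linearI)
      show "complex_of_real (2 * pi * ((r *\<^sub>R b) \<bullet> u)) = r *\<^sub>R complex_of_real (2 * pi * (b \<bullet> u))" for r b
        by (simp only: inner_scaleR_left) (simp add: scaleR_conv_of_real)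
    qed (simp add: inner_add_left distrib_left)
    show "cmod (complex_of_real (2 * pi * (w \<bullet> u))) \<le> 2 * pi * norm w * norm u" for w u :: "complex^'n"
      using Cauchy_Schwarz_ineq2 [of w u] by (simp add: norm_mult abs_mult)
  qed simp_all
  have "berezin F w = complex_of_real (exp (- pi * (norm w)\<^sup>2)) * (LINT u|lborel. F u * gweight u * exp (complex_of_real (2 * pi * (w \<bullet> u))))" for w
  proof -
    have "complex_of_real (exp (- pi * (norm (w - u))\<^sup>2)) = complex_of_real (exp (- pi * (norm w)\<^sup>2)) * (gweight u * exp (complex_of_real (2 * pi * (w \<bullet> u))))" for u
    proof -
      have "- pi * (norm (w - u))\<^sup>2 = - pi * (norm w)\<^sup>2 + (- pi * (norm u)\<^sup>2 + 2 * pi * (w \<bullet> u))"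
        by (simp add: norm_diff_squared Re_cdot algebra_simps)
      then show ?thesis unfolding gweight_def exp_of_real of_real_mult [symmetric] exp_add [symmetric] by simp
    qed
    then have "F u * complex_of_real (exp (- pi * (norm (w - u))\<^sup>2)) = complex_of_real (exp (- pi * (norm w)\<^sup>2)) * (F u * gweight u * exp (complex_of_real (2 * pi * (w \<bullet> u))))" for u
      by (simp only: mult_ac)
    then show ?thesis unfolding berezin_eq [OF assms(1)] by (simp only: integral_mult_right_zero)
  qed
  moreover have "continuous_on UNIV (\<lambda>w. LINT u|lborel. F u * gweight u * exp (complex_of_real (2 * pi * (w \<bullet> u))))"
    by (intro continuous_at_imp_continuous_on ballI has_derivative_continuous [OF has_derivative_integral])
  ultimately show ?thesis
    by (simp only: cong: continuous_on_cong) (intro continuous_intros; simp)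
qed

definition phase_coord :: "(real^'n) \<times> (real^'n) \<Rightarrow> complex^'n" where
  "phase_coord = (\<lambda>(x, \<omega>). \<chi> j. complex_of_real (x $ j) - \<i> * complex_of_real (\<omega> $ j))"

lemma linear_phase_coord: "linear phase_coord"
  by (rule linearI) (auto simp: phase_coord_def vec_eq_iff complex_eq_iff)

lemma norm_phase_coord: "norm (phase_coord p) = norm p"
proof (cases p)
  case (Pair x \<omega>)
  have "(norm (phase_coord p))\<^sup>2 = (\<Sum>j\<in>UNIV. (cmod (complex_of_real (x $ j) - \<i> * complex_of_real (\<omega> $ j)))\<^sup>2)"
    by (simp add: phase_coord_def Pair norm_vec_def L2_set_def sum_nonneg)
  also have "\<dots> = (\<Sum>j\<in>UNIV. (x $ j)\<^sup>2) + (\<Sum>j\<in>UNIV. (\<omega> $ j)\<^sup>2)"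
    by (simp add: cmod_power2 sum.distrib)
  also have "\<dots> = (norm p)\<^sup>2"
    by (simp add: Pair norm_Pair norm_vec_def L2_set_def sum_nonneg)
  finally show ?thesis by simp
qed

lemma surj_phase_coord: "surj (phase_coord :: (real^'n) \<times> (real^'n) \<Rightarrow> complex^'n)"
proof (rule surjI)
  show "phase_coord (\<chi> j. Re (z $ j), \<chi> j. - Im (z $ j)) = z" for z :: "complex^'n"
    by (simp add: phase_coord_def vec_eq_iff complex_eq_iff)
qed

text \<open>A representative that is Borel and bounded everywhere avoids exceptional sets in the
  pointwise estimates.\<close>

lemma Linfty_borel_representative:
  fixes F :: "'a::euclidean_space \<Rightarrow> complex"
  assumes "F \<in> Linfty"
  obtains G C where "G \<in> borel_measurable borel" "\<And>z. cmod (G z) \<le> C" "AE z in lborel. F z = G z"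
proof -
  obtain C where m: "F \<in> borel_measurable lebesgue" and C: "AE z in lebesgue. cmod (F z) \<le> C"
    using assms by (auto simp: Linfty_def)
  have "(\<lambda>z. Re (F z)) \<in> borel_measurable lebesgue" "(\<lambda>z. Im (F z)) \<in> borel_measurable lebesgue"
    using m by measurable
  from this [THEN completion_ex_borel_measurable_real]
  obtain A B where [measurable]: "A \<in> borel_measurable borel" "B \<in> borel_measurable borel"
    and AB: "AE z in lborel. Re (F z) = A z" "AE z in lborel. Im (F z) = B z" by auto
  \<comment> \<open>the cut-off makes the bound hold everywhere\<close>
  define G where "G z = (if cmod (Complex (A z) (B z)) \<le> C then Complex (A z) (B z) else 0)" for z
  have [measurable]: "(\<lambda>z. Complex (A z) (B z)) \<in> borel_measurable borel"
    unfolding Complex_eq by measurable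
  have "G \<in> borel_measurable borel" unfolding G_def [abs_def] by measurable
  moreover have "cmod (G z) \<le> max C 0" for z by (simp add: G_def le_max_iff_disj)
  moreover have "AE z in lborel. F z = G z"
    using AB C [unfolded AE_completion_iff]
  proof eventually_elim
    case (elim z)
    then have "Complex (A z) (B z) = F z" by (simp add: complex_eq_iff)
    with elim show ?case by (simp add: G_def)
  qed
  ultimately show ?thesis using that by blast
qed

text \<open>Changing the symbol on a null set changes no inner product, hence not the projection.\<close>

lemma toeplitz_eq_bproj:
  fixes F G :: "complex^'n \<Rightarrow> complex"
  assumes F: "F \<in> borel_measurable lebesgue" and G [measurable]: "G \<in> borel_measurable borel"
    and C: "\<And>z. cmod (G z) \<le> C" and FG: "AE z in lborel. F z = G z" and H: "H \<in> fock"
  shows "toeplitz F H = bproj (\<lambda>z. G z * H z)"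
proof -
  have sets: "sets fock_measure = sets (lebesgue :: (complex^'n) measure)" by (simp add: fock_measure_def)
  have bm: "A \<in> borel_measurable fock_measure" if "A \<in> borel_measurable borel" for A :: "complex^'n \<Rightarrow> complex"
    unfolding measurable_cong_sets [OF sets refl] using that by (intro measurable_completion) simp
  have Fm: "F \<in> borel_measurable fock_measure"
    unfolding measurable_cong_sets [OF sets refl] by (rule F)
  have "(\<lambda>z::complex^'n. ennreal (exp (- pi * (norm z)\<^sup>2))) \<in> borel_measurable lebesgue"
    by (intro measurable_completion) simp
  then have ae: "AE z in fock_measure. F z = G z"
    unfolding fock_measure_def using AE_completion [OF FG] by (subst AE_density) auto
  have "fock_inner (\<lambda>z. F z * H z - K z) A = fock_inner (\<lambda>z. G z * H z - K z) A" if "K \<in> fock" "A \<in> fock" for K A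
    unfolding fock_inner_def
  proof (rule integral_cong_AE)
    note [measurable] = Fm bm [OF G] bm [OF fock_measurable [OF H]] bm [OF fock_measurable [OF that(1)]] bm [OF fock_measurable [OF that(2)]]
    show "(\<lambda>z. (F z * H z - K z) * cnj (A z)) \<in> borel_measurable fock_measure"
      "(\<lambda>z. (G z * H z - K z) * cnj (A z)) \<in> borel_measurable fock_measure" by measurable
    show "AE z in fock_measure. (F z * H z - K z) * cnj (A z) = (G z * H z - K z) * cnj (A z)"
      using ae by eventually_elim simp
  qed
  then have "fock_proj (\<lambda>z. F z * H z) = fock_proj (\<lambda>z. G z * H z)"
    unfolding fock_proj_def by (intro arg_cong [of _ _ The] ext) (auto cong: conj_cong)
  then show ?thesis
    unfolding toeplitz_def using fock_proj_bounded_mult [OF G C H] by simp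
qed

lemma convolution_eq_berezin:
  fixes F G :: "complex^'n \<Rightarrow> complex"
  assumes G [measurable]: "G \<in> borel_measurable borel" and FG: "AE z in lborel. F z = G z"
  shows "convolution (\<lambda>p. F (phase_coord p)) (\<lambda>p. complex_of_real (exp (- pi * (norm p)\<^sup>2))) z = berezin G (phase_coord z)"
proof -
  have cont: "continuous_on UNIV (phase_coord :: (real^'n) \<times> (real^'n) \<Rightarrow> complex^'n)"
    by (rule linear_continuous_on) (simp add: linear_conv_bounded_linear [symmetric] linear_phase_coord)
  have pm [measurable]: "(phase_coord :: (real^'n) \<times> (real^'n) \<Rightarrow> complex^'n) \<in> borel_measurable borel"
    by (rule borel_measurable_continuous_onI [OF cont])
  have d: "distr lborel borel (phase_coord :: (real^'n) \<times> (real^'n) \<Rightarrow> complex^'n) = lborel"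
    by (rule distr_lborel_isometry [OF linear_phase_coord norm_phase_coord surj_phase_coord])
  have ae: "AE p in lborel. F (phase_coord p) = G (phase_coord (p :: (real^'n) \<times> (real^'n)))"
    using FG unfolding d [symmetric]
    by (rule AE_distrD [rotated]) simp
  let ?g = "\<lambda>w :: (real^'n) \<times> (real^'n). G (phase_coord w) * complex_of_real (exp (- pi * (norm (z - w))\<^sup>2))"
  have gm: "?g \<in> borel_measurable lebesgue"
    by (rule measurable_completion) measurable
  have ae': "AE w in lebesgue. ?g w = F (phase_coord w) * complex_of_real (exp (- pi * (norm (z - w))\<^sup>2))"
    using AE_completion [OF ae] by eventually_elim simp
  have fm: "(\<lambda>w. F (phase_coord w) * complex_of_real (exp (- pi * (norm (z - w))\<^sup>2))) \<in> borel_measurable lebesgue"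
    by (rule borel_measurable_AE [OF gm ae'])
  have "convolution (\<lambda>p. F (phase_coord p)) (\<lambda>p. complex_of_real (exp (- pi * (norm p)\<^sup>2))) z = (LINT w|lebesgue. ?g w)"
    unfolding convolution_def using ae' by (intro integral_cong_AE fm gm) auto
  also have "\<dots> = (LINT w|lborel. ?g w)"
    by (rule integral_completion) measurable
  also have "\<dots> = (LINT w|lborel. (\<lambda>u. G u * complex_of_real (exp (- pi * (norm (phase_coord z - u))\<^sup>2))) (phase_coord w))"
    by (simp add: linear_diff [OF linear_phase_coord, symmetric] norm_phase_coord)
  also have "\<dots> = (LINT u|lborel. G u * complex_of_real (exp (- pi * (norm (phase_coord z - u))\<^sup>2)))"
    by (rule integral_lborel_isometry [OF linear_phase_coord norm_phase_coord surj_phase_coord]) measurable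
  also have "\<dots> = berezin G (phase_coord z)" by (rule berezin_eq [OF G, symmetric])
  finally show ?thesis .
qed

lemma tendsto_phase_coord_iff:
  "((\<lambda>p. h (phase_coord p)) \<longlongrightarrow> l) at_infinity \<longleftrightarrow> (h \<longlongrightarrow> l) at_infinity"
  for h :: "complex^'n \<Rightarrow> complex"
proof -
  have "\<exists>p. phase_coord p = w" for w :: "complex^'n" using surj_phase_coord by (metis surjD)
  then have "(\<forall>p :: (real^'n) \<times> (real^'n). norm p \<ge> b \<longrightarrow> dist (h (phase_coord p)) l < e) \<longleftrightarrow> (\<forall>w. norm w \<ge> b \<longrightarrow> dist (h w) l < e)" for b e
    by (metis norm_phase_coord)
  then show ?thesis unfolding Lim_at_infinity by simp
qed

theorem corollary5p6:
  fixes F :: "complex^'n \<Rightarrow> complex"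
    and f :: "(real^'n) \<times> (real^'n) \<Rightarrow> complex"
  assumes F: "F \<in> Linfty"
    and f: "\<And>x \<omega>. f (x, \<omega>) = F (\<chi> j. complex_of_real (x $ j) - \<i> * complex_of_real (\<omega> $ j))"
  shows "(fock_compact_operator (toeplitz F) \<longleftrightarrow>
           convolution f (\<lambda>z. complex_of_real ((cmod (stft gauss0 gauss0 z))\<^sup>2)) \<in> C0) \<and>
         (\<forall>z :: (real^'n) \<times> (real^'n).
           (cmod (stft gauss0 gauss0 z))\<^sup>2 = exp (- pi * (norm z)\<^sup>2))"
proof
  obtain G C where G: "G \<in> borel_measurable borel" and C: "\<And>z. cmod (G z) \<le> C" and FG: "AE z in lborel. F z = G z"
    using Linfty_borel_representative [OF F] by metis
  have T: "toeplitz F H = bproj (\<lambda>z. G z * H z)" if "H \<in> fock" for H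
    using F by (intro toeplitz_eq_bproj [OF _ G C FG that]) (simp add: Linfty_def)
  have f_eq: "f = (\<lambda>p. F (phase_coord p))"
    by (auto simp: fun_eq_iff f phase_coord_def)
  have conv: "convolution f (\<lambda>z. complex_of_real ((cmod (stft gauss0 gauss0 z))\<^sup>2)) = (\<lambda>z. berezin G (phase_coord z))"
    unfolding f_eq cmod_stft_gauss0 by (rule ext) (rule convolution_eq_berezin [OF G FG])
  have "continuous_on UNIV (phase_coord :: (real^'n) \<times> (real^'n) \<Rightarrow> complex^'n)"
    by (rule linear_continuous_on) (simp add: linear_conv_bounded_linear [symmetric] linear_phase_coord)
  then have cont: "continuous_on UNIV (\<lambda>z :: (real^'n) \<times> (real^'n). berezin G (phase_coord z))"
    by (rule continuous_on_compose2 [OF continuous_berezin [OF G C]]) auto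
  have "fock_compact_operator (toeplitz F) \<longleftrightarrow> (berezin G \<longlongrightarrow> 0) at_infinity"
    using berezin_vanishes_if_compact [OF G T] compact_if_berezin_vanishes [OF G C T] by blast
  then show "fock_compact_operator (toeplitz F) \<longleftrightarrow>
      convolution f (\<lambda>z. complex_of_real ((cmod (stft gauss0 gauss0 z))\<^sup>2)) \<in> C0"
    unfolding conv C0_def using cont by (simp add: tendsto_phase_coord_iff)
  show "\<forall>z :: (real^'n) \<times> (real^'n). (cmod (stft gauss0 gauss0 z))\<^sup>2 = exp (- pi * (norm z)\<^sup>2)"
    by (simp add: cmod_stft_gauss0)
qed

end
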